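(* Let $n\ge 2$ and $1\le k\le n$ be integers. Suppose $p,q$ are real numbers with $p\ge 1$, $q\le k+1$ and at least one of these inequalities is strict. Then any smooth strictly convex solution $M$ to $$u^{1-p}r^{q-k-1}P_k(W)=1\quad\text{on }\mathbb{S}^n$$ must be an origin-centred sphere.
   Context: $(\mathbb{S}^n,g_0,\nabla)$ is the unit sphere in $\mathbb{R}^{n+1}$ with its standard metric and Levi-Civita connection. A smooth strictly convex solution $M$ means a smooth closed hypersurface $M\subset\mathbb{R}^{n+1}$ with strictly positive Gauss curvature that bounds a convex body $K$ containing the origin in its interior, and such that the equation holds with the following notation. $u:\mathbb{S}^n\to(0,\infty)$ is the support function of $K$; $X(z)=u(z)z+\nabla u(z)$ is the point of $M$ with unit outer normal $z$; $r(z)=|X(z)|=\sqrt{u^2+|\nabla u|^2}$ is the radial function viewed on $\mathbb{S}^n$ via the Gauss map; $W=\nabla^2u+u g_0$. $P_k(W)=\binom{n}{k}^{-1}\sum_{j_1<\cdots<j_k}\lambda_{j_1}\cdots\lambda_{j_k}$, where $\lambda_1,\dots,\lambda_n$ are the eigenvalues of $W$ with respect to $g_0$. *)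

theory Defs
  imports "HOL-Analysis.Analysis"
begin

section \<open>Smooth hypersurfaces\<close>

text \<open>The following two definitions are meant for open sets \<open>U\<close>.\<close>

fun Ck_on :: "nat \<Rightarrow> ('a::real_normed_vector \<Rightarrow> 'b::real_normed_vector) \<Rightarrow> 'a set \<Rightarrow> bool" where
  "Ck_on 0 f U \<longleftrightarrow> continuous_on U f"
| "Ck_on (Suc m) f U \<longleftrightarrow>
     (\<forall>x\<in>U. f differentiable (at x)) \<and> (\<forall>v. Ck_on m (\<lambda>x. frechet_derivative f (at x) v) U)"

definition smooth_on :: "('a::real_normed_vector \<Rightarrow> 'b::real_normed_vector) \<Rightarrow> 'a set \<Rightarrow> bool" where
  "smooth_on f U \<longleftrightarrow> (\<forall>m. Ck_on m f U)"

text \<open>Embedded hypersurfaces without boundary, given locally as regular level sets.\<close>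

definition smooth_hypersurface :: "'a::euclidean_space set \<Rightarrow> bool" where
  "smooth_hypersurface M \<longleftrightarrow>
     (\<forall>x\<in>M. \<exists>U f. open U \<and> x \<in> U \<and> smooth_on (f :: 'a \<Rightarrow> real) U \<and>
        (\<forall>y\<in>U. frechet_derivative f (at y) \<noteq> (\<lambda>v. 0)) \<and> M \<inter> U = {y \<in> U. f y = 0})"


section \<open>Eigenvalues of a symmetric bilinear form relative to the inner product\<close>

definition form_eigenspace :: "'a::euclidean_space set \<Rightarrow> ('a \<Rightarrow> 'a \<Rightarrow> real) \<Rightarrow> real \<Rightarrow> 'a set" where
  "form_eigenspace T B l = {v \<in> T. \<forall>w\<in>T. B v w = l * (v \<bullet> w)}"

text \<open>
  The eigenvalues of the form \<open>B\<close> on the subspace \<open>T\<close> in increasing order, each repeated according to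
  the dimension of its eigenspace. For symmetric \<open>B\<close> the list has length \<open>dim T\<close>.
\<close>

definition form_eigenvalues :: "'a::euclidean_space set \<Rightarrow> ('a \<Rightarrow> 'a \<Rightarrow> real) \<Rightarrow> real list" where
  "form_eigenvalues T B =
     (THE ls. sorted ls \<and> (\<forall>l. count_list ls l = dim (form_eigenspace T B l)))"

definition normalized_esym :: "nat \<Rightarrow> nat \<Rightarrow> real list \<Rightarrow> real" where
  "normalized_esym n k ls =
     (\<Sum>J | J \<subseteq> {..<n} \<and> card J = k. \<Prod>j\<in>J. ls ! j) / real (n choose k)"


section \<open>Curvature of the boundary of a convex body\<close>

definition convex_body :: "'a::euclidean_space set \<Rightarrow> bool" where
  "convex_body K \<longleftrightarrow> compact K \<and> convex K \<and> interior K \<noteq> {}"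

definition outer_normal :: "'a::euclidean_space set \<Rightarrow> 'a \<Rightarrow> 'a" where
  "outer_normal K x = (THE \<nu>. norm \<nu> = 1 \<and> (\<forall>y\<in>K. (y - x) \<bullet> \<nu> \<le> 0))"

text \<open>
  Derivatives at a point of a hypersurface \<open>M\<close>, here and for the unit sphere below, are taken
  \<open>at x within M\<close>. Such a derivative is determined only on tangent vectors (where it is the
  derivative along curves in \<open>M\<close>), so it must never be applied to any other vector.
\<close>

definition second_fundamental_form :: "'a::euclidean_space set \<Rightarrow> 'a \<Rightarrow> 'a \<Rightarrow> 'a \<Rightarrow> real" where
  "second_fundamental_form K x v w =
     frechet_derivative (outer_normal K) (at x within frontier K) v \<bullet> w"

text \<open>
  The product of the principal curvatures; with the outer normal \<open>\<nu>\<close> and the shape operator \<open>d\<nu>\<close>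
  the unit sphere has principal curvatures \<open>+1\<close>.
\<close>

definition gauss_curvature :: "'a::euclidean_space set \<Rightarrow> 'a \<Rightarrow> real" where
  "gauss_curvature K x =
     prod_list (form_eigenvalues {v. v \<bullet> outer_normal K x = 0} (second_fundamental_form K x))"

text \<open>\<open>M\<close> is a closed hypersurface since the frontier of the compact set \<open>K\<close> is compact.\<close>

definition smooth_strictly_convex_around_0 ::
    "'a::euclidean_space set \<Rightarrow> 'a set \<Rightarrow> bool" where
  "smooth_strictly_convex_around_0 M K \<longleftrightarrow>
     smooth_hypersurface M \<and> convex_body K \<and> M = frontier K \<and> 0 \<in> interior K \<and>
     (\<forall>x\<in>M. gauss_curvature K x > 0)"


section \<open>Calculus on the unit sphere\<close>

abbreviation unit_sphere :: "'a::euclidean_space set" where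
  "unit_sphere \<equiv> sphere 0 1"

definition sphere_tangent :: "'a::euclidean_space \<Rightarrow> 'a set" where
  "sphere_tangent z = {v. v \<bullet> z = 0}"

definition sphere_grad :: "('a::euclidean_space \<Rightarrow> real) \<Rightarrow> 'a \<Rightarrow> 'a" where
  "sphere_grad f z = (THE g. g \<in> sphere_tangent z \<and>
     (\<forall>v\<in>sphere_tangent z. g \<bullet> v = frechet_derivative f (at z within unit_sphere) v))"

text \<open>
  The Levi-Civita connection of the metric induced from the ambient space: the tangential part of
  the derivative of the tangent field \<open>Y\<close> in the direction \<open>v\<close>.
\<close>

definition sphere_connection ::
    "('a::euclidean_space \<Rightarrow> 'a) \<Rightarrow> 'a \<Rightarrow> 'a \<Rightarrow> 'a" where
  "sphere_connection Y z v =
     (let d = frechet_derivative Y (at z within unit_sphere) v in d - (d \<bullet> z) *\<^sub>R z)"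

definition sphere_hessian :: "('a::euclidean_space \<Rightarrow> real) \<Rightarrow> 'a \<Rightarrow> 'a \<Rightarrow> 'a \<Rightarrow> real" where
  "sphere_hessian f z v w = sphere_connection (sphere_grad f) z v \<bullet> w"


section \<open>The support function and derived quantities\<close>

definition support_function :: "'a::euclidean_space set \<Rightarrow> 'a \<Rightarrow> real" where
  "support_function K z = (SUP x\<in>K. x \<bullet> z)"

definition inverse_gauss_map :: "('a::euclidean_space \<Rightarrow> real) \<Rightarrow> 'a \<Rightarrow> 'a" where
  "inverse_gauss_map u z = u z *\<^sub>R z + sphere_grad u z"

definition radial_function :: "('a::euclidean_space \<Rightarrow> real) \<Rightarrow> 'a \<Rightarrow> real" where
  "radial_function u z = norm (inverse_gauss_map u z)"

definition W_form :: "('a::euclidean_space \<Rightarrow> real) \<Rightarrow> 'a \<Rightarrow> 'a \<Rightarrow> 'a \<Rightarrow> real" where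
  "W_form u z v w = sphere_hessian u z v w + u z * (v \<bullet> w)"

definition P_W :: "nat \<Rightarrow> nat \<Rightarrow> ('a::euclidean_space \<Rightarrow> real) \<Rightarrow> 'a \<Rightarrow> real" where
  "P_W n k u z = normalized_esym n k (form_eigenvalues (sphere_tangent z) (W_form u z))"

end

theory Submission
  imports Defs
begin

text \<open>
  With \<open>a = p - 1 \<ge> 0\<close> and \<open>b = k + 1 - q \<ge> 0\<close> the equation reads \<open>P\<^sub>k = u\<^sup>a r\<^sup>b\<close>. Since \<open>r \<nabla>r = W \<nabla>u\<close>
  and \<open>W > 0\<close>, the function \<open>\<nabla>P\<^sub>k \<bullet> \<nabla>u\<close> is nonnegative and vanishes only where \<open>\<nabla>u = 0\<close>. Since
  \<open>\<Delta>u = n (P\<^sub>1 - u)\<close>, integrating the divergence of \<open>P\<^sub>k \<nabla>u\<close> over the sphere shows that the integral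
  of \<open>P\<^sub>k (P\<^sub>1 - u)\<close> is at most \<open>0\<close>, with equality only if \<open>u\<close> is constant. Conversely this integral
  is nonnegative: for \<open>k < n\<close> the integrals of \<open>u P\<^sub>k\<close> and \<open>P\<^sub>k\<^sub>+\<^sub>1\<close> agree (Minkowski) and \<open>P\<^sub>k\<^sub>+\<^sub>1 \<le> P\<^sub>1 P\<^sub>k\<close>
  (Maclaurin); for \<open>k = n\<close> it is the Heintze-Karcher inequality, proved as by Montiel and Ros by
  covering the body with the inward normals of length at most the smallest radius of curvature.

  Functions on the sphere are extended to functions of degree zero on the punctured space, and
  integrals over the sphere are replaced by integrals over the unit ball.
\<close>

section \<open>Change of variables\<close>

text \<open>The available regularity shapes the argument. The inverse Gauss map is obtained as a C^1
  map, so \<open>W\<close> is a continuous form, and single eigenvalues need not be differentiable.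
  The divergence identity nevertheless asks for the gradient of P_k. It exists because the equation
  equates P_k with an expression in \<open>u\<close> and its first derivatives; third derivatives of
  \<open>u\<close> never appear. Symmetric functions of the eigenvalues are reached as coefficients,
  in a shift \<open>t\<close>, of determinants with continuous entries.

  Positive Gauss curvature enters as invertibility of the shape operator. This makes the inverse
  Gauss map single-valued and differentiable, and it makes \<open>W\<close> positive definite rather
  than just nonnegative.

  The Minkowski formulas come from volumes alone: two radial profiles parametrize the same parallel
  body, and over a ball, unlike over a sphere, they carry different constants. The divergence
  theorem is applied with a radial cutoff supported in an annulus, which avoids both the origin and
  a boundary; its derivative drops out because the field is tangential.\<close>

text \<open>The change of variables theorems of the library ask for a well-ordered index type. A copy of
  an arbitrary finite type can be given such an order.\<close>

typedef 'a ordered_copy = "UNIV :: 'a set" by simp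

lemma bij_Rep_ordered_copy: "bij Rep_ordered_copy"
  by (metis Abs_ordered_copy_inverse Rep_ordered_copy_inverse UNIV_I bijI')

instance ordered_copy :: (finite) finite
proof
  show "finite (UNIV :: 'a ordered_copy set)"
    using bij_Rep_ordered_copy by (metis bij_betw_finite finite)
qed

instantiation ordered_copy :: (finite) wellorder
begin

definition copy_index :: "'a ordered_copy \<Rightarrow> nat" where
  "copy_index = (SOME f. inj f)"

definition less_eq_ordered_copy :: "'a ordered_copy \<Rightarrow> 'a ordered_copy \<Rightarrow> bool" where
  "less_eq_ordered_copy x y \<longleftrightarrow> copy_index x \<le> copy_index y"

definition less_ordered_copy :: "'a ordered_copy \<Rightarrow> 'a ordered_copy \<Rightarrow> bool" where
  "less_ordered_copy x y \<longleftrightarrow> copy_index x < copy_index y"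

lemma inj_copy_index: "inj (copy_index :: 'a ordered_copy \<Rightarrow> nat)"
proof -
  have "\<exists>f :: 'a ordered_copy \<Rightarrow> nat. inj f"
    using finite_imp_inj_to_nat_seg[of "UNIV :: 'a ordered_copy set"] by auto
  then show ?thesis unfolding copy_index_def by (rule someI_ex)
qed

instance
proof
  fix x y z :: "'a ordered_copy" and P
  show "x < y \<longleftrightarrow> x \<le> y \<and> \<not> y \<le> x" "x \<le> x" "x \<le> y \<Longrightarrow> y \<le> z \<Longrightarrow> x \<le> z"
    "x \<le> y \<Longrightarrow> y \<le> x \<Longrightarrow> x = y" "x \<le> y \<or> y \<le> x"
    using inj_copy_index by (auto simp: less_eq_ordered_copy_def less_ordered_copy_def inj_eq)
  show "P x" if "\<And>x. (\<And>y. y < x \<Longrightarrow> P y) \<Longrightarrow> P x"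
  proof (induction x rule: measure_induct_rule[of copy_index])
    case (less x)
    show ?case by (rule that) (use less in \<open>simp add: less_ordered_copy_def\<close>)
  qed
qed

end

definition to_copy :: "real^'d \<Rightarrow> real^('d ordered_copy)" where
  "to_copy x = (\<chi> i. x $ Rep_ordered_copy i)"

definition of_copy :: "real^('d ordered_copy) \<Rightarrow> real^'d" where
  "of_copy x = (\<chi> i. x $ Abs_ordered_copy i)"

lemma of_to_copy [simp]: "of_copy (to_copy x) = x"
  by (simp add: of_copy_def to_copy_def vec_eq_iff Abs_ordered_copy_inverse)

lemma to_of_copy [simp]: "to_copy (of_copy x) = x"
  by (simp add: of_copy_def to_copy_def vec_eq_iff Rep_ordered_copy_inverse)

lemma linear_to_copy: "linear to_copy" and linear_of_copy: "linear of_copy"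
  by (auto intro!: linearI simp: to_copy_def of_copy_def vec_eq_iff)

lemma bounded_linear_to_copy: "bounded_linear (to_copy :: real^'d::finite \<Rightarrow> _)"
  and bounded_linear_of_copy: "bounded_linear (of_copy :: _ \<Rightarrow> real^'d::finite)"
  by (simp_all add: linear_to_copy linear_of_copy flip: linear_conv_bounded_linear)

lemma measurable_to_copy [measurable]: "(to_copy :: real^'d::finite \<Rightarrow> _) \<in> borel_measurable borel"
  and measurable_of_copy [measurable]: "(of_copy :: _ \<Rightarrow> real^'d::finite) \<in> borel_measurable borel"
  by (rule borel_measurable_continuous_onI[OF linear_continuous_on],
      simp add: bounded_linear_to_copy bounded_linear_of_copy)+

text \<open>Images under one map are preimages under the other, which makes them Borel.\<close>

lemma vimage_of_copy: "of_copy -` S = to_copy ` S" and vimage_to_copy: "to_copy -` V = of_copy ` V"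
proof -
  show "of_copy -` S = to_copy ` S"
  proof safe
    fix x assume "of_copy x \<in> S"
    then have "to_copy (of_copy x) \<in> to_copy ` S" by (rule imageI)
    then show "x \<in> to_copy ` S" by simp
  qed auto
  show "to_copy -` V = of_copy ` V"
  proof safe
    fix x assume "to_copy x \<in> V"
    then have "of_copy (to_copy x) \<in> of_copy ` V" by (rule imageI)
    then show "x \<in> of_copy ` V" by simp
  qed auto
qed

text \<open>\<open>of_copy\<close> permutes coordinates, so the preimage of a box is a box with the
  same side lengths, and values on boxes identify Lebesgue measure.\<close>

lemma lborel_distr_of_copy: "distr lborel borel of_copy = (lborel :: (real^'d::finite) measure)"
proof (rule lborel_eqI[symmetric])
  fix l u :: "real^'d"
  assume le: "\<And>b. b \<in> Basis \<Longrightarrow> l \<bullet> b \<le> u \<bullet> b"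
  have le': "l $ i \<le> u $ i" for i
    using le[of "axis i 1"] by (auto simp: inner_axis axis_in_Basis_iff)
  have all_copy: "(\<forall>i :: 'd ordered_copy. P (Rep_ordered_copy i)) \<longleftrightarrow> (\<forall>i. P i)" for P
    using bij_is_surj[OF bij_Rep_ordered_copy] by (metis surjD)
  have "of_copy y \<in> box l u \<longleftrightarrow> y \<in> box (to_copy l) (to_copy u)" for y
    unfolding mem_box_cart of_copy_def to_copy_def
    using all_copy[of "\<lambda>i. l $ i < y $ Abs_ordered_copy i \<and> y $ Abs_ordered_copy i < u $ i"]
    by (simp add: Rep_ordered_copy_inverse)
  then have "of_copy -` box l u = box (to_copy l) (to_copy u)"
    by blast
  moreover have "emeasure lborel (box (to_copy l) (to_copy u)) = ennreal (\<Prod>i\<in>UNIV. (u - l) $ Rep_ordered_copy i)"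
    by (subst emeasure_lborel_box)
       (auto simp: Basis_vec_def inner_axis to_copy_def le' UNION_singleton_eq_range
         prod.reindex axis_eq_axis inj_on_def)
  moreover have "(\<Prod>i\<in>UNIV. (u - l) $ Rep_ordered_copy i) = (\<Prod>i\<in>UNIV. (u - l) $ i)"
    by (rule prod.reindex_bij_betw[OF bij_Rep_ordered_copy])
  moreover have "(\<Prod>b\<in>Basis. (u - l) \<bullet> b) = (\<Prod>i\<in>UNIV. (u - l) $ i)"
    by (simp add: Basis_vec_def inner_axis UNION_singleton_eq_range
         prod.reindex axis_eq_axis inj_on_def)
  ultimately show "emeasure (distr lborel borel of_copy) (box l u) = ennreal (\<Prod>b\<in>Basis. (u - l) \<bullet> b)"
    by (subst emeasure_distr) auto
qed auto

text \<open>Conjugation by \<open>g\<close> is a sign-preserving bijection between the permutations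
  of the two index types; it only reorders the factors of each Leibniz term.\<close>

lemma det_reindex:
  fixes M :: "real^'d::finite^'d" and g :: "'e::finite \<Rightarrow> 'd"
  assumes g: "bij g"
  shows "det (\<chi> i j. M $ g i $ g j) = det M"
proof -
  have inj: "inj g" and surj: "surj g"
    using g by (auto simp: bij_is_inj bij_is_surj)
  have mp: "map_permutation UNIV g p (g i) = g (p i)" for p i
    unfolding map_permutation_def using inj surj by auto
  have bij: "bij_betw (map_permutation UNIV g) {p. p permutes UNIV} {p. p permutes UNIV}"
  proof (rule bij_betw_byWitness[where f' = "\<lambda>q. inv g \<circ> q \<circ> g"])
    show "\<forall>p\<in>{p. p permutes UNIV}. inv g \<circ> map_permutation UNIV g p \<circ> g = p"
      using inj by (auto simp: fun_eq_iff mp)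
    show "\<forall>q\<in>{q. q permutes UNIV}. map_permutation UNIV g (inv g \<circ> q \<circ> g) = q"
    proof safe
      fix q :: "'d \<Rightarrow> 'd"
      show "map_permutation UNIV g (inv g \<circ> q \<circ> g) = q"
      proof
        fix j
        obtain i where "j = g i" using surj by auto
        then show "map_permutation UNIV g (inv g \<circ> q \<circ> g) j = q j"
          by (simp add: mp surj_f_inv_f[OF surj])
      qed
    qed
    show "map_permutation UNIV g ` {p. p permutes UNIV} \<subseteq> {p. p permutes UNIV}"
      using map_permutation_permutes[of g UNIV UNIV] g by auto
    show "(\<lambda>q. inv g \<circ> q \<circ> g) ` {p. p permutes UNIV} \<subseteq> {p. p permutes UNIV}"
      using g by (auto simp: permutes_altdef intro!: bij_comp bij_imp_bij_inv)
  qed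
  have "det M = (\<Sum>q\<in>{p. p permutes UNIV}. of_int (sign q) * (\<Prod>j\<in>UNIV. M $ j $ q j))"
    by (simp add: det_def)
  also have "\<dots> = (\<Sum>p\<in>{p. p permutes UNIV}. of_int (sign (map_permutation UNIV g p)) *
      (\<Prod>j\<in>UNIV. M $ j $ map_permutation UNIV g p j))"
    by (rule sum.reindex_bij_betw[OF bij, symmetric])
  also have "\<dots> = (\<Sum>p\<in>{p. p permutes UNIV}. of_int (sign p) * (\<Prod>i\<in>UNIV. M $ g i $ g (p i)))"
  proof (rule sum.cong)
    fix p assume p: "p \<in> {p. p permutes (UNIV :: 'e set)}"
    have "sign (map_permutation UNIV g p) = sign p"
      by (rule sign_map_permutation) (use inj p in auto)
    moreover have "(\<Prod>j\<in>UNIV. M $ j $ map_permutation UNIV g p j) = (\<Prod>i\<in>UNIV. M $ g i $ g (p i))"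
      by (subst prod.reindex_bij_betw[OF g, symmetric]) (simp add: mp)
    ultimately show "of_int (sign (map_permutation UNIV g p)) * (\<Prod>j\<in>UNIV. M $ j $ map_permutation UNIV g p j)
       = of_int (sign p) * (\<Prod>i\<in>UNIV. M $ g i $ g (p i))" by simp
  qed simp
  finally show ?thesis by (simp add: det_def)
qed

lemma det_matrix_copy:
  fixes f :: "real^'d::finite \<Rightarrow> real^'d"
  assumes "linear f"
  shows "det (matrix (to_copy \<circ> f \<circ> of_copy)) = det (matrix f)"
proof -
  have "of_copy (axis i 1) = axis (Rep_ordered_copy i) 1" for i :: "'d ordered_copy"
    by (auto simp: of_copy_def axis_def vec_eq_iff Rep_ordered_copy_inverse Abs_ordered_copy_inverse)
  then have "matrix (to_copy \<circ> f \<circ> of_copy) = (\<chi> i j. matrix f $ Rep_ordered_copy i $ Rep_ordered_copy j)"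
    unfolding matrix_def to_copy_def by simp
  then show ?thesis
    using det_reindex[OF bij_Rep_ordered_copy, of "matrix f"] by simp
qed

lemma nn_integral_of_copy:
  fixes g :: "real^'d::finite \<Rightarrow> ennreal"
  assumes [measurable]: "g \<in> borel_measurable borel"
  shows "(\<integral>\<^sup>+x. g (of_copy x) \<partial>lborel) = (\<integral>\<^sup>+x. g x \<partial>lborel)"
proof -
  have "(\<integral>\<^sup>+x. g x \<partial>lborel) = (\<integral>\<^sup>+x. g x \<partial>distr lborel borel of_copy)"
    by (simp add: lborel_distr_of_copy)
  also have "\<dots> = (\<integral>\<^sup>+x. g (of_copy x) \<partial>lborel)"
    by (subst nn_integral_distr) auto
  finally show ?thesis ..
qed

lemma emeasure_to_copy_image:
  fixes U :: "(real^'d::finite) set"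
  assumes "U \<in> sets borel"
  shows "emeasure lborel (to_copy ` U) = emeasure lborel U"
proof -
  have "emeasure lborel U = emeasure (distr lborel borel of_copy) U"
    by (simp add: lborel_distr_of_copy)
  also have "\<dots> = emeasure lborel (of_copy -` U \<inter> space lborel)"
    by (rule emeasure_distr) (use assms in auto)
  finally show ?thesis by (simp add: vimage_of_copy)
qed

lemma sets_to_copy_image:
  fixes U :: "(real^'d::finite) set"
  assumes "U \<in> sets borel"
  shows "to_copy ` U \<in> sets borel"
  using measurable_sets[OF measurable_of_copy assms] by (simp add: vimage_of_copy)

lemma has_derivative_copy:
  fixes f :: "real^'d::finite \<Rightarrow> real^'d"
  assumes "(f has_derivative f') (at (of_copy y) within S)"
  shows "(to_copy \<circ> f \<circ> of_copy has_derivative to_copy \<circ> f' \<circ> of_copy) (at y within to_copy ` S)"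
proof -
  have d: "(f has_derivative f') (at (of_copy y) within of_copy ` (to_copy ` S))"
    using assms by (simp add: image_image)
  have "(f \<circ> of_copy has_derivative f' \<circ> of_copy) (at y within to_copy ` S)"
    using bounded_linear.has_derivative[OF bounded_linear_of_copy has_derivative_ident]
    by (intro diff_chain_within d) auto
  then show ?thesis
    unfolding comp_assoc o_def by (rule bounded_linear.has_derivative[OF bounded_linear_to_copy])
qed

context
  fixes f :: "real^'d::finite \<Rightarrow> real^'d" and f' J S and U :: "(real^'d) set"
  assumes S: "S \<in> sets borel" and U: "U \<in> sets borel"
    and deriv: "\<And>x. x \<in> S \<Longrightarrow> (f has_derivative f' x) (at x within S)"
    and J: "J \<in> borel_measurable borel" "\<And>x. x \<in> S \<Longrightarrow> J x = \<bar>det (matrix (f' x))\<bar>"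
begin

private definition "g = to_copy \<circ> f \<circ> of_copy"
private definition "g' y = to_copy \<circ> f' (of_copy y) \<circ> of_copy"

private lemma g_deriv: "y \<in> to_copy ` S \<Longrightarrow> (g has_derivative g' y) (at y within to_copy ` S)"
  unfolding g_def g'_def by (auto intro!: has_derivative_copy deriv)

private lemma g_det: "y \<in> to_copy ` S \<Longrightarrow> \<bar>det (matrix (g' y))\<bar> = J (of_copy y)"
  unfolding g'_def using deriv J(2) det_matrix_copy has_derivative_linear by fastforce

private lemma nn_integral_copy_det:
  "(\<integral>\<^sup>+y\<in>to_copy ` S. ennreal (J (of_copy y)) \<partial>lborel) = (\<integral>\<^sup>+x\<in>S. ennreal (J x) \<partial>lborel)"
proof -
  have "(\<integral>\<^sup>+x\<in>S. ennreal (J x) \<partial>lborel) = (\<integral>\<^sup>+y. ennreal (J (of_copy y)) * indicator S (of_copy y) \<partial>lborel)"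
    using J(1) S by (subst nn_integral_of_copy[symmetric]) auto
  also have "\<dots> = (\<integral>\<^sup>+y\<in>to_copy ` S. ennreal (J (of_copy y)) \<partial>lborel)"
    by (intro nn_integral_cong) (auto simp: indicator_def vimage_of_copy[symmetric])
  finally show ?thesis ..
qed

text \<open>The area inequality for a map that may fold. The Borel function \<open>J\<close> stands
  for the Jacobian because \<open>f'\<close> is constrained only on \<open>S\<close>. An infinite
  right side is trivial; a finite one makes the Jacobian integrable, and then its integral bounds
  the measure of the image.\<close>

lemma emeasure_subset_image_le:
  assumes UfS: "U \<subseteq> f ` S"
  shows "emeasure lborel U \<le> (\<integral>\<^sup>+x\<in>S. ennreal (J x) \<partial>lborel)"
proof (cases "(\<integral>\<^sup>+x\<in>S. ennreal (J x) \<partial>lborel) < \<infinity>")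
  case True
  let ?S = "to_copy ` S" and ?h = "\<lambda>y. J (of_copy y)"
  have Jnn: "0 \<le> ?h y" if "y \<in> ?S" for y
    using that J(2) by auto
  have meas: "set_borel_measurable borel ?S ?h"
    unfolding set_borel_measurable_def using J(1) sets_to_copy_image[OF S]
    by (intro borel_measurable_scaleR) auto
  have fin: "(\<integral>\<^sup>+y\<in>?S. ennreal (?h y) \<partial>lborel) < \<infinity>"
    using True nn_integral_copy_det by simp
  have int: "?h integrable_on ?S"
  proof -
    have eq: "(\<integral>\<^sup>+y. ennreal (indicator ?S y * ?h y) \<partial>lborel) = (\<integral>\<^sup>+y\<in>?S. ennreal (?h y) \<partial>lborel)"
      by (intro nn_integral_cong) (auto simp: indicator_def)
    have "(\<lambda>y. indicator ?S y * ?h y) integrable_on UNIV"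
      by (rule nn_integral_integrable_on)
        (use fin eq meas Jnn in \<open>auto simp: set_borel_measurable_def indicator_def\<close>)
    also have "(\<lambda>y. indicator ?S y * ?h y) = (\<lambda>y. if y \<in> ?S then ?h y else 0)"
      by (auto simp: indicator_def)
    finally show ?thesis by (simp add: integrable_restrict_UNIV)
  qed
  have int': "(\<lambda>y. \<bar>det (matrix (g' y))\<bar>) integrable_on ?S"
    using int by (rule integrable_eq) (simp add: g_det)
  have Slm: "?S \<in> sets lebesgue" using sets_to_copy_image[OF S] by auto
  have im: "g ` ?S \<in> lmeasurable" "measure lebesgue (g ` ?S) \<le> integral ?S (\<lambda>y. \<bar>det (matrix (g' y))\<bar>)"
    using measurable_differentiable_image[OF Slm g_deriv int'] measure_differentiable_image[OF Slm g_deriv int'] by auto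
  have "emeasure lborel U = emeasure lborel (to_copy ` U)"
    using emeasure_to_copy_image[OF U] ..
  also have "\<dots> = emeasure lebesgue (to_copy ` U)"
    using sets_to_copy_image[OF U] by simp
  also have "\<dots> \<le> emeasure lebesgue (g ` ?S)"
  proof (rule emeasure_mono)
    show "to_copy ` U \<subseteq> g ` ?S"
      using UfS by (auto simp: g_def image_image)
  qed (use im in \<open>auto simp: fmeasurable_def\<close>)
  also have "\<dots> = ennreal (measure lebesgue (g ` ?S))"
    using im by (simp add: emeasure_eq_measure2)
  also have "\<dots> \<le> ennreal (integral ?S (\<lambda>y. \<bar>det (matrix (g' y))\<bar>))"
    using im(2) by (rule ennreal_leI)
  also have "integral ?S (\<lambda>y. \<bar>det (matrix (g' y))\<bar>) = integral ?S ?h"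
    by (rule integral_cong) (simp add: g_det)
  also have "ennreal (integral ?S ?h) = (\<integral>\<^sup>+y\<in>?S. ennreal (?h y) \<partial>lborel)"
    using set_nn_integral_lborel_eq_integral[OF meas Jnn fin] by simp
  finally show ?thesis
    using nn_integral_copy_det by simp
next
  case False
  then have "(\<integral>\<^sup>+x\<in>S. ennreal (J x) \<partial>lborel) = \<infinity>"
    by (metis infinity_ennreal_def top.not_eq_extremum)
  then show ?thesis by simp
qed

text \<open>If the image has infinite measure, the inequality above already forces equality.
  Otherwise the finite measure of the injective image is itself what makes the Jacobian
  integrable.\<close>

lemma emeasure_injective_image_eq:
  assumes inj: "inj_on f S" and UfS: "f ` S = U"
  shows "emeasure lborel U = (\<integral>\<^sup>+x\<in>S. ennreal (J x) \<partial>lborel)"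
proof (cases "emeasure lborel U = \<infinity>")
  case True
  then show ?thesis using emeasure_subset_image_le UfS by (simp add: top.extremum_unique)
next
  case False
  let ?S = "to_copy ` S"
  have gS: "g ` ?S = to_copy ` U"
    by (auto simp: g_def image_image UfS[symmetric])
  have Slm: "?S \<in> sets lebesgue" using sets_to_copy_image[OF S] by auto
  have injg: "inj_on g ?S"
    using inj unfolding g_def by (auto simp: inj_on_def) (metis of_to_copy)
  have em: "emeasure lebesgue (g ` ?S) = emeasure lborel U"
    using emeasure_to_copy_image[OF U] sets_to_copy_image[OF U] by (simp add: gS)
  have "g ` ?S \<in> lmeasurable"
    unfolding fmeasurable_def using False em sets_to_copy_image[OF U]
    by (auto simp: gS top.not_eq_extremum)
  then have "((\<lambda>y. \<bar>det (matrix (g' y))\<bar>) has_integral measure lebesgue (g ` ?S)) ?S"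
    using has_measure_differentiable_image[OF Slm g_deriv injg] by blast
  then have "(\<integral>\<^sup>+y. ennreal \<bar>det (matrix (g' y))\<bar> * indicator ?S y \<partial>lborel) = ennreal (measure lebesgue (g ` ?S))"
    by (intro nn_integral_has_integral_lebesgue') auto
  also have "\<dots> = emeasure lborel U"
    using \<open>g ` ?S \<in> lmeasurable\<close> em by (simp add: emeasure_eq_measure2)
  also have "(\<integral>\<^sup>+y. ennreal \<bar>det (matrix (g' y))\<bar> * indicator ?S y \<partial>lborel) = (\<integral>\<^sup>+y\<in>?S. ennreal (J (of_copy y)) \<partial>lborel)"
    by (intro nn_integral_cong) (auto simp: indicator_def g_det)
  finally show ?thesis using nn_integral_copy_det by simp
qed

end

section \<open>Eigenvalues of symmetric forms\<close>

text \<open>A maximizer of the Rayleigh quotient on the unit sphere of \<open>T\<close> is an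
  eigenvector. \<open>L\<close> may map \<open>T\<close> out of itself, so the eigenvalue relation
  is tested against vectors of \<open>T\<close> only.\<close>

lemma symmetric_form_eigenvector:
  fixes L :: "'a::euclidean_space \<Rightarrow> 'a"
  assumes T: "subspace T" "T \<noteq> {0}" and L: "linear L"
    and sym: "\<And>v w. v \<in> T \<Longrightarrow> w \<in> T \<Longrightarrow> L v \<bullet> w = v \<bullet> L w"
  obtains e where "e \<in> T" "norm e = 1" "\<And>w. w \<in> T \<Longrightarrow> L e \<bullet> w = (L e \<bullet> e) * (e \<bullet> w)"
proof -
  interpret L: linear L by fact
  let ?K = "T \<inter> sphere 0 1"
  obtain x where x: "x \<in> T" "x \<noteq> 0" using T subspace_0 by blast
  have "x /\<^sub>R norm x \<in> ?K"
    using x T by (simp add: subspace_scale)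
  then have "?K \<noteq> {}" by blast
  moreover have "compact ?K"
    using T by (simp add: closed_subspace closed_Int_compact)
  moreover have "continuous_on ?K (\<lambda>v. L v \<bullet> v)"
    by (intro continuous_intros linear_continuous_on linear_conv_bounded_linear[THEN iffD1] L)
  ultimately obtain e where e: "e \<in> ?K" and max: "\<And>y. y \<in> ?K \<Longrightarrow> L y \<bullet> y \<le> L e \<bullet> e"
    using continuous_attains_sup[of ?K "\<lambda>v. L v \<bullet> v"] by blast
  define l where "l = L e \<bullet> e"
  have eT: "e \<in> T" and ee: "e \<bullet> e = 1"
    using e by (auto simp: norm_eq_1)
  have le: "L y \<bullet> y \<le> l * (y \<bullet> y)" if "y \<in> T" for y
  proof (cases "y = 0")
    case False
    then have "L (y /\<^sub>R norm y) \<bullet> (y /\<^sub>R norm y) \<le> l"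
      unfolding l_def by (intro max) (use that T in \<open>simp add: subspace_scale\<close>)
    moreover have "L (y /\<^sub>R norm y) \<bullet> (y /\<^sub>R norm y) = (L y \<bullet> y) / (y \<bullet> y)"
      by (simp add: L.scaleR dot_square_norm power2_eq_square divide_inverse)
    ultimately show ?thesis
      using False by (simp add: pos_divide_le_eq)
  qed (simp add: L.zero)
  have perp: "L e \<bullet> w = 0" if w: "w \<in> T" "e \<bullet> w = 0" for w
  proof -
    define c where "c = L e \<bullet> w"
    \<comment> \<open>\<open>d\<close> exceeds the quadratic coefficient of the variation
      \<open>e + t w\<close> by a margin of one. At \<open>t = c / d\<close> the linear gain
      \<open>2 c^2 / d\<close> cannot be offset by \<open>(c / d)^2 (d - 1)\<close> unless
      \<open>c = 0\<close>.\<close>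
    define d where "d = \<bar>l * (w \<bullet> w) - L w \<bullet> w\<bar> + 1"
    have d: "0 < d" and d': "l * (w \<bullet> w) - L w \<bullet> w \<le> d - 1" by (simp_all add: d_def)
    have "L w \<bullet> e = c" unfolding c_def using sym[OF w(1) eT] by (simp add: inner_commute)
    moreover have "L (e + (c / d) *\<^sub>R w) \<bullet> (e + (c / d) *\<^sub>R w)
        \<le> l * ((e + (c / d) *\<^sub>R w) \<bullet> (e + (c / d) *\<^sub>R w))"
      using T eT w by (intro le) (simp add: subspace_add subspace_scale)
    ultimately have "2 * (c / d) * c \<le> (c / d)\<^sup>2 * (l * (w \<bullet> w) - L w \<bullet> w)"
      using w(2) ee
      by (simp add: L.add L.scaleR inner_simps c_def[symmetric] l_def[symmetric] inner_commute[of w e]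
          algebra_simps power2_eq_square)
    also have "\<dots> \<le> (c / d)\<^sup>2 * (d - 1)"
      using d' by (rule mult_left_mono) simp
    finally have "2 * c\<^sup>2 * d \<le> c\<^sup>2 * (d - 1)"
      using d by (simp add: field_simps power2_eq_square)
    then have "c\<^sup>2 * (d + 1) \<le> 0" by (simp add: algebra_simps)
    then have "c\<^sup>2 \<le> 0" using d by (simp add: mult_le_0_iff)
    then show ?thesis by (simp add: c_def)
  qed
  show thesis
  proof
    show "e \<in> T" "norm e = 1" using e by auto
    fix w assume w: "w \<in> T"
    have "L e \<bullet> (w - (e \<bullet> w) *\<^sub>R e) = 0"
      by (rule perp) (use w eT T ee in \<open>simp_all add: subspace_diff subspace_scale inner_simps\<close>)
    then show "L e \<bullet> w = (L e \<bullet> e) * (e \<bullet> w)"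
      by (simp add: inner_simps)
  qed
qed

text \<open>Induction on \<open>dim T\<close>: split off a unit eigenvector \<open>e\<close> and
  continue in its orthogonal complement within \<open>T\<close>.\<close>

lemma symmetric_form_eigenbasis:
  fixes L :: "'a::euclidean_space \<Rightarrow> 'a"
  assumes "subspace T" and L: "linear L"
    and "\<And>v w. v \<in> T \<Longrightarrow> w \<in> T \<Longrightarrow> L v \<bullet> w = v \<bullet> L w"
  shows "\<exists>B. finite B \<and> card B = dim T \<and> B \<subseteq> T \<and> pairwise orthogonal B \<and> (\<forall>b\<in>B. norm b = 1) \<and>
    (\<forall>b\<in>B. \<forall>w\<in>T. L b \<bullet> w = (L b \<bullet> b) * (b \<bullet> w))"
  using assms(1,3)
proof (induction "dim T" arbitrary: T)
  case 0
  then show ?case by (intro exI[of _ "{}"]) auto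
next
  case (Suc n)
  have "T \<noteq> {0}" using Suc.hyps(2) by auto
  then obtain e where e: "e \<in> T" "norm e = 1"
    and eig: "\<And>w. w \<in> T \<Longrightarrow> L e \<bullet> w = (L e \<bullet> e) * (e \<bullet> w)"
    using symmetric_form_eigenvector[OF Suc.prems(1) _ L Suc.prems(2)] by metis
  have ee: "e \<bullet> e = 1" using e by (simp add: norm_eq_1)
  let ?T = "{v \<in> T. e \<bullet> v = 0}"
  have sub: "subspace ?T"
    using Suc.prems(1) by (auto simp: subspace_def inner_simps)
  have "dim {y \<in> T. \<forall>x \<in> span {e}. orthogonal x y} + dim (span {e}) = dim T"
    using e Suc.prems(1) by (intro dim_subspace_orthogonal_to_vectors) (auto simp: span_minimal)
  moreover have "{y \<in> T. \<forall>x \<in> span {e}. orthogonal x y} = ?T"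
    by (auto simp: span_singleton orthogonal_def intro: bexI[of _ 1] dest: spec[of _ 1])
  moreover have "dim (span {e}) = 1"
    using e(2) by (auto simp: dim_insert)
  ultimately have n: "n = dim ?T" using Suc.hyps(2) by simp
  obtain B where B: "finite B" "card B = dim ?T" "B \<subseteq> ?T" "pairwise orthogonal B" "\<forall>b\<in>B. norm b = 1"
    "\<forall>b\<in>B. \<forall>w\<in>?T. L b \<bullet> w = (L b \<bullet> b) * (b \<bullet> w)"
    using Suc.hyps(1)[OF n sub] Suc.prems(2) by auto
  show ?case
  proof (intro exI[of _ "insert e B"] conjI)
    have "e \<notin> B" using B(3) ee by auto
    then show "card (insert e B) = dim T"
      using B(1,2) n Suc.hyps(2) by simp
    show "pairwise orthogonal (insert e B)"
      using B(3,4) by (auto simp: pairwise_insert orthogonal_def inner_commute)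
    show "\<forall>b\<in>insert e B. \<forall>w\<in>T. L b \<bullet> w = (L b \<bullet> b) * (b \<bullet> w)"
    proof (intro ballI)
      fix b w assume b: "b \<in> insert e B" and w: "w \<in> T"
      show "L b \<bullet> w = (L b \<bullet> b) * (b \<bullet> w)"
      proof (cases "b = e")
        case True
        then show ?thesis using eig w by simp
      next
        case False
        then have b: "b \<in> B" "b \<in> T" "e \<bullet> b = 0" using b B(3) by auto
        \<comment> \<open>Symmetry moves \<open>L\<close> onto \<open>e\<close>, so
          \<open>L b\<close> is orthogonal to \<open>e\<close>, and the relation known on the
          complement extends to all of \<open>T\<close>.\<close>
        have "L b \<bullet> e = 0"
          using Suc.prems(2)[OF b(2) e(1)] eig[OF b(2)] b(3) by (simp add: inner_commute)
        moreover have "w - (e \<bullet> w) *\<^sub>R e \<in> ?T"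
          using w e(1) Suc.prems(1) ee by (simp add: subspace_diff subspace_scale inner_simps)
        then have "L b \<bullet> (w - (e \<bullet> w) *\<^sub>R e) = (L b \<bullet> b) * (b \<bullet> (w - (e \<bullet> w) *\<^sub>R e))"
          using B(6) b(1) by blast
        ultimately show ?thesis
          using b(3) by (simp add: inner_simps inner_commute[of b e])
      qed
    qed
  qed (use B e in auto)
qed

definition orthonormal_list :: "'a::euclidean_space list \<Rightarrow> bool" where
  "orthonormal_list es \<longleftrightarrow> distinct es \<and> pairwise orthogonal (set es) \<and> (\<forall>e\<in>set es. norm e = 1)"

lemma sorted_eq_if_count_eq:
  assumes "sorted ls" "sorted ls'" "\<And>l. count_list ls l = count_list ls' l"
  shows "ls = ls'"
proof -
  have "mset ls = mset ls'"
    by (rule multiset_eqI) (simp add: count_mset assms(3))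
  then show ?thesis
    using assms(1,2) by (metis properties_for_sort)
qed

lemma form_eigenvalues_eqI:
  assumes "sorted ls" "\<And>l. count_list ls l = dim (form_eigenspace T B l)"
  shows "form_eigenvalues T B = ls"
  unfolding form_eigenvalues_def
  by (rule the_equality) (use assms in \<open>auto intro: sorted_eq_if_count_eq\<close>)

text \<open>Gives the definite description \<open>form_eigenvalues\<close> a concrete value. The
  eigenspace for \<open>l\<close> is spanned by the basis vectors with eigenvalue \<open>l\<close>,
  so the number of occurrences of \<open>l\<close> is its dimension. The form is compared with
  \<open>L\<close> on \<open>T\<close> only, because the forms of the definitions are meaningful
  only on tangent vectors.\<close>

lemma form_eigenvalues_eigenbasis:
  fixes L :: "'a::euclidean_space \<Rightarrow> 'a"
  assumes T: "subspace T" and L: "linear L"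
    and sym: "\<And>v w. v \<in> T \<Longrightarrow> w \<in> T \<Longrightarrow> L v \<bullet> w = v \<bullet> L w"
    and form: "\<And>v w. v \<in> T \<Longrightarrow> w \<in> T \<Longrightarrow> form v w = L v \<bullet> w"
  obtains es where "orthonormal_list es" "length es = dim T" "set es \<subseteq> T"
    "\<And>e w. e \<in> set es \<Longrightarrow> w \<in> T \<Longrightarrow> L e \<bullet> w = (L e \<bullet> e) * (e \<bullet> w)"
    "form_eigenvalues T form = map (\<lambda>e. L e \<bullet> e) es"
proof -
  obtain B where B: "finite B" "card B = dim T" "B \<subseteq> T" "pairwise orthogonal B" "\<forall>b\<in>B. norm b = 1"
    "\<forall>b\<in>B. \<forall>w\<in>T. L b \<bullet> w = (L b \<bullet> b) * (b \<bullet> w)"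
    using symmetric_form_eigenbasis[OF T L sym] by blast
  obtain bs where bs: "set bs = B" "distinct bs"
    using B(1) finite_distinct_list by blast
  define es where "es = sort_key (\<lambda>e. L e \<bullet> e) bs"
  have es: "set es = B" "distinct es" "length es = dim T"
    using bs B(2) distinct_card[of bs] by (auto simp: es_def)
  have ind: "independent C" if "C \<subseteq> B" for C
  proof (rule pairwise_orthogonal_independent)
    show "0 \<notin> C" using that B(5) by (metis norm_zero subsetD zero_neq_one)
    show "pairwise orthogonal C" using that B(4) pairwise_subset by blast
  qed
  have span: "span B = T"
  proof (rule subspace_dim_equal)
    show "span B \<subseteq> T" using B(3) T by (rule span_minimal)
    show "dim (span B) \<ge> dim T" using B(2) dim_eq_card_independent[OF ind[OF order_refl]] by simp
  qed (use T in simp_all)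
  have eigenspace: "form_eigenspace T form l = span {e \<in> B. L e \<bullet> e = l}" for l
  proof
    have "e \<in> form_eigenspace T form l" if "e \<in> B" "L e \<bullet> e = l" for e
    proof -
      have "L e \<bullet> w = l * (e \<bullet> w)" if "w \<in> T" for w
        using bspec[OF bspec[OF B(6)]] that \<open>e \<in> B\<close> \<open>L e \<bullet> e = l\<close> by blast
      moreover have "e \<in> T" using \<open>e \<in> B\<close> B(3) by blast
      ultimately show ?thesis
        unfolding form_eigenspace_def mem_Collect_eq by (metis form)
    qed
    moreover have "subspace (form_eigenspace T form l)"
      using T unfolding subspace_def form_eigenspace_def
      by (auto simp: form inner_simps linear_0[OF L] linear_add[OF L] linear_cmul[OF L] algebra_simps)
    ultimately show "span {e \<in> B. L e \<bullet> e = l} \<subseteq> form_eigenspace T form l"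
      by (intro span_minimal) auto
    show "form_eigenspace T form l \<subseteq> span {e \<in> B. L e \<bullet> e = l}"
    proof
      fix v assume "v \<in> form_eigenspace T form l"
      then have v: "v \<in> T" "\<And>w. w \<in> T \<Longrightarrow> L v \<bullet> w = l * (v \<bullet> w)"
        using form unfolding form_eigenspace_def by auto
      \<comment> \<open>Eigenvectors for different eigenvalues are orthogonal, so only the basis
        vectors for \<open>l\<close> survive in the expansion of \<open>v\<close>.\<close>
      have "v \<bullet> e = 0" if "e \<in> B" "L e \<bullet> e \<noteq> l" for e
      proof -
        have eT: "e \<in> T" using that B(3) by auto
        have "l * (v \<bullet> e) = (L e \<bullet> e) * (v \<bullet> e)"
          using v(2)[OF eT] sym[OF v(1) eT] B(6) that v(1) by (metis inner_commute)
        then show ?thesis using that(2) by simp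
      qed
      then have "(\<Sum>e\<in>B. (v \<bullet> e) *\<^sub>R e) = (\<Sum>e\<in>{e \<in> B. L e \<bullet> e = l}. (v \<bullet> e) *\<^sub>R e)"
        using B(1) by (intro sum.mono_neutral_right) auto
      moreover have "(\<Sum>e\<in>B. (v \<bullet> e) *\<^sub>R e) = v"
        using B v(1) span by (intro orthonormal_basis_expand) auto
      ultimately show "v \<in> span {e \<in> B. L e \<bullet> e = l}"
        by (metis (no_types, lifting) span_base span_scale span_sum)
    qed
  qed
  have "count_list (map (\<lambda>e. L e \<bullet> e) es) l = dim (form_eigenspace T form l)" for l
  proof -
    have "count_list (map (\<lambda>e. L e \<bullet> e) es) l = length (filter (\<lambda>e. L e \<bullet> e = l) es)"
      by (induction es) auto
    also have "\<dots> = card {e \<in> B. L e \<bullet> e = l}"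
      using es by (subst distinct_card[symmetric]) auto
    also have "\<dots> = dim (form_eigenspace T form l)"
      unfolding eigenspace dim_span using dim_eq_card_independent[OF ind] by simp
    finally show ?thesis .
  qed
  then have "form_eigenvalues T form = map (\<lambda>e. L e \<bullet> e) es"
    by (intro form_eigenvalues_eqI) (simp_all add: es_def)
  moreover have "orthonormal_list es"
    using es B(4,5) by (simp add: orthonormal_list_def)
  ultimately show thesis
    using es B(3) bspec[OF bspec[OF B(6)]] by (intro that[of es]) simp_all
qed

section \<open>Trace and determinant in an orthonormal basis\<close>

lemma sum_inner_orthonormal_basis:
  fixes L :: "'a::euclidean_space \<Rightarrow> 'a"
  assumes L: "linear L" and B: "pairwise orthogonal B" "\<And>b. b \<in> B \<Longrightarrow> norm b = 1" "card B = DIM('a)"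
  shows "(\<Sum>i\<in>Basis. L i \<bullet> i) = (\<Sum>b\<in>B. L b \<bullet> b)"
proof -
  have fin: "finite B" using B(3) by (metis DIM_positive card.infinite not_less_zero)
  have "independent B"
    using B(1) B(2)[of 0] by (intro pairwise_orthogonal_independent) auto
  then have span: "span B = UNIV"
    using B(3) fin by (metis dim_UNIV dim_eq_card_independent dim_eq_full)
  have "(\<Sum>i\<in>Basis. L i \<bullet> i) = (\<Sum>i\<in>Basis. \<Sum>b\<in>B. (i \<bullet> b) * (L b \<bullet> i))"
  proof (rule sum.cong)
    fix i :: 'a
    have "i = (\<Sum>b\<in>B. (i \<bullet> b) *\<^sub>R b)"
      using orthonormal_basis_expand[OF B(1,2) _ fin, of i] span by simp
    then have "L i = (\<Sum>b\<in>B. (i \<bullet> b) *\<^sub>R L b)"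
      by (metis (no_types, lifting) L linear_cmul linear_sum sum.cong)
    then show "L i \<bullet> i = (\<Sum>b\<in>B. (i \<bullet> b) * (L b \<bullet> i))"
      by (simp add: inner_sum_left)
  qed simp
  also have "\<dots> = (\<Sum>b\<in>B. \<Sum>i\<in>Basis. (L b \<bullet> i) * (b \<bullet> i))"
    by (subst sum.swap) (simp add: mult.commute inner_commute)
  also have "\<dots> = (\<Sum>b\<in>B. L b \<bullet> b)"
    by (simp add: euclidean_inner[symmetric])
  finally show ?thesis .
qed

lemma orthonormal_list_inner:
  assumes "orthonormal_list es" "a \<in> set es" "b \<in> set es"
  shows "a \<bullet> b = (if a = b then 1 else 0)"
  using assms by (auto simp: orthonormal_list_def pairwise_def orthogonal_def norm_eq_1)

text \<open>In the basis \<open>z # es\<close> every column except that of \<open>z\<close> is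
  diagonal, so only the diagonal entry of the remaining column counts. That column is left arbitrary
  because the maps differentiated below send the radial direction to vectors that are not
  radial.\<close>

lemma det_orthonormal_triangular:
  fixes L :: "real^'d::finite \<Rightarrow> real^'d"
  assumes L: "linear L" and es: "orthonormal_list (z # es)" "length es + 1 = CARD('d)"
    and eig: "\<And>e. e \<in> set es \<Longrightarrow> L e = \<mu> e *\<^sub>R e"
  shows "det (matrix L) = (L z \<bullet> z) * (\<Prod>e\<leftarrow>es. \<mu> e)"
proof -
  let ?B = "set (z # es)"
  have dist: "z \<notin> set es" "distinct es" using es by (auto simp: orthonormal_list_def)
  have "card ?B = CARD('d)"
    using es distinct_card[of "z # es"] by (auto simp: orthonormal_list_def)
  then obtain b where b: "bij_betw b (UNIV :: 'd set) ?B"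
    using finite_same_card_bij[of "UNIV :: 'd set" ?B] by auto
  have bB: "b i \<in> ?B" for i using b by (auto simp: bij_betw_def)
  have inj: "b i = b j \<longleftrightarrow> i = j" for i j using b by (auto simp: bij_betw_def inj_on_def)
  have ortho: "b i \<bullet> b j = (if i = j then 1 else 0)" for i j
    using orthonormal_list_inner[OF es(1) bB bB, of i j] inj by simp
  obtain k where k: "b k = z" using b unfolding bij_betw_def by (metis imageE list.set_intros(1))
  define Q where "Q = (\<chi> i. b i)"
  have "orthogonal_matrix Q"
    unfolding orthogonal_matrix_orthonormal_rows
    using ortho by (auto simp: Q_def row_def norm_eq_1 orthogonal_def vec_lambda_eta)
  then have "\<bar>det Q\<bar> = 1" using det_orthogonal_matrix[of Q] by auto
  then have detQ: "det Q * det Q = 1" by (metis abs_mult_self_eq mult_1)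
  define N where "N = Q ** matrix L ** transpose Q"
  have N: "N $ i $ j = b i \<bullet> L (b j)" for i j
  proof -
    have "(matrix L ** transpose Q) $ m $ j = L (b j) $ m" for m
    proof -
      have "(matrix L ** transpose Q) $ m $ j = (matrix L *v b j) $ m"
        by (simp add: matrix_matrix_mult_def matrix_vector_mult_def transpose_def Q_def)
      then show ?thesis using L by (simp add: matrix_works)
    qed
    then have "N $ i $ j = (\<Sum>m\<in>UNIV. Q $ i $ m * L (b j) $ m)"
      unfolding N_def matrix_mul_assoc[symmetric] by (simp add: matrix_matrix_mult_def[of Q])
    then show ?thesis by (simp add: inner_vec_def Q_def)
  qed
  have Nd: "N $ i $ j = (if i = j then \<mu> (b j) else 0)" if "j \<noteq> k" for i j
  proof -
    have "b j \<in> set es" using bB[of j] that k inj by (metis set_ConsD)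
    then show ?thesis using ortho by (simp add: N eig)
  qed
  have "det N = det (matrix L)"
    unfolding N_def det_mul det_transpose using detQ by (simp add: mult.commute mult.left_commute)
  moreover have "det N = (\<Prod>i\<in>UNIV. N $ i $ i)"
  proof -
    \<comment> \<open>A permutation other than the identity picks an off-diagonal entry in a column
      other than \<open>k\<close>: if the moved index \<open>i\<close> is sent to \<open>k\<close>,
      then \<open>k\<close> itself is moved elsewhere.\<close>
    have "(\<Prod>i\<in>UNIV. N $ i $ p i) = 0" if p: "p permutes (UNIV :: 'd set)" "p \<noteq> id" for p
    proof -
      obtain i where i: "p i \<noteq> i" using p(2) by (auto simp: fun_eq_iff)
      have "\<exists>i. p i \<noteq> i \<and> p i \<noteq> k"
      proof (cases "p i = k")
        case True
        have "p (p i) \<noteq> p i" using i p(1) by (metis permutes_inj injD)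
        then show ?thesis using True i by metis
      qed (use i in blast)
      then obtain j where j: "p j \<noteq> j" "p j \<noteq> k" by blast
      then have "N $ j $ p j = 0" using Nd by simp
      then show ?thesis by (intro prod_zero) auto
    qed
    then have "det N = (\<Sum>p\<in>{id}. of_int (sign p) * (\<Prod>i\<in>UNIV. N $ i $ p i))"
      unfolding det_def by (intro sum.mono_neutral_right) (auto simp: permutes_id)
    then show ?thesis by simp
  qed
  moreover have "(\<Prod>i\<in>UNIV. N $ i $ i) = N $ k $ k * (\<Prod>i\<in>UNIV - {k}. N $ i $ i)"
    by (simp add: prod.remove)
  moreover have "(\<Prod>i\<in>UNIV - {k}. N $ i $ i) = (\<Prod>i\<in>UNIV - {k}. \<mu> (b i))"
    by (intro prod.cong) (auto simp: Nd)
  moreover have "bij_betw b (UNIV - {k}) (set es)"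
    using bij_betw_DiffI[OF b, of "{k}" "{z}"] dist k by (auto simp: bij_betw_def)
  then have "(\<Prod>i\<in>UNIV - {k}. \<mu> (b i)) = (\<Prod>e\<leftarrow>es. \<mu> e)"
    using dist by (simp add: prod.reindex_bij_betw prod.distinct_set_conv_list)
  ultimately show ?thesis by (simp add: N k inner_commute)
qed

section \<open>Elementary symmetric functions\<close>

definition esym :: "nat \<Rightarrow> nat \<Rightarrow> (nat \<Rightarrow> real) \<Rightarrow> real" where
  "esym n k f = (\<Sum>J | J \<subseteq> {..<n} \<and> card J = k. \<Prod>j\<in>J. f j)"

lemma finite_subsets_of_card [simp]: "finite {J. J \<subseteq> {..<n::nat} \<and> card J = k}"
  by (rule finite_subset[of _ "Pow {..<n}"]) auto

lemma esym_nonneg: "(\<And>i. i < n \<Longrightarrow> 0 \<le> f i) \<Longrightarrow> 0 \<le> esym n k f"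
  unfolding esym_def by (intro sum_nonneg prod_nonneg) auto

lemma esym_full: "esym n n f = (\<Prod>i<n. f i)"
proof -
  have "{J. J \<subseteq> {..<n} \<and> card J = n} = {{..<n}}"
    using card_subset_eq[of "{..<n}"] by auto
  then show ?thesis by (simp add: esym_def)
qed

text \<open>The generating polynomial. It lets the elementary symmetric functions be read off a
  determinant, and it is the source of the volume polynomials of the parallel bodies.\<close>

lemma prod_add_const_esym: "(\<Prod>i<n. f i + t) = (\<Sum>k\<le>n. esym n k f * t ^ (n - k))"
proof -
  have "(\<Prod>i<n. f i + t) = (\<Sum>J\<in>Pow {..<n}. (\<Prod>i\<in>J. f i) * t ^ (n - card J))"
    by (subst prod_add) (auto intro!: sum.cong simp: card_Diff_subset finite_subset)
  also have "\<dots> = (\<Sum>k\<le>n. \<Sum>J | J \<in> Pow {..<n} \<and> card J = k. (\<Prod>i\<in>J. f i) * t ^ (n - card J))"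
    by (rule sum.group[symmetric]) (auto dest: card_mono[rotated])
  also have "\<dots> = (\<Sum>k\<le>n. esym n k f * t ^ (n - k))"
    unfolding esym_def sum_distrib_right by (intro sum.cong) auto
  finally show ?thesis .
qed

text \<open>Double counting: a \<open>k\<close>-subset with an element outside it is the same as a
  \<open>(k + 1)\<close>-subset with one of its elements marked.\<close>

lemma sum_subsets_insert:
  fixes g :: "nat set \<Rightarrow> nat \<Rightarrow> real"
  shows "(\<Sum>J | J \<subseteq> {..<n} \<and> card J = k. \<Sum>i\<in>{..<n} - J. g (insert i J) i) =
    (\<Sum>I | I \<subseteq> {..<n} \<and> card I = Suc k. \<Sum>i\<in>I. g I i)"
proof -
  have fin: "finite J" if "J \<subseteq> {..<n}" for J :: "nat set"
    using that finite_subset by blast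
  have "(\<Sum>J | J \<subseteq> {..<n} \<and> card J = k. \<Sum>i\<in>{..<n} - J. g (insert i J) i) =
      (\<Sum>(J, i)\<in>(SIGMA J:{J. J \<subseteq> {..<n} \<and> card J = k}. {..<n} - J). g (insert i J) i)"
    by (subst sum.Sigma) auto
  also have "\<dots> = (\<Sum>(I, i)\<in>(SIGMA I:{I. I \<subseteq> {..<n} \<and> card I = Suc k}. I). g I i)"
    by (rule sum.reindex_bij_witness[where i = "\<lambda>(I, i). (I - {i}, i)" and j = "\<lambda>(J, i). (insert i J, i)"])
      (auto simp: fin insert_absorb)
  also have "\<dots> = (\<Sum>I | I \<subseteq> {..<n} \<and> card I = Suc k. \<Sum>i\<in>I. g I i)"
    by (subst sum.Sigma) (auto simp: fin)
  finally show ?thesis .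
qed

text \<open>Expanding e_1 e_(k+1) gives (k+2) e_(k+2) plus the sum \<open>Q\<close> of the terms
  with a repeated factor. Grouped by the remaining \<open>k\<close>-subset \<open>L\<close>,
  \<open>Q\<close> carries the sum of squares over the complement of \<open>L\<close>, while
  (k+1)(k+2) e_(k+2) carries the square of the sum minus the sum of squares. Cauchy-Schwarz on the
  \<open>n - k\<close> elements of the complement compares the two.\<close>

lemma esym_maclaurin_aux:
  fixes f :: "nat \<Rightarrow> real"
  assumes f: "\<And>i. i < n \<Longrightarrow> 0 \<le> f i" and k: "Suc k < n"
  shows "real n * real (k + 2) * esym n (k + 2) f \<le> real (n - Suc k) * ((\<Sum>i<n. f i) * esym n (Suc k) f)"
proof -
  let ?P = "\<lambda>k. {J. J \<subseteq> {..<n} \<and> card J = k}"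
  have fin: "finite J" if "J \<subseteq> {..<n}" for J :: "nat set"
    using that finite_subset by blast
  have prod_insert: "(\<Prod>j\<in>insert i J. f j) = f i * (\<Prod>j\<in>J. f j)" if "J \<subseteq> {..<n}" "i \<notin> J" for i J
    using that fin by simp
  define Q where "Q = (\<Sum>J\<in>?P (Suc k). \<Sum>i\<in>J. f i * (\<Prod>j\<in>J. f j))"
  have outside: "(\<Sum>J\<in>?P (Suc k). \<Sum>i\<in>{..<n} - J. f i * (\<Prod>j\<in>J. f j)) = real (k + 2) * esym n (k + 2) f"
  proof -
    have "(\<Sum>J\<in>?P (Suc k). \<Sum>i\<in>{..<n} - J. f i * (\<Prod>j\<in>J. f j)) =
        (\<Sum>J\<in>?P (Suc k). \<Sum>i\<in>{..<n} - J. \<Prod>j\<in>insert i J. f j)"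
      by (intro sum.cong) (auto simp: prod_insert)
    also have "\<dots> = (\<Sum>I\<in>?P (Suc (Suc k)). \<Sum>i\<in>I. \<Prod>j\<in>I. f j)"
      by (rule sum_subsets_insert)
    finally show ?thesis by (simp add: esym_def sum_distrib_left)
  qed
  have "(\<Sum>i<n. f i) * esym n (Suc k) f = (\<Sum>J\<in>?P (Suc k). \<Sum>i<n. f i * (\<Prod>j\<in>J. f j))"
    by (simp add: esym_def sum_distrib_left sum_distrib_right)
  also have "\<dots> = (\<Sum>J\<in>?P (Suc k). (\<Sum>i\<in>J. f i * (\<Prod>j\<in>J. f j)) + (\<Sum>i\<in>{..<n} - J. f i * (\<Prod>j\<in>J. f j)))"
    by (intro sum.cong refl) (auto simp: sum.subset_diff[of _ "{..<n}"])
  finally have split: "(\<Sum>i<n. f i) * esym n (Suc k) f = Q + real (k + 2) * esym n (k + 2) f"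
    by (simp add: sum.distrib outside Q_def)
  have Q: "Q = (\<Sum>L\<in>?P k. (\<Prod>j\<in>L. f j) * (\<Sum>i\<in>{..<n} - L. (f i)\<^sup>2))"
  proof -
    have "Q = (\<Sum>L\<in>?P k. \<Sum>i\<in>{..<n} - L. f i * (\<Prod>j\<in>insert i L. f j))"
      unfolding Q_def by (rule sum_subsets_insert[symmetric])
    also have "\<dots> = (\<Sum>L\<in>?P k. \<Sum>i\<in>{..<n} - L. (\<Prod>j\<in>L. f j) * (f i)\<^sup>2)"
      by (intro sum.cong) (auto simp: prod_insert power2_eq_square)
    finally show ?thesis by (simp add: sum_distrib_left)
  qed
  \<comment> \<open>The factor \<open>Suc k\<close> counts the elements \<open>l\<close> of
    \<open>J\<close> that can be split off, so that the sum can be regrouped by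
    \<open>L = J - {l}\<close>.\<close>
  have "real (Suc k) * (real (k + 2) * esym n (k + 2) f) =
      (\<Sum>J\<in>?P (Suc k). \<Sum>l\<in>J. \<Sum>i\<in>{..<n} - J. f i * (\<Prod>j\<in>J. f j))"
    unfolding outside[symmetric] by (simp add: sum_distrib_left)
  also have "\<dots> = (\<Sum>L\<in>?P k. \<Sum>l\<in>{..<n} - L. \<Sum>i\<in>{..<n} - insert l L. f i * (\<Prod>j\<in>insert l L. f j))"
    by (rule sum_subsets_insert[symmetric])
  also have "\<dots> = (\<Sum>L\<in>?P k. (\<Prod>j\<in>L. f j) * ((\<Sum>i\<in>{..<n} - L. f i)\<^sup>2 - (\<Sum>i\<in>{..<n} - L. (f i)\<^sup>2)))"
  proof (intro sum.cong refl)
    fix L assume L: "L \<in> ?P k"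
    have "(\<Sum>i\<in>{..<n} - insert l L. f i) = (\<Sum>i\<in>{..<n} - L. f i) - f l" if "l \<in> {..<n} - L" for l
    proof -
      have "{..<n} - insert l L = ({..<n} - L) - {l}" by auto
      then show ?thesis using that by (simp add: sum_diff1)
    qed
    then have "(\<Sum>l\<in>{..<n} - L. \<Sum>i\<in>{..<n} - insert l L. f i * (\<Prod>j\<in>insert l L. f j)) =
        (\<Sum>l\<in>{..<n} - L. ((\<Sum>i\<in>{..<n} - L. f i) - f l) * (f l * (\<Prod>j\<in>L. f j)))"
      using L by (intro sum.cong refl) (auto simp: prod_insert sum_distrib_right[symmetric])
    also have "\<dots> = (\<Prod>j\<in>L. f j) * ((\<Sum>i\<in>{..<n} - L. f i)\<^sup>2 - (\<Sum>i\<in>{..<n} - L. (f i)\<^sup>2))"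
      by (simp add: algebra_simps sum_subtractf sum_distrib_left sum_distrib_right power2_eq_square)
    finally show "(\<Sum>l\<in>{..<n} - L. \<Sum>i\<in>{..<n} - insert l L. f i * (\<Prod>j\<in>insert l L. f j)) =
        (\<Prod>j\<in>L. f j) * ((\<Sum>i\<in>{..<n} - L. f i)\<^sup>2 - (\<Sum>i\<in>{..<n} - L. (f i)\<^sup>2))" .
  qed
  also have "\<dots> \<le> (\<Sum>L\<in>?P k. (\<Prod>j\<in>L. f j) * (real (n - Suc k) * (\<Sum>i\<in>{..<n} - L. (f i)\<^sup>2)))"
  proof (intro sum_mono mult_left_mono)
    fix L assume L: "L \<in> ?P k"
    then have "card ({..<n} - L) = Suc (n - Suc k)"
      using k by (auto simp: card_Diff_subset fin)
    then have "(\<Sum>i\<in>{..<n} - L. f i)\<^sup>2 \<le> (\<Sum>i\<in>{..<n} - L. (f i)\<^sup>2) * real (Suc (n - Suc k))"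
      using sum_squared_le_sum_of_squares[of f "{..<n} - L"] by simp
    then show "(\<Sum>i\<in>{..<n} - L. f i)\<^sup>2 - (\<Sum>i\<in>{..<n} - L. (f i)\<^sup>2) \<le> real (n - Suc k) * (\<Sum>i\<in>{..<n} - L. (f i)\<^sup>2)"
      by (simp add: algebra_simps)
    show "0 \<le> (\<Prod>j\<in>L. f j)" using L f by (intro prod_nonneg) auto
  qed
  also have "\<dots> = real (n - Suc k) * Q"
    by (simp add: Q sum_distrib_left mult.left_commute)
  finally have "real (Suc k) * (real (k + 2) * esym n (k + 2) f) \<le> real (n - Suc k) * Q" .
  moreover have "real n = real (n - Suc k) + real (Suc k)" using k by simp
  moreover have "N * c * e \<le> d * (Q + c * e)" if "m * (c * e) \<le> d * Q" "N = d + m" for N c d e m :: real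
    using that by (simp add: algebra_simps)
  ultimately show ?thesis unfolding split by blast
qed

lemma esym_maclaurin:
  fixes f :: "nat \<Rightarrow> real"
  assumes f: "\<And>i. i < n \<Longrightarrow> 0 \<le> f i" and k: "1 \<le> k" "k < n"
  shows "esym n (k + 1) f / real (n choose (k + 1)) \<le> ((\<Sum>i<n. f i) / real n) * (esym n k f / real (n choose k))"
proof -
  obtain j where j: "k = Suc j" using k(1) by (cases k) auto
  have le: "real n * real (k + 1) * esym n (k + 1) f \<le> real (n - k) * ((\<Sum>i<n. f i) * esym n k f)"
    using esym_maclaurin_aux[of n f j] f k j by simp
  have "(k + 1) * (n choose (k + 1)) = (n - k) * (n choose k)"
    using binomial_absorb_comp[of n k] binomial_absorption[of k n] by simp
  then have choose: "real (k + 1) * real (n choose (k + 1)) = real (n - k) * real (n choose k)"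
    by (metis of_nat_mult)
  have pos: "0 < real (n choose (k + 1))" "0 < real (n choose k)" "0 < real n" "0 < real (n - k)" "0 < real (k + 1)"
    using k by auto
  have "esym n (k + 1) f / real (n choose (k + 1)) = (real (k + 1) * esym n (k + 1) f) / (real (n - k) * real (n choose k))"
    unfolding choose[symmetric] using pos by simp
  also have "\<dots> \<le> ((\<Sum>i<n. f i) / real n) * (esym n k f / real (n choose k))"
  proof -
    have "x / (a * b) \<le> s / c * (e / b)" if "c * x \<le> a * (s * e)" "0 < a" "0 < b" "0 < c" for a b c e s x :: real
      using that by (simp add: field_simps)
    then show ?thesis using le pos by (simp only: mult.assoc)
  qed
  finally show ?thesis .
qed

text \<open>AM-GM for the factors \<open>1 - s / f i\<close>, whose mean is at most
  \<open>1 - s / m\<close> because the harmonic mean of the \<open>f i\<close> is at most their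
  arithmetic mean \<open>m\<close>.\<close>

lemma prod_diff_le_mean:
  fixes f :: "nat \<Rightarrow> real"
  assumes n: "0 < n" and f: "\<And>i. i < n \<Longrightarrow> 0 < f i" and s: "0 \<le> s" "\<And>i. i < n \<Longrightarrow> s \<le> f i"
  shows "(\<Prod>i<n. f i - s) \<le> (\<Prod>i<n. f i) * (1 - s / ((\<Sum>i<n. f i) / n)) ^ n"
proof -
  define m where "m = (\<Sum>i<n. f i) / n"
  have m: "0 < m" unfolding m_def using n f by (intro divide_pos_pos sum_pos) auto
  have nn: "0 \<le> 1 - s / f i" if "i < n" for i
    using s(2)[OF that] f[OF that] by (simp add: field_simps)
  \<comment> \<open>The lower bound is the tangent line of \<open>1 / x\<close> at
    \<open>x = m\<close>; summing over \<open>i\<close> collapses it to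
    \<open>n / m\<close>.\<close>
  have "1 / f i \<ge> 2 / m - f i / m\<^sup>2" if "i < n" for i
  proof -
    have "0 \<le> (f i - m)\<^sup>2 / (f i * m\<^sup>2)" using f[OF that] by (intro divide_nonneg_nonneg) auto
    also have "\<dots> = 1 / f i - (2 / m - f i / m\<^sup>2)"
      using f[OF that] m by (simp add: field_simps power2_eq_square)
    finally show ?thesis by simp
  qed
  then have "(\<Sum>i<n. 2 / m - f i / m\<^sup>2) \<le> (\<Sum>i<n. 1 / f i)" by (intro sum_mono) auto
  moreover have "(\<Sum>i<n. 2 / m - f i / m\<^sup>2) = real n / m"
  proof -
    have "(\<Sum>i<n. f i) = n * m" using n by (simp add: m_def)
    then show ?thesis
      using m by (simp add: sum_subtractf sum_divide_distrib[symmetric] field_simps power2_eq_square)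
  qed
  ultimately have harm: "real n / m \<le> (\<Sum>i<n. 1 / f i)" by simp
  define y where "y = 1 - s / m"
  have sum_le: "(\<Sum>i<n. 1 - s / f i) \<le> n * y"
  proof -
    have "s * (real n / m) \<le> s * (\<Sum>i<n. 1 / f i)" using harm s(1) by (rule mult_left_mono)
    then have "s * (real n / m) \<le> (\<Sum>i<n. s / f i)" by (simp add: sum_distrib_left)
    then show ?thesis by (simp add: sum_subtractf y_def algebra_simps)
  qed
  have "0 \<le> n * y" using sum_nonneg[of "{..<n}" "\<lambda>i. 1 - s / f i"] nn sum_le by auto
  then have "0 \<le> y" using n by (simp add: zero_le_mult_iff)
  have "(\<Prod>i<n. 1 - s / f i) \<le> y ^ n"
  proof (cases "y = 0")
    \<comment> \<open>Split off because the exponential estimate of the other case divides by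
      \<open>y\<close>.\<close>
    case True
    then have "(\<Sum>i<n. 1 - s / f i) = 0"
      using sum_le sum_nonneg[of "{..<n}" "\<lambda>i. 1 - s / f i"] nn by auto
    then have "1 - s / f 0 = 0"
      using n nn by (subst (asm) sum_nonneg_eq_0_iff) auto
    then have "(\<Prod>i<n. 1 - s / f i) = 0" using n by (intro prod_zero) auto
    then show ?thesis using zero_le_power[OF \<open>0 \<le> y\<close>, of n] by linarith
  next
    case False
    then have y: "0 < y" using \<open>0 \<le> y\<close> by simp
    \<comment> \<open>AM-GM by multiplying the inequalities \<open>x \<le> y * exp (x / y - 1)\<close>\<close>
    have "(\<Prod>i<n. 1 - s / f i) \<le> (\<Prod>i<n. y * exp ((1 - s / f i) / y - 1))"
    proof (intro prod_mono conjI)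
      fix i assume i: "i \<in> {..<n}"
      then show "0 \<le> 1 - s / f i" using nn by simp
      have "(1 - s / f i) / y \<le> exp ((1 - s / f i) / y - 1)"
        using exp_ge_add_one_self[of "(1 - s / f i) / y - 1"] by simp
      then show "1 - s / f i \<le> y * exp ((1 - s / f i) / y - 1)"
        using y by (simp add: pos_divide_le_eq mult.commute)
    qed
    also have "\<dots> = y ^ n * exp ((\<Sum>i<n. 1 - s / f i) / y - n)"
    proof -
      have "(\<Sum>i<n. (1 - s / f i) / y - 1) = (\<Sum>i<n. 1 - s / f i) / y - n"
        by (subst sum_subtractf) (simp add: sum_divide_distrib)
      then show ?thesis by (simp only: prod.distrib exp_sum[symmetric] finite_lessThan) simp
    qed
    also have "\<dots> \<le> y ^ n * 1"
      using sum_le y by (intro mult_left_mono) (auto simp: pos_divide_le_eq)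
    finally show ?thesis by simp
  qed
  moreover have "(\<Prod>i<n. f i - s) = (\<Prod>i<n. f i) * (\<Prod>i<n. 1 - s / f i)"
    unfolding prod.distrib[symmetric] using f by (intro prod.cong) (fastforce simp: field_simps)+
  moreover have "0 \<le> (\<Prod>i<n. f i)" using f by (intro prod_nonneg) (auto intro: less_imp_le)
  ultimately show ?thesis by (simp add: m_def y_def mult_left_mono)
qed

text \<open>The bound of \<open>prod_diff_le_mean\<close> integrates in closed form, and stopping at
  \<open>\<mu> \<le> m\<close> leaves a nonnegative remainder that is dropped. With \<open>f\<close>
  the principal radii, the left side measures what one inward normal of length \<open>\<mu>\<close>
  sweeps out.\<close>

lemma nn_integral_prod_diff_le:
  fixes f :: "nat \<Rightarrow> real"
  assumes n: "0 < n" and f: "\<And>i. i < n \<Longrightarrow> 0 < f i" and \<mu>: "0 \<le> \<mu>" "\<And>i. i < n \<Longrightarrow> \<mu> \<le> f i"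
  shows "(\<integral>\<^sup>+s\<in>{0<..\<mu>}. ennreal (\<Prod>i<n. f i - s) \<partial>lborel) \<le> ennreal ((\<Prod>i<n. f i) * ((\<Sum>i<n. f i) / n) / (n + 1))"
proof -
  define m where "m = (\<Sum>i<n. f i) / n"
  define c where "c = (\<Prod>i<n. f i)"
  have m: "0 < m" unfolding m_def using n f by (intro divide_pos_pos sum_pos) auto
  have c: "0 \<le> c" unfolding c_def using f by (intro prod_nonneg) (auto intro: less_imp_le)
  have "\<mu> \<le> m"
  proof -
    have "real n * \<mu> \<le> (\<Sum>i<n. f i)" using sum_mono[of "{..<n}" "\<lambda>_. \<mu>" f] \<mu>(2) by simp
    then show ?thesis using n by (simp add: m_def field_simps)
  qed
  \<comment> \<open>The antiderivative normalized to vanish at \<open>s = m\<close>, so that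
    \<open>F \<mu>\<close> is nonpositive and \<open>- F 0\<close> is the claimed bound.\<close>
  define F where "F s = - (c * m / (n + 1)) * (1 - s / m) ^ (n + 1)" for s
  have "(\<integral>\<^sup>+s\<in>{0<..\<mu>}. ennreal (\<Prod>i<n. f i - s) \<partial>lborel) \<le> (\<integral>\<^sup>+s\<in>{0..\<mu>}. ennreal (c * (1 - s / m) ^ n) \<partial>lborel)"
  proof (intro nn_integral_mono)
    fix s
    show "ennreal (\<Prod>i<n. f i - s) * indicator {0<..\<mu>} s \<le> ennreal (c * (1 - s / m) ^ n) * indicator {0..\<mu>} s"
      using prod_diff_le_mean[of n f s] n f \<mu> unfolding m_def c_def
      by (cases "s \<in> {0<..\<mu>}") (auto intro!: ennreal_leI intro: order_trans)
  qed
  also have "\<dots> = ennreal (F \<mu> - F 0)"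
  proof (rule nn_integral_FTC_Icc)
    fix s assume "s \<in> {0..\<mu>}"
    then have s: "0 \<le> s" "s \<le> \<mu>" by auto
    show "DERIV F s :> c * (1 - s / m) ^ n"
    proof -
      have "DERIV F s :> - (c * m / (n + 1)) * (real (n + 1) * (1 - s / m) ^ n * - (1 / m))"
        unfolding F_def[abs_def]
      proof (rule DERIV_cmult)
        have "DERIV (\<lambda>s. 1 - s / m) s :> - (1 / m)"
          using m by (auto intro!: derivative_eq_intros)
        then show "DERIV (\<lambda>s. (1 - s / m) ^ (n + 1)) s :> real (n + 1) * (1 - s / m) ^ n * - (1 / m)"
          using DERIV_power[of "\<lambda>s. 1 - s / m" "- (1 / m)" s UNIV "n + 1"] by (simp add: mult.commute mult.left_commute)
      qed
      moreover have "- (c * m / (n + 1)) * (real (n + 1) * (1 - s / m) ^ n * - (1 / m)) = c * (1 - s / m) ^ n"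
        using m by simp
      ultimately show ?thesis by simp
    qed
    show "0 \<le> c * (1 - s / m) ^ n"
      using c s \<open>\<mu> \<le> m\<close> m by (intro mult_nonneg_nonneg zero_le_power) (auto simp: field_simps)
  qed (use \<mu> in auto)
  also have "\<dots> \<le> ennreal (c * m / (n + 1))"
  proof (rule ennreal_leI)
    have "0 \<le> (c * m / (n + 1)) * (1 - \<mu> / m) ^ (n + 1)"
      using c m \<open>\<mu> \<le> m\<close> by (intro mult_nonneg_nonneg zero_le_power divide_nonneg_nonneg) (auto simp: field_simps)
    then show "F \<mu> - F 0 \<le> c * m / (n + 1)" by (simp add: F_def)
  qed
  finally show ?thesis by (simp add: m_def c_def)
qed

section \<open>Polar coordinates and integrals of derivatives\<close>

lemma nn_integral_lborel_scaleR:
  fixes f :: "'a::euclidean_space \<Rightarrow> ennreal"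
  assumes [measurable]: "f \<in> borel_measurable borel" and c: "0 < c"
  shows "(\<integral>\<^sup>+x. f x \<partial>lborel) = ennreal (c ^ DIM('a)) * (\<integral>\<^sup>+x. f (c *\<^sub>R x) \<partial>lborel)"
proof -
  have "(\<integral>\<^sup>+x. f x \<partial>lborel) = (\<integral>\<^sup>+x. f x \<partial>density (distr lborel borel (\<lambda>x. 0 + c *\<^sub>R x)) (\<lambda>_. \<bar>c\<bar> ^ DIM('a)))"
    using lborel_affine[of c "0 :: 'a"] c by simp
  also have "\<dots> = ennreal (c ^ DIM('a)) * (\<integral>\<^sup>+x. f (c *\<^sub>R x) \<partial>lborel)"
    using c by (simp add: nn_integral_density nn_integral_distr nn_integral_cmult)
  finally show ?thesis .
qed

lemma nn_integral_inverse_power_tail: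
  fixes a :: real
  assumes a: "0 < a" and N: "0 < N"
  shows "(\<integral>\<^sup>+t\<in>{a<..}. ennreal (1 / t ^ (N + 1)) \<partial>lborel) = ennreal (1 / (real N * a ^ N))"
proof -
  have "(\<integral>\<^sup>+t\<in>{a<..}. ennreal (1 / t ^ (N + 1)) \<partial>lborel) = (\<integral>\<^sup>+t\<in>{a..}. ennreal (1 / t ^ (N + 1)) \<partial>lborel)"
    by (rule nn_integral_cong_AE, use AE_lborel_singleton[of a] in eventually_elim) (auto simp: indicator_def)
  also have "\<dots> = ennreal (0 - (- (1 / (real N * a ^ N))))"
  proof (rule nn_integral_FTC_atLeast)
    fix t assume t: "a \<le> t"
    have "((\<lambda>t. - (1 / real N) * inverse (t ^ N)) has_real_derivative
        - (1 / real N) * - (inverse (t ^ N) * (real N * t ^ (N - Suc 0)) * inverse (t ^ N))) (at t)"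
      using t a by (auto intro!: derivative_eq_intros)
    moreover have "- (1 / real N) * - (inverse (t ^ N) * (real N * t ^ (N - Suc 0)) * inverse (t ^ N)) = 1 / t ^ (N + 1)"
    proof -
      obtain m where "N = Suc m" using N by (cases N) auto
      then show ?thesis using t a by (simp add: field_simps del: of_nat_Suc)
    qed
    moreover have "(\<lambda>t. - (1 / real N) * inverse (t ^ N)) = (\<lambda>t. - (1 / (real N * t ^ N)))"
      by (simp add: fun_eq_iff divide_inverse)
    ultimately show "((\<lambda>t. - (1 / (real N * t ^ N))) has_real_derivative 1 / t ^ (N + 1)) (at t)"
      by simp
    show "0 \<le> 1 / t ^ (N + 1)" using t a by simp
  next
    have "((\<lambda>t. - (1 / (real N * t ^ N))) \<longlongrightarrow> - 0) at_top"
      using N by (intro tendsto_minus tendsto_divide_0[OF tendsto_const] filterlim_at_top_imp_at_infinity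
          filterlim_tendsto_pos_mult_at_top[OF tendsto_const] filterlim_pow_at_top filterlim_ident) auto
    then show "((\<lambda>t. - (1 / (real N * t ^ N))) \<longlongrightarrow> 0) at_top" by simp
  qed simp
  finally show ?thesis by simp
qed

text \<open>
  Integration in polar coordinates, with the spherical measure replaced by Lebesgue measure on the
  unit ball (which weighs a cone by its solid angle divided by the dimension).
\<close>

lemma nn_integral_polar:
  fixes f :: "'a::euclidean_space \<Rightarrow> ennreal"
  assumes [measurable]: "f \<in> borel_measurable borel"
  shows "(\<integral>\<^sup>+x. f x \<partial>lborel) = of_nat DIM('a) * (\<integral>\<^sup>+y\<in>ball 0 1.
    (\<integral>\<^sup>+\<rho>\<in>{0<..}. f ((\<rho> / norm y) *\<^sub>R y) * ennreal (\<rho> ^ (DIM('a) - 1)) \<partial>lborel) \<partial>lborel)"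
proof -
  define N where "N = DIM('a)"
  have N: "0 < N" by (simp add: N_def)
  \<comment> \<open>The double integral is taken in \<open>(t, y)\<close> with
    \<open>x = t y\<close> and \<open>\<rho> = t |y|\<close>. Rescaling \<open>y\<close> at fixed
    \<open>t\<close> turns the unit ball into \<open>|x| < t\<close>, and integrating
    \<open>|x|^N / t^(N + 1)\<close> over \<open>t > |x|\<close> leaves the constant
    \<open>1 / N\<close>.\<close>
  define g where "g = (\<lambda>(t, y). f (t *\<^sub>R y) * ennreal (norm y ^ N * t ^ (N - 1)) * indicator {0<..} t * indicator (ball 0 1) y)"
  have [measurable]: "ball (0 :: 'a) 1 \<in> sets borel" by simp
  have [measurable]: "g \<in> borel_measurable (borel \<Otimes>\<^sub>M borel)"
    unfolding g_def by measurable
  have inner: "(\<integral>\<^sup>+\<rho>\<in>{0<..}. f ((\<rho> / norm y) *\<^sub>R y) * ennreal (\<rho> ^ (N - 1)) \<partial>lborel) * indicator (ball 0 1) y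
     = (\<integral>\<^sup>+t. g (t, y) \<partial>lborel)" if y: "y \<noteq> 0" for y
  proof -
    have "(\<integral>\<^sup>+\<rho>\<in>{0<..}. f ((\<rho> / norm y) *\<^sub>R y) * ennreal (\<rho> ^ (N - 1)) \<partial>lborel)
       = ennreal (norm y) * (\<integral>\<^sup>+t. f (t *\<^sub>R y) * ennreal ((norm y * t) ^ (N - 1)) * indicator {0<..} t \<partial>lborel)"
      by (subst nn_integral_real_affine[where c = "norm y" and t = 0])
        (use y in \<open>auto intro!: arg_cong2[where f = "(*)"] nn_integral_cong simp: indicator_def zero_less_mult_iff\<close>)
    also have "\<dots> = (\<integral>\<^sup>+t. f (t *\<^sub>R y) * ennreal (norm y ^ N * t ^ (N - 1)) * indicator {0<..} t \<partial>lborel)"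
    proof (subst nn_integral_cmult[symmetric], measurable, rule nn_integral_cong)
      fix t :: real
      have "norm y ^ N * t ^ (N - 1) = norm y * (norm y * t) ^ (N - 1)"
        using N by (cases N) (auto simp: power_mult_distrib)
      then show "ennreal (norm y) * (f (t *\<^sub>R y) * ennreal ((norm y * t) ^ (N - 1)) * indicator {0<..} t)
        = f (t *\<^sub>R y) * ennreal (norm y ^ N * t ^ (N - 1)) * indicator {0<..} t"
        by (auto simp: indicator_def ennreal_mult mult_ac)
    qed
    finally show ?thesis
      by (simp add: g_def nn_integral_multc)
  qed
  have outer: "(\<integral>\<^sup>+y. g (t, y) \<partial>lborel) = (\<integral>\<^sup>+x. f x * ennreal (norm x ^ N / t ^ (N + 1)) * indicator {0<..<t} (norm x) \<partial>lborel)" for t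
  proof (cases "0 < t")
    case True
    let ?h = "\<lambda>x. f x * ennreal (norm x ^ N / t ^ (N + 1)) * indicator {0<..<t} (norm x)"
    have "(\<integral>\<^sup>+x. ?h x \<partial>lborel) = ennreal (t ^ N) * (\<integral>\<^sup>+x. ?h (t *\<^sub>R x) \<partial>lborel)"
      unfolding N_def by (rule nn_integral_lborel_scaleR) (use True in auto)
    also have "\<dots> = (\<integral>\<^sup>+x. ennreal (t ^ N) * ?h (t *\<^sub>R x) \<partial>lborel)"
      by (rule nn_integral_cmult[symmetric]) measurable
    also have "\<dots> = (\<integral>\<^sup>+y. g (t, y) \<partial>lborel)"
    proof (rule nn_integral_cong)
      fix x :: 'a
      have "t ^ N * (norm (t *\<^sub>R x) ^ N / t ^ (N + 1)) = norm x ^ N * t ^ (N - 1)"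
        using True N by (cases N) (auto simp: power_mult_distrib field_simps)
      then have eq: "ennreal (t ^ N) * ennreal (norm (t *\<^sub>R x) ^ N / t ^ (N + 1)) = ennreal (norm x ^ N * t ^ (N - 1))"
        using True by (subst ennreal_mult[symmetric]) auto
      have ind: "indicator {0<..<t} (norm (t *\<^sub>R x)) = (indicator (ball 0 1) x :: ennreal)" if "x \<noteq> 0"
        using True that by (auto simp: indicator_def)
      show "ennreal (t ^ N) * ?h (t *\<^sub>R x) = g (t, x)"
      proof (cases "x = 0")
        case False
        have "ennreal (t ^ N) * ?h (t *\<^sub>R x) = f (t *\<^sub>R x) *
            (ennreal (t ^ N) * ennreal (norm (t *\<^sub>R x) ^ N / t ^ (N + 1))) * indicator {0<..<t} (norm (t *\<^sub>R x))"
          by (simp only: mult_ac)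
        then show ?thesis
          unfolding eq ind[OF False] using True by (simp add: g_def)
      qed (use N in \<open>simp add: g_def power_0_left\<close>)
    qed
    finally show ?thesis ..
  next
    case False
    then have "{0<..<t} = {}" by auto
    with False show ?thesis by (simp add: g_def)
  qed
  have "(\<integral>\<^sup>+y\<in>ball 0 1. (\<integral>\<^sup>+\<rho>\<in>{0<..}. f ((\<rho> / norm y) *\<^sub>R y) * ennreal (\<rho> ^ (N - 1)) \<partial>lborel) \<partial>lborel)
      = (\<integral>\<^sup>+y. \<integral>\<^sup>+t. g (t, y) \<partial>lborel \<partial>lborel)"
    by (rule nn_integral_cong_AE, use AE_lborel_singleton[of "0 :: 'a"] in eventually_elim) (rule inner)
  also have "\<dots> = (\<integral>\<^sup>+t. \<integral>\<^sup>+y. g (t, y) \<partial>lborel \<partial>lborel)"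
    by (rule lborel_pair.Fubini) simp
  also have "\<dots> = (\<integral>\<^sup>+t. \<integral>\<^sup>+x. f x * ennreal (norm x ^ N / t ^ (N + 1)) * indicator {0<..<t} (norm x) \<partial>lborel \<partial>lborel)"
    by (simp only: outer)
  also have "\<dots> = (\<integral>\<^sup>+x. \<integral>\<^sup>+t. f x * ennreal (norm x ^ N / t ^ (N + 1)) * indicator {0<..<t} (norm x) \<partial>lborel \<partial>lborel)"
    by (rule lborel_pair.Fubini'[where f = "\<lambda>x t. f x * ennreal (norm x ^ N / t ^ (N + 1)) * indicator {0<..<t} (norm x)"])
      (unfold indicator_def of_bool_def greaterThanLessThan_iff, measurable)
  also have "\<dots> = (\<integral>\<^sup>+x. f x * ennreal (1 / real N) \<partial>lborel)"
  proof (rule nn_integral_cong_AE, use AE_lborel_singleton[of "0 :: 'a"] in eventually_elim)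
    fix x :: 'a assume x: "x \<noteq> 0"
    have "(\<integral>\<^sup>+t. f x * ennreal (norm x ^ N / t ^ (N + 1)) * indicator {0<..<t} (norm x) \<partial>lborel)
      = (\<integral>\<^sup>+t. (f x * ennreal (norm x ^ N)) * (ennreal (1 / t ^ (N + 1)) * indicator {norm x<..} t) \<partial>lborel)"
    proof (intro nn_integral_cong)
      fix t :: real
      show "f x * ennreal (norm x ^ N / t ^ (N + 1)) * indicator {0<..<t} (norm x)
        = (f x * ennreal (norm x ^ N)) * (ennreal (1 / t ^ (N + 1)) * indicator {norm x<..} t)"
      proof (cases "norm x < t")
        case True
        then have "0 < t" using norm_ge_zero[of x] by linarith
        then have "ennreal (norm x ^ N / t ^ (N + 1)) = ennreal (norm x ^ N) * ennreal (1 / t ^ (N + 1))"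
          by (subst ennreal_mult[symmetric]) auto
        then show ?thesis using True x by (simp add: mult_ac)
      qed simp
    qed
    also have "\<dots> = (f x * ennreal (norm x ^ N)) * (\<integral>\<^sup>+t\<in>{norm x<..}. ennreal (1 / t ^ (N + 1)) \<partial>lborel)"
      by (rule nn_integral_cmult) measurable
    also have "\<dots> = f x * (ennreal (norm x ^ N) * ennreal (1 / (real N * norm x ^ N)))"
      using x N by (subst nn_integral_inverse_power_tail) (auto simp: mult.assoc)
    also have "ennreal (norm x ^ N) * ennreal (1 / (real N * norm x ^ N)) = ennreal (1 / real N)"
      using x by (subst ennreal_mult[symmetric]) auto
    finally show "(\<integral>\<^sup>+t. f x * ennreal (norm x ^ N / t ^ (N + 1)) * indicator {0<..<t} (norm x) \<partial>lborel) = f x * ennreal (1 / real N)" .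
  qed
  also have "\<dots> = (\<integral>\<^sup>+x. f x \<partial>lborel) * ennreal (1 / real N)"
    by (rule nn_integral_multc) measurable
  finally have "of_nat N * (\<integral>\<^sup>+y\<in>ball 0 1. (\<integral>\<^sup>+\<rho>\<in>{0<..}. f ((\<rho> / norm y) *\<^sub>R y) * ennreal (\<rho> ^ (N - 1)) \<partial>lborel) \<partial>lborel)
      = (\<integral>\<^sup>+x. f x \<partial>lborel) * (ennreal (real N) * ennreal (1 / real N))"
    by (simp add: mult_ac ennreal_of_nat_eq_real_of_nat)
  also have "ennreal (real N) * ennreal (1 / real N) = 1"
    using N by (subst ennreal_mult[symmetric]) auto
  finally show ?thesis by (simp add: N_def)
qed

text \<open>For a function of degree zero, every radial weight gives the same integral up to a
  factor that depends on the weight alone. This allows passing between the unit ball, powers of the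
  norm and a cutoff.\<close>

lemma nn_integral_polar_product:
  fixes g :: "'a::euclidean_space \<Rightarrow> ennreal" and w :: "real \<Rightarrow> ennreal"
  assumes [measurable]: "g \<in> borel_measurable borel" "w \<in> borel_measurable borel"
    and hom: "\<And>c x. 0 < c \<Longrightarrow> x \<noteq> 0 \<Longrightarrow> g (c *\<^sub>R x) = g x"
  shows "(\<integral>\<^sup>+x. g x * w (norm x) \<partial>lborel) =
    of_nat DIM('a) * (\<integral>\<^sup>+\<rho>\<in>{0<..}. w \<rho> * ennreal (\<rho> ^ (DIM('a) - 1)) \<partial>lborel) * (\<integral>\<^sup>+y\<in>ball 0 1. g y \<partial>lborel)"
proof -
  have [measurable]: "ball (0 :: 'a) 1 \<in> sets borel" by simp
  let ?W = "\<integral>\<^sup>+\<rho>\<in>{0<..}. w \<rho> * ennreal (\<rho> ^ (DIM('a) - 1)) \<partial>lborel"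
  have "(\<integral>\<^sup>+y\<in>ball 0 1. (\<integral>\<^sup>+\<rho>\<in>{0<..}. g ((\<rho> / norm y) *\<^sub>R y) * w (norm ((\<rho> / norm y) *\<^sub>R y)) *
      ennreal (\<rho> ^ (DIM('a) - 1)) \<partial>lborel) \<partial>lborel) = (\<integral>\<^sup>+y. ?W * (g y * indicator (ball 0 1) y) \<partial>lborel)"
  proof (rule nn_integral_cong_AE, use AE_lborel_singleton[of "0 :: 'a"] in eventually_elim)
    fix y :: 'a assume y: "y \<noteq> 0"
    have "(\<integral>\<^sup>+\<rho>\<in>{0<..}. g ((\<rho> / norm y) *\<^sub>R y) * w (norm ((\<rho> / norm y) *\<^sub>R y)) * ennreal (\<rho> ^ (DIM('a) - 1)) \<partial>lborel)
      = (\<integral>\<^sup>+\<rho>. g y * (w \<rho> * ennreal (\<rho> ^ (DIM('a) - 1)) * indicator {0<..} \<rho>) \<partial>lborel)"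
      using y by (intro nn_integral_cong) (auto simp: indicator_def hom mult_ac)
    also have "\<dots> = g y * ?W" by (rule nn_integral_cmult) measurable
    finally show "(\<integral>\<^sup>+\<rho>\<in>{0<..}. g ((\<rho> / norm y) *\<^sub>R y) * w (norm ((\<rho> / norm y) *\<^sub>R y)) * ennreal (\<rho> ^ (DIM('a) - 1)) \<partial>lborel)
      * indicator (ball 0 1) y = ?W * (g y * indicator (ball 0 1) y)" by (simp add: mult_ac)
  qed
  also have "\<dots> = ?W * (\<integral>\<^sup>+y\<in>ball 0 1. g y \<partial>lborel)" by (rule nn_integral_cmult) measurable
  finally show ?thesis
    by (subst nn_integral_polar) (simp_all add: mult.assoc)
qed

text \<open>Translation invariance makes the integrals of the difference quotients vanish. The
  quotients converge to the derivative, boundedly and with a common compact support, so dominated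
  convergence applies.\<close>

lemma integral_derivative_compact_support:
  fixes \<phi> :: "'a::euclidean_space \<Rightarrow> real"
  assumes deriv: "\<And>x. (\<phi> has_derivative \<phi>' x) (at x)" and cont: "continuous_on UNIV (\<lambda>x. \<phi>' x e)"
    and supp: "\<And>x. R \<le> norm x \<Longrightarrow> \<phi> x = 0"
  shows "integrable lborel (\<lambda>x. \<phi>' x e)" and "(\<integral>x. \<phi>' x e \<partial>lborel) = 0"
proof -
  have supp': "\<phi>' x e = 0" if "R < norm x" for x
  proof -
    have "((\<lambda>x. 0) has_derivative \<phi>' x) (at x)"
    proof (rule has_derivative_transform_within_open[OF deriv])
      show "open {x :: 'a. R < norm x}" by (intro open_Collect_less continuous_intros)
    qed (use that supp in auto)
    then have "\<phi>' x = (\<lambda>_. 0)"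
      by (rule has_derivative_unique[OF _ has_derivative_const])
    then show ?thesis by simp
  qed
  have compact_integrable: "integrable lborel f" if "continuous_on UNIV f" "\<And>x. S < norm x \<Longrightarrow> f x = 0"
    for f :: "'a \<Rightarrow> real" and S
  proof -
    have "integrable lborel (\<lambda>x. indicator (cball 0 S) x *\<^sub>R f x)"
      by (rule borel_integrable_compact) (use that in \<open>auto intro: continuous_on_subset\<close>)
    moreover have "(\<lambda>x. indicator (cball 0 S) x *\<^sub>R f x) = f"
      using that(2) by (auto simp: indicator_def fun_eq_iff not_le)
    ultimately show ?thesis by simp
  qed
  have cont\<phi>: "continuous_on UNIV \<phi>"
    by (intro continuous_at_imp_continuous_on ballI has_derivative_continuous[OF deriv])
  have int\<phi>: "integrable lborel \<phi>"
    by (rule compact_integrable[of _ R]) (use cont\<phi> supp in auto)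
  show int: "integrable lborel (\<lambda>x. \<phi>' x e)"
    using cont supp' by (rule compact_integrable)
  have "bounded ((\<lambda>x. \<phi>' x e) ` cball 0 R)"
    by (intro compact_imp_bounded compact_continuous_image continuous_on_subset[OF cont]) auto
  then obtain C where C: "0 < C" "\<And>x. norm x \<le> R \<Longrightarrow> \<bar>\<phi>' x e\<bar> \<le> C"
    unfolding bounded_pos by auto
  have bound: "\<bar>\<phi>' x e\<bar> \<le> C" for x
    using C supp'[of x] by (cases "norm x \<le> R") auto
  \<comment> \<open>The steps \<open>1 / Suc k\<close> are nonzero and at most \<open>1\<close>, so
    all quotients vanish outside the ball of radius \<open>R + norm e\<close>.\<close>
  define D where "D k x = (\<phi> (x + (1 / real (Suc k)) *\<^sub>R e) - \<phi> x) * real (Suc k)" for k x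
  have line: "((\<lambda>t. \<phi> (x + t *\<^sub>R e)) has_real_derivative \<phi>' (x + t *\<^sub>R e) e) (at t)" for x t
  proof -
    have "((\<lambda>t. x + t *\<^sub>R e) has_derivative (\<lambda>s. s *\<^sub>R e)) (at t)"
      by (auto intro!: derivative_eq_intros)
    then have "((\<lambda>t. \<phi> (x + t *\<^sub>R e)) has_derivative (\<lambda>s. \<phi>' (x + t *\<^sub>R e) (s *\<^sub>R e))) (at t)"
      by (rule has_derivative_compose) (rule deriv)
    moreover have "(\<lambda>s. \<phi>' (x + t *\<^sub>R e) (s *\<^sub>R e)) = (*) (\<phi>' (x + t *\<^sub>R e) e)"
      using has_derivative_linear[OF deriv, of "x + t *\<^sub>R e"] by (auto simp: linear_cmul mult.commute)
    ultimately show ?thesis by (simp add: has_field_derivative_def)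
  qed
  have D_le: "\<bar>D k x\<bar> \<le> C" for k x
  proof -
    obtain t where "\<phi> (x + (1 / real (Suc k)) *\<^sub>R e) - \<phi> (x + 0 *\<^sub>R e) = (1 / real (Suc k) - 0) * \<phi>' (x + t *\<^sub>R e) e"
      using MVT2[of 0 "1 / real (Suc k)" "\<lambda>t. \<phi> (x + t *\<^sub>R e)" "\<lambda>t. \<phi>' (x + t *\<^sub>R e) e"] line by auto
    then have "D k x = \<phi>' (x + t *\<^sub>R e) e" by (simp add: D_def)
    then show ?thesis using bound by simp
  qed
  have D_lim: "(\<lambda>k. D k x) \<longlonglongrightarrow> \<phi>' x e" for x
  proof -
    have "((\<lambda>h. (\<phi> (x + (0 + h) *\<^sub>R e) - \<phi> (x + 0 *\<^sub>R e)) / h) \<longlongrightarrow> \<phi>' (x + 0 *\<^sub>R e) e) (at 0)"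
      using line[of x 0] unfolding DERIV_def .
    moreover have "filterlim (\<lambda>k. 1 / real (Suc k)) (at 0) sequentially"
      using LIMSEQ_inverse_real_of_nat by (auto simp: filterlim_at inverse_eq_divide)
    ultimately have "(\<lambda>k. (\<phi> (x + (0 + 1 / real (Suc k)) *\<^sub>R e) - \<phi> (x + 0 *\<^sub>R e)) / (1 / real (Suc k))) \<longlonglongrightarrow> \<phi>' (x + 0 *\<^sub>R e) e"
      by (rule filterlim_compose)
    then show ?thesis by (simp add: D_def)
  qed
  have shift: "has_bochner_integral lborel (\<lambda>x. \<phi> (x + c)) (\<integral>x. \<phi> x \<partial>lborel)" for c
  proof -
    have [measurable]: "\<phi> \<in> borel_measurable borel"
      using cont\<phi> by (rule borel_measurable_continuous_onI)
    have "integrable (distr lborel borel ((+) c)) \<phi>" "(\<integral>x. \<phi> x \<partial>distr lborel borel ((+) c)) = (\<integral>x. \<phi> x \<partial>lborel)"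
      unfolding lborel_distr_plus using int\<phi> by simp_all
    then show ?thesis
      by (simp add: integrable_distr_eq integral_distr has_bochner_integral_iff add.commute)
  qed
  have "(\<integral>x. D k x \<partial>lborel) = 0" for k
    unfolding D_def using shift[of "(1 / real (Suc k)) *\<^sub>R e"] int\<phi>
    by (simp add: has_bochner_integral_iff)
  moreover have "(\<lambda>k. \<integral>x. D k x \<partial>lborel) \<longlonglongrightarrow> (\<integral>x. \<phi>' x e \<partial>lborel)"
  proof (rule integral_dominated_convergence)
    let ?B = "cball (0 :: 'a) (R + norm e)"
    show "integrable lborel (\<lambda>x. C * indicator ?B x)"
      using emeasure_bounded_finite[of ?B] by (intro integrable_mult_right integrable_real_indicator) auto
    show "AE x in lborel. norm (D k x) \<le> C * indicator ?B x" for k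
    proof (rule AE_I2)
      fix x :: 'a
      have "D k x = 0" if x: "R + norm e < norm x"
      proof -
        have "norm x \<le> norm (x + (1 / real (Suc k)) *\<^sub>R e) + norm ((1 / real (Suc k)) *\<^sub>R e)"
          by (metis add_diff_cancel norm_triangle_ineq4)
        moreover have "norm ((1 / real (Suc k)) *\<^sub>R e) \<le> norm e"
          by (simp add: divide_le_eq algebra_simps)
        ultimately have "R \<le> norm (x + (1 / real (Suc k)) *\<^sub>R e)" using x by linarith
        moreover have "R \<le> norm x" using x norm_ge_zero[of e] by linarith
        ultimately show ?thesis by (simp add: D_def supp)
      qed
      then show "norm (D k x) \<le> C * indicator ?B x"
        using D_le by (auto simp: indicator_def)
    qed
    show "D k \<in> borel_measurable lborel" for k
      unfolding D_def using borel_measurable_continuous_onI[OF cont\<phi>] by measurable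
  qed (use int D_lim in auto)
  ultimately show "(\<integral>x. \<phi>' x e \<partial>lborel) = 0"
    by (simp add: LIMSEQ_const_iff)
qed

section \<open>Tangent directions and implicit differentiation\<close>

text \<open>The double difference is \<open>g s - g 0\<close> with
  \<open>g t = f (x + t v + s w) - f (x + t v)\<close>. The mean value theorem reduces it to a
  difference of values of \<open>f' y v\<close>, which differentiability of that function at the
  single point \<open>x\<close> evaluates as \<open>s * D w\<close> up to o(s).\<close>

lemma second_difference_estimate:
  fixes f :: "'a::real_normed_vector \<Rightarrow> real"
  assumes "open U" "x \<in> U" and deriv: "\<And>y. y \<in> U \<Longrightarrow> (f has_derivative f' y) (at y)"
    and second: "((\<lambda>y. f' y v) has_derivative D) (at x)" and "0 < e"
  shows "\<exists>d>0. \<forall>s. 0 < s \<and> s < d \<longrightarrow>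
    \<bar>f (x + s *\<^sub>R v + s *\<^sub>R w) - f (x + s *\<^sub>R v) - f (x + s *\<^sub>R w) + f x - s\<^sup>2 * D w\<bar> \<le> e * s\<^sup>2"
proof -
  interpret D: bounded_linear D using second by (rule has_derivative_bounded_linear)
  define m where "m = norm v + norm w + 1"
  have m: "0 < m" unfolding m_def by (simp add: add_nonneg_pos)
  obtain d1 where d1: "0 < d1" "ball x d1 \<subseteq> U"
    using assms(1,2) open_contains_ball by blast
  obtain d2 where d2: "0 < d2"
    "\<And>y. norm (y - x) < d2 \<Longrightarrow> \<bar>f' y v - f' x v - D (y - x)\<bar> \<le> e / (2 * m) * norm (y - x)"
  proof -
    have "0 < e / (2 * m)" using \<open>0 < e\<close> m by simp
    then show ?thesis using second that unfolding has_derivative_at_alt real_norm_def by blast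
  qed
  define d where "d = min d1 d2 / m"
  show ?thesis
  proof (intro exI[of _ d] conjI allI impI)
    show "0 < d" using d1 d2 m by (simp add: d_def)
    fix s assume s: "0 < s \<and> s < d"
    have sm: "s * m < d1" "s * m < d2" using s m by (auto simp: d_def field_simps)
    define g where "g t = f (x + t *\<^sub>R v + s *\<^sub>R w) - f (x + t *\<^sub>R v)" for t
    have small: "norm (t *\<^sub>R v + a *\<^sub>R w) \<le> s * m" if "0 \<le> t" "t \<le> s" "0 \<le> a" "a \<le> s" for t a
    proof -
      have "norm (t *\<^sub>R v + a *\<^sub>R w) \<le> t * norm v + a * norm w"
        using that norm_triangle_ineq[of "t *\<^sub>R v" "a *\<^sub>R w"] by simp
      also have "\<dots> \<le> s * norm v + s * norm w"
        using that by (intro add_mono mult_right_mono) auto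
      also have "\<dots> \<le> s * m" using s by (simp add: m_def algebra_simps)
      finally show ?thesis .
    qed
    have inU: "x + t *\<^sub>R v + a *\<^sub>R w \<in> U" if "0 \<le> t" "t \<le> s" "0 \<le> a" "a \<le> s" for t a
    proof -
      have "dist x (x + t *\<^sub>R v + a *\<^sub>R w) = norm (t *\<^sub>R v + a *\<^sub>R w)"
        by (metis add.assoc add_diff_cancel_left' dist_commute dist_norm)
      then show ?thesis
        using small[OF that] sm d1(2) by (intro subsetD[OF d1(2)]) simp
    qed
    have line: "((\<lambda>t. f (x + t *\<^sub>R v + a *\<^sub>R w)) has_real_derivative f' (x + t *\<^sub>R v + a *\<^sub>R w) v) (at t)"
      if "0 \<le> t" "t \<le> s" "0 \<le> a" "a \<le> s" for t a
    proof -
      have "((\<lambda>t. x + t *\<^sub>R v + a *\<^sub>R w) has_derivative (\<lambda>h. h *\<^sub>R v)) (at t)"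
        by (auto intro!: derivative_eq_intros)
      then have "((\<lambda>t. f (x + t *\<^sub>R v + a *\<^sub>R w)) has_derivative (\<lambda>h. f' (x + t *\<^sub>R v + a *\<^sub>R w) (h *\<^sub>R v))) (at t)"
        by (rule has_derivative_compose) (rule deriv[OF inU[OF that]])
      moreover have "(\<lambda>h. f' (x + t *\<^sub>R v + a *\<^sub>R w) (h *\<^sub>R v)) = (*) (f' (x + t *\<^sub>R v + a *\<^sub>R w) v)"
        using has_derivative_linear[OF deriv[OF inU[OF that]]] by (auto simp: linear_cmul mult.commute)
      ultimately show ?thesis by (simp add: has_field_derivative_def)
    qed
    have "\<exists>t>0. t < s \<and> g s - g 0 = (s - 0) * (f' (x + t *\<^sub>R v + s *\<^sub>R w) v - f' (x + t *\<^sub>R v) v)"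
      unfolding g_def using s line[of _ s] line[of _ 0]
      by (intro MVT2) (auto intro!: DERIV_diff)
    then obtain t where t: "0 < t" "t < s"
      "g s - g 0 = s * (f' (x + t *\<^sub>R v + s *\<^sub>R w) v - f' (x + t *\<^sub>R v) v)" by auto
    have est: "\<bar>f' (x + y) v - f' x v - D y\<bar> \<le> e / 2 * s" if "norm y \<le> s * m" for y
    proof -
      have "\<bar>f' (x + y) v - f' x v - D y\<bar> \<le> e / (2 * m) * norm y"
        using d2(2)[of "x + y"] that sm by simp
      also have "\<dots> \<le> e / (2 * m) * (s * m)"
        using that \<open>0 < e\<close> m by (intro mult_left_mono) auto
      finally show ?thesis using m by simp
    qed
    have e1: "\<bar>f' (x + t *\<^sub>R v + s *\<^sub>R w) v - f' x v - (t * D v + s * D w)\<bar> \<le> e / 2 * s"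
      using est[OF small[of t s]] t s by (simp add: D.add D.scaleR add.assoc)
    have e2: "\<bar>f' (x + t *\<^sub>R v) v - f' x v - t * D v\<bar> \<le> e / 2 * s"
      using est[OF small[of t 0]] t s by (simp add: D.add D.scaleR D.zero)
    have "\<bar>(f' (x + t *\<^sub>R v + s *\<^sub>R w) v - f' (x + t *\<^sub>R v) v) - s * D w\<bar> \<le> e * s"
      using e1 e2 by linarith
    then have "s * \<bar>(f' (x + t *\<^sub>R v + s *\<^sub>R w) v - f' (x + t *\<^sub>R v) v) - s * D w\<bar> \<le> s * (e * s)"
      using s by (intro mult_left_mono) auto
    moreover have "\<bar>g s - g 0 - s\<^sup>2 * D w\<bar> = s * \<bar>(f' (x + t *\<^sub>R v + s *\<^sub>R w) v - f' (x + t *\<^sub>R v) v) - s * D w\<bar>"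
    proof -
      have "g s - g 0 - s\<^sup>2 * D w = s * ((f' (x + t *\<^sub>R v + s *\<^sub>R w) v - f' (x + t *\<^sub>R v) v) - s * D w)"
        unfolding t(3) by (simp add: algebra_simps power2_eq_square)
      then show ?thesis using s by (simp add: abs_mult)
    qed
    ultimately show "\<bar>f (x + s *\<^sub>R v + s *\<^sub>R w) - f (x + s *\<^sub>R v) - f (x + s *\<^sub>R w) + f x - s\<^sup>2 * D w\<bar> \<le> e * s\<^sup>2"
      by (simp add: g_def power2_eq_square mult_ac)
  qed
qed

text \<open>The double difference is symmetric in \<open>v\<close> and \<open>w\<close>, so its two
  expansions \<open>s^2 D w\<close> and \<open>s^2 E v\<close> agree to second order.\<close>

lemma second_derivative_symmetric:
  fixes f :: "'a::real_normed_vector \<Rightarrow> real"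
  assumes U: "open U" "x \<in> U" and deriv: "\<And>y. y \<in> U \<Longrightarrow> (f has_derivative f' y) (at y)"
    and v: "((\<lambda>y. f' y v) has_derivative D) (at x)" and w: "((\<lambda>y. f' y w) has_derivative E) (at x)"
  shows "D w = E v"
proof (rule ccontr)
  assume "D w \<noteq> E v"
  define e where "e = \<bar>D w - E v\<bar> / 3"
  have e: "0 < e" using \<open>D w \<noteq> E v\<close> by (simp add: e_def)
  obtain d1 where d1: "0 < d1" "\<And>s. 0 < s \<and> s < d1 \<Longrightarrow>
    \<bar>f (x + s *\<^sub>R v + s *\<^sub>R w) - f (x + s *\<^sub>R v) - f (x + s *\<^sub>R w) + f x - s\<^sup>2 * D w\<bar> \<le> e * s\<^sup>2"
    using second_difference_estimate[OF U deriv v e] by blast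
  obtain d2 where d2: "0 < d2" "\<And>s. 0 < s \<and> s < d2 \<Longrightarrow>
    \<bar>f (x + s *\<^sub>R w + s *\<^sub>R v) - f (x + s *\<^sub>R w) - f (x + s *\<^sub>R v) + f x - s\<^sup>2 * E v\<bar> \<le> e * s\<^sup>2"
    using second_difference_estimate[OF U deriv w e] by blast
  obtain s where s: "0 < s" "s < d1" "s < d2"
    using d1(1) d2(1) by (metis field_lbound_gt_zero)
  have "f (x + s *\<^sub>R w + s *\<^sub>R v) = f (x + s *\<^sub>R v + s *\<^sub>R w)" by (simp add: add_ac)
  then have "\<bar>s\<^sup>2 * D w - s\<^sup>2 * E v\<bar> \<le> 2 * (e * s\<^sup>2)"
    using d1(2)[of s] d2(2)[of s] s by linarith
  moreover have "\<bar>s\<^sup>2 * D w - s\<^sup>2 * E v\<bar> = s\<^sup>2 * (3 * e)"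
    by (simp add: e_def right_diff_distrib[symmetric] abs_mult)
  ultimately show False using e s by simp
qed

text \<open>The contingent cone: \<open>w\<close> is a limit of quotients \<open>(y - x) / s\<close>
  with \<open>y\<close> in \<open>S\<close> and \<open>s\<close> tending to zero from above. A
  single \<open>e\<close> bounds both the step and the relative error.\<close>

definition tangential :: "'a::real_normed_vector set \<Rightarrow> 'a \<Rightarrow> 'a \<Rightarrow> bool" where
  "tangential S x w \<longleftrightarrow> (\<forall>e>0. \<exists>s y. 0 < s \<and> s < e \<and> y \<in> S \<and> norm (y - x - s *\<^sub>R w) \<le> e * s)"

text \<open>Two derivatives within \<open>S\<close> have the same limit along points of
  \<open>S\<close> that approach \<open>x\<close> in direction \<open>w\<close>. This controls the
  choice hidden in \<open>frechet_derivative\<close> for derivatives within a hypersurface.\<close>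

lemma tangential_derivative_unique:
  fixes f :: "'a::real_normed_vector \<Rightarrow> 'b::real_normed_vector"
  assumes f1: "(f has_derivative f1) (at x within S)" and f2: "(f has_derivative f2) (at x within S)"
    and tan: "tangential S x w"
  shows "f1 w = f2 w"
proof -
  define D where "D = (\<lambda>h. f1 h - f2 h)"
  have der: "((\<lambda>y. 0) has_derivative D) (at x within S)"
    using has_derivative_diff[OF f1 f2] by (simp add: D_def)
  then interpret D: bounded_linear D by (rule has_derivative_bounded_linear)
  obtain B where B: "0 < B" "\<And>h. norm (D h) \<le> norm h * B"
    using D.pos_bounded by auto
  have "norm (D w) \<le> 0 + e" if e: "0 < e" for e
  proof -
    define a where "a = e / (2 * (norm w + 1))"
    have w1: "0 < norm w + 1" by (simp add: add_nonneg_pos)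
    have a: "0 < a" using e w1 by (simp add: a_def)
    obtain d where d: "0 < d" "\<And>y. y \<in> S \<Longrightarrow> norm (y - x) < d \<Longrightarrow> norm (D (y - x)) \<le> a * norm (y - x)"
      using der a unfolding has_derivative_within_alt by (metis diff_zero norm_minus_cancel diff_0)
    define c where "c = min 1 (min (d / (norm w + 1)) (e / (2 * B)))"
    have c: "0 < c" "c \<le> 1" "c * (norm w + 1) \<le> d" "c * B \<le> e / 2"
    proof -
      have "c \<le> d / (norm w + 1)" "c \<le> e / (2 * B)" by (auto simp: c_def)
      then show "c * (norm w + 1) \<le> d" "c * B \<le> e / 2"
        using w1 B(1) by (simp_all add: pos_le_divide_eq mult_ac)
      show "0 < c" "c \<le> 1" using d(1) w1 B(1) e by (auto simp: c_def)
    qed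
    obtain s y where s: "0 < s" "s < c" and y: "y \<in> S" "norm (y - x - s *\<^sub>R w) \<le> c * s"
      using tan c(1) unfolding tangential_def by blast
    define r where "r = y - x - s *\<^sub>R w"
    have r: "norm r \<le> c * s" using y by (simp add: r_def)
    have "norm (y - x) \<le> norm (s *\<^sub>R w) + norm r"
      using norm_triangle_ineq[of "s *\<^sub>R w" r] by (simp add: r_def)
    also have "\<dots> \<le> s * norm w + s * 1"
      using r s c(2) by (intro add_mono) (auto intro: order_trans mult_left_le_one_le simp: mult_le_cancel_right1)
    finally have yx: "norm (y - x) \<le> s * (norm w + 1)" by (simp add: algebra_simps)
    also have "\<dots> < c * (norm w + 1)" using s w1 by simp
    finally have "norm (y - x) < d" using c(3) by linarith
    then have "norm (D (y - x)) \<le> a * norm (y - x)" using d(2) y(1) by blast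
    also have "\<dots> \<le> a * (s * (norm w + 1))" using yx a by simp
    also have "\<dots> = s * (e / 2)"
    proof -
      have "a * (norm w + 1) = e / 2" using w1 by (simp add: a_def divide_simps)
      then show ?thesis by (metis mult.left_commute)
    qed
    finally have 1: "norm (D (y - x)) \<le> s * (e / 2)" .
    have "norm (D r) \<le> norm r * B" by (rule B)
    also have "\<dots> \<le> (c * s) * B" using r B(1) by simp
    also have "\<dots> = s * (c * B)" by simp
    also have "\<dots> \<le> s * (e / 2)" using c(4) s by (intro mult_left_mono) auto
    finally have 2: "norm (D r) \<le> s * (e / 2)" .
    have "s *\<^sub>R D w = D (y - x) - D r"
      by (simp add: r_def D.diff D.scaleR)
    then have "norm (s *\<^sub>R D w) \<le> norm (D (y - x)) + norm (D r)"
      using norm_triangle_ineq4 by metis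
    moreover have "norm (s *\<^sub>R D w) = s * norm (D w)" using s by simp
    moreover have "s * (e / 2) + s * (e / 2) = s * e" by simp
    ultimately have "s * norm (D w) \<le> s * e" using 1 2 by linarith
    then show ?thesis using s by simp
  qed
  then have "norm (D w) \<le> 0" by (rule field_le_epsilon)
  then show ?thesis by (simp add: D_def)
qed

text \<open>The value of \<open>f\<close> at \<open>x + s w\<close> is o(s). Moving that point along
  \<open>g\<close> by \<open>e * s\<close> in either direction gives \<open>f\<close> opposite
  signs, and the intermediate value theorem finds a zero in between.\<close>

lemma tangential_level_set:
  fixes f :: "'a::real_inner \<Rightarrow> real"
  assumes U: "open U" "x \<in> U" and cont: "continuous_on U f" and deriv: "(f has_derivative (\<lambda>v. g \<bullet> v)) (at x)"
    and g: "g \<noteq> 0" and "f x = 0" and w: "g \<bullet> w = 0"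
  shows "tangential {y \<in> U. f y = 0} x w"
  unfolding tangential_def
proof (intro allI impI)
  fix e :: real assume e: "0 < e"
  define a where "a = e / norm g"
  have a: "0 < a" "a * norm g = e" using e g by (auto simp: a_def)
  define m where "m = norm w + e"
  have m: "0 < m" using e by (simp add: m_def add_nonneg_pos)
  have gg: "0 < e * norm g" using e g by simp
  obtain d1 where d1: "0 < d1" "ball x d1 \<subseteq> U" using U open_contains_ball by blast
  \<comment> \<open>Over a distance of at most \<open>s * m\<close> the linearization error is then
    at most half of \<open>s * (e * norm g)\<close>, the change of \<open>f\<close> predicted for
    the correction along \<open>g\<close>, so it cannot reverse the sign.\<close>
  define b where "b = e * norm g / (2 * m)"
  have b: "0 < b" using gg m by (simp add: b_def)
  obtain d2 where d2: "0 < d2" "\<And>y. norm (y - x) < d2 \<Longrightarrow> \<bar>f y - f x - g \<bullet> (y - x)\<bar> \<le> b * norm (y - x)"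
    using deriv b unfolding has_derivative_at_alt real_norm_def by blast
  define s where "s = min e (min d1 d2 / m) / 2"
  have s: "0 < s" "s < e" "s * m < d1" "s * m < d2"
    using e m d1(1) d2(1) by (auto simp: s_def min_def field_simps)
  define p where "p t = x + s *\<^sub>R w + (t * a * s) *\<^sub>R g" for t
  have px: "norm (p t - x) \<le> s * m" if "\<bar>t\<bar> \<le> 1" for t
  proof -
    have "norm (p t - x) \<le> norm (s *\<^sub>R w) + norm ((t * a * s) *\<^sub>R g)"
      unfolding p_def using norm_triangle_ineq[of "s *\<^sub>R w" "(t * a * s) *\<^sub>R g"] by (simp add: add.assoc)
    also have "norm ((t * a * s) *\<^sub>R g) = \<bar>t\<bar> * (s * e)"
      using a s by (simp add: abs_mult mult_ac)
    also have "\<dots> \<le> 1 * (s * e)" using that s e by (intro mult_right_mono) auto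
    finally show ?thesis using s by (simp add: m_def algebra_simps)
  qed
  have pU: "p t \<in> U" if "\<bar>t\<bar> \<le> 1" for t
    using px[OF that] s d1(2) by (intro subsetD[OF d1(2)]) (simp add: dist_norm norm_minus_commute)
  have fp: "\<bar>f (p t) - t * (s * (e * norm g))\<bar> \<le> s * (e * norm g) / 2" if "\<bar>t\<bar> \<le> 1" for t
  proof -
    have "g \<bullet> (p t - x) = t * (s * (e * norm g))"
    proof -
      have "g \<bullet> (p t - x) = t * a * s * (norm g * norm g)"
        using w by (simp add: p_def inner_add_right dot_square_norm power2_eq_square)
      also have "\<dots> = t * (s * ((a * norm g) * norm g))" by (simp only: mult_ac)
      finally show ?thesis using a by simp
    qed
    then have "\<bar>f (p t) - t * (s * (e * norm g))\<bar> \<le> b * norm (p t - x)"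
      using d2(2)[of "p t"] px[OF that] s \<open>f x = 0\<close> by simp
    also have "\<dots> \<le> b * (s * m)" using px[OF that] b by simp
    also have "\<dots> = s * (e * norm g) / 2" using m by (simp add: b_def)
    finally show ?thesis .
  qed
  have "0 < s * (e * norm g)" using s gg by simp
  moreover have "\<bar>f (p (-1)) - (-1) * (s * (e * norm g))\<bar> \<le> s * (e * norm g) / 2"
    "\<bar>f (p 1) - 1 * (s * (e * norm g))\<bar> \<le> s * (e * norm g) / 2"
    by (rule fp; simp)+
  ultimately have "f (p (-1)) \<le> 0" "0 \<le> f (p 1)" by linarith+
  moreover have "continuous_on {-1..1} (\<lambda>t. f (p t))"
  proof (rule continuous_on_compose2[OF cont])
    show "continuous_on {-1..1} p" unfolding p_def by (intro continuous_intros)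
    show "p ` {-1..1} \<subseteq> U" using pU by auto
  qed
  ultimately obtain t where t: "-1 \<le> t" "t \<le> 1" "f (p t) = 0"
    using IVT'[of "\<lambda>t. f (p t)" "-1" 0 1] by auto
  show "\<exists>s y. 0 < s \<and> s < e \<and> y \<in> {y \<in> U. f y = 0} \<and> norm (y - x - s *\<^sub>R w) \<le> e * s"
  proof (intro exI[of _ s] exI[of _ "p t"] conjI)
    show "p t \<in> {y \<in> U. f y = 0}" using pU t by auto
    have "norm (p t - x - s *\<^sub>R w) = \<bar>t\<bar> * (e * s)"
      using a s by (simp add: p_def abs_mult mult_ac)
    also have "\<dots> \<le> 1 * (e * s)" using t s e by (intro mult_right_mono) auto
    finally show "norm (p t - x - s *\<^sub>R w) \<le> e * s" by simp
  qed (use s in auto)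
qed

lemma tangential_mono: "tangential S x w \<Longrightarrow> S \<subseteq> T \<Longrightarrow> tangential T x w"
  unfolding tangential_def by blast

lemma tangential_unit_sphere:
  fixes z :: "'a::euclidean_space"
  assumes "norm z = 1" "w \<bullet> z = 0"
  shows "tangential (sphere 0 1) z w"
proof -
  have "tangential {y \<in> UNIV. y \<bullet> y - 1 = 0} z w"
  proof (rule tangential_level_set[where g = "2 *\<^sub>R z"])
    show "((\<lambda>y. y \<bullet> y - 1) has_derivative (\<bullet>) (2 *\<^sub>R z)) (at z)"
      by (auto intro!: derivative_eq_intros simp: inner_commute)
  qed (use assms in \<open>auto intro!: continuous_intros simp: norm_eq_1 inner_commute\<close>)
  then show ?thesis by (rule tangential_mono) (auto simp: norm_eq_1)
qed

text \<open>\<open>X\<close> is already given and continuous. The injective map \<open>L\<close> is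
  bounded below, so the remainder \<open>X y - X x - A (y - x)\<close> is controlled by its image
  under \<open>L\<close>, which the two known derivatives estimate.\<close>

lemma has_derivative_implicit:
  fixes \<Theta> :: "'b::euclidean_space \<Rightarrow> 'c::euclidean_space" and X :: "'a::real_normed_vector \<Rightarrow> 'b"
  assumes \<Theta>: "(\<Theta> has_derivative L) (at (X x))" and inj: "inj L" and cont: "isCont X x"
    and comp: "((\<lambda>y. \<Theta> (X y)) has_derivative P) (at x)"
    and A: "bounded_linear A" "\<And>v. L (A v) = P v"
  shows "(X has_derivative A) (at x)"
proof -
  interpret L: bounded_linear L using \<Theta> by (rule has_derivative_bounded_linear)
  interpret A: bounded_linear A by fact
  obtain c where c: "0 < c" "\<And>v. c * norm v \<le> norm (L v)"
    using linear_inj_bounded_below_pos[OF L.linear_axioms inj] by (auto simp: mult.commute)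
  obtain a where a: "0 < a" "\<And>v. norm (A v) \<le> norm v * a"
    using A.pos_bounded by auto
  show ?thesis
    unfolding has_derivative_at_alt
  proof (intro conjI allI impI)
    fix e :: real assume e: "0 < e"
    \<comment> \<open>The bound \<open>c / 2\<close> lets the term with the remainder
      \<open>R\<close> be absorbed on the left; the other bound makes what is left at most
      \<open>e * norm (y - x)\<close>.\<close>
    define b where "b = min (c / 2) (e * c / (2 * (a + 1)))"
    have b: "0 < b" "b \<le> c / 2" "b * (a + 1) \<le> e * c / 2"
    proof -
      have "b \<le> e * c / (2 * (a + 1))" by (simp add: b_def)
      then show "b * (a + 1) \<le> e * c / 2" using a by (simp add: pos_le_divide_eq mult_ac)
      show "0 < b" using a c e by (simp add: b_def)
      show "b \<le> c / 2" unfolding b_def by (rule min.cobounded1)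
    qed
    obtain d1 where d1: "0 < d1"
      "\<And>y. norm (y - X x) < d1 \<Longrightarrow> norm (\<Theta> y - \<Theta> (X x) - L (y - X x)) \<le> b * norm (y - X x)"
      using \<Theta> b(1) unfolding has_derivative_at_alt by blast
    obtain d2 where d2: "0 < d2" "\<And>y. norm (y - x) < d2 \<Longrightarrow> norm (X y - X x) < d1"
      using cont d1(1) unfolding continuous_at_eps_delta dist_norm by blast
    obtain d3 where d3: "0 < d3"
      "\<And>y. norm (y - x) < d3 \<Longrightarrow> norm (\<Theta> (X y) - \<Theta> (X x) - P (y - x)) \<le> b * norm (y - x)"
      using comp b(1) unfolding has_derivative_at_alt by blast
    show "\<exists>d>0. \<forall>y. norm (y - x) < d \<longrightarrow> norm (X y - X x - A (y - x)) \<le> e * norm (y - x)"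
    proof (intro exI[of _ "min d2 d3"] conjI allI impI)
      fix y assume y: "norm (y - x) < min d2 d3"
      define R where "R = X y - X x - A (y - x)"
      have "norm (X y - X x) \<le> norm R + norm (A (y - x))"
        using norm_triangle_ineq[of R "A (y - x)"] by (simp add: R_def)
      then have Xd: "norm (X y - X x) \<le> norm R + norm (y - x) * a"
        using a(2)[of "y - x"] by linarith
      have "L R = (\<Theta> (X y) - \<Theta> (X x) - P (y - x)) - (\<Theta> (X y) - \<Theta> (X x) - L (X y - X x))"
        unfolding R_def by (simp add: L.diff A(2)[symmetric])
      then have "norm (L R) \<le> norm (\<Theta> (X y) - \<Theta> (X x) - P (y - x)) + norm (\<Theta> (X y) - \<Theta> (X x) - L (X y - X x))"
        by (metis norm_triangle_ineq4)
      also have "\<dots> \<le> b * norm (y - x) + b * norm (X y - X x)"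
        using y d1(2) d2(2) d3(2) by (intro add_mono) auto
      also have "\<dots> \<le> b * norm (y - x) + b * (norm R + norm (y - x) * a)"
        using Xd b by simp
      also have "\<dots> = b * (a + 1) * norm (y - x) + b * norm R"
        by (simp add: algebra_simps)
      also have "\<dots> \<le> (e * c / 2) * norm (y - x) + (c / 2) * norm R"
        using b by (intro add_mono mult_right_mono) auto
      finally have "c * norm R \<le> (e * c / 2) * norm (y - x) + (c / 2) * norm R"
        using c(2)[of R] by linarith
      then have "c * norm R \<le> c * (e * norm (y - x))" by (simp add: algebra_simps)
      then show "norm (X y - X x - A (y - x)) \<le> e * norm (y - x)"
        using c(1) by (simp add: R_def)
    qed (use d2 d3 in auto)
  qed (rule A)
qed

text \<open>In finite dimension, continuity of each \<open>B x v\<close> is continuity in operator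
  norm, and the lower bound for the injective map \<open>B x\<close> turns closeness of the data
  into closeness of the solutions.\<close>

lemma continuous_on_linear_solution:
  fixes B :: "'p::metric_space \<Rightarrow> 'a::euclidean_space \<Rightarrow> 'b::euclidean_space"
  assumes lin: "\<And>x. x \<in> S \<Longrightarrow> linear (B x)" and inj: "\<And>x. x \<in> S \<Longrightarrow> inj (B x)"
    and cont: "\<And>v. continuous_on S (\<lambda>x. B x v)" and b: "continuous_on S b"
    and sol: "\<And>x. x \<in> S \<Longrightarrow> B x (a x) = b x"
  shows "continuous_on S a"
  unfolding continuous_on_def
proof
  fix x assume x: "x \<in> S"
  obtain c where c: "0 < c" "\<And>v. c * norm v \<le> norm (B x v)"
    using linear_inj_bounded_below_pos[OF lin[OF x] inj[OF x]] by (auto simp: mult.commute)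
  define N where "N y = (\<Sum>i\<in>Basis. norm (B y i - B x i))" for y
  have N: "norm (B y v - B x v) \<le> N y * norm v" if y: "y \<in> S" for y v
  proof -
    have "v = (\<Sum>i\<in>Basis. (v \<bullet> i) *\<^sub>R i)" by (simp add: euclidean_representation)
    then have exp: "B z v = (\<Sum>i\<in>Basis. (v \<bullet> i) *\<^sub>R B z i)" if "z \<in> S" for z
      using lin[OF that] by (metis (no_types, lifting) linear_cmul linear_sum sum.cong)
    have "norm (B y v - B x v) = norm (\<Sum>i\<in>Basis. (v \<bullet> i) *\<^sub>R (B y i - B x i))"
      unfolding exp[OF y] exp[OF x] by (simp add: sum_subtractf scaleR_diff_right)
    also have "\<dots> \<le> (\<Sum>i\<in>Basis. norm v * norm (B y i - B x i))"
      by (rule sum_norm_le) (simp add: Basis_le_norm mult_right_mono)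
    finally show ?thesis by (simp add: N_def sum_distrib_left mult.commute)
  qed
  have N0: "(N \<longlongrightarrow> 0) (at x within S)"
  proof -
    have "(N \<longlongrightarrow> (\<Sum>i\<in>Basis. norm (B x i - B x i))) (at x within S)"
      unfolding N_def using cont x by (intro tendsto_intros) (auto simp: continuous_on_def)
    then show ?thesis by simp
  qed
  have b0: "((\<lambda>y. norm (b y - b x)) \<longlongrightarrow> 0) (at x within S)"
    using b x by (auto simp: continuous_on_def tendsto_norm_zero_iff LIM_zero_iff)
  have "eventually (\<lambda>y. N y < c / 2) (at x within S)"
    using N0 c(1) by (intro order_tendstoD(2)[OF N0]) simp
  moreover have "eventually (\<lambda>y. y \<in> S) (at x within S)"
    by (simp add: eventually_at_filter)
  ultimately have ev: "eventually (\<lambda>y. norm (a y - a x) \<le> (2 / c) * (N y * norm (a x) + norm (b y - b x))) (at x within S)"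
  proof eventually_elim
    case (elim y)
    interpret Bx: linear "B x" using lin x by blast
    have "norm (a y) \<le> norm (a y - a x) + norm (a x)"
      using norm_triangle_ineq[of "a y - a x" "a x"] by simp
    moreover have "0 \<le> N y" unfolding N_def by (intro sum_nonneg) auto
    ultimately have Na: "N y * norm (a y) \<le> (c / 2) * norm (a y - a x) + N y * norm (a x)"
      using elim(1) mult_left_mono[of "norm (a y)" "norm (a y - a x) + norm (a x)" "N y"]
        mult_right_mono[of "N y" "c / 2" "norm (a y - a x)"] by (simp add: algebra_simps)
    have "B x (a y - a x) = (b y - b x) - (B y (a y) - B x (a y))"
      using sol x elim(2) by (simp add: Bx.diff)
    then have "c * norm (a y - a x) \<le> norm (b y - b x) + norm (B y (a y) - B x (a y))"
      using c(2)[of "a y - a x"] norm_triangle_ineq4[of "b y - b x" "B y (a y) - B x (a y)"] by simp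
    also have "\<dots> \<le> norm (b y - b x) + ((c / 2) * norm (a y - a x) + N y * norm (a x))"
      using N[OF elim(2), of "a y"] Na by linarith
    finally have "(c / 2) * norm (a y - a x) \<le> N y * norm (a x) + norm (b y - b x)" by simp
    then show ?case using c(1) by (simp add: field_simps)
  qed
  have "((\<lambda>y. (2 / c) * (N y * norm (a x) + norm (b y - b x))) \<longlongrightarrow> (2 / c) * (0 * norm (a x) + 0)) (at x within S)"
    by (intro tendsto_intros N0 b0)
  then have lim: "((\<lambda>y. (2 / c) * (N y * norm (a x) + norm (b y - b x))) \<longlongrightarrow> 0) (at x within S)"
    by simp
  have "((\<lambda>y. a y - a x) \<longlongrightarrow> 0) (at x within S)"
    using ev lim by (rule Lim_null_comparison)
  then show "(a \<longlongrightarrow> a x) (at x within S)" by (simp add: LIM_zero_iff)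
qed

text \<open>A nonzero linear coefficient would dominate near \<open>t = 0\<close>; the trial value
  \<open>- c / m\<close> makes this explicit.\<close>

lemma linear_coefficient_zero:
  fixes c d :: real
  assumes "\<And>t. 0 \<le> t * c + t\<^sup>2 * d"
  shows "c = 0"
proof -
  define m where "m = \<bar>d\<bar> + 1"
  have m: "0 < m" "d \<le> m - 1" by (auto simp: m_def)
  have "0 \<le> (- (c / m)) * c + (- (c / m))\<^sup>2 * d" by (rule assms)
  also have "\<dots> \<le> (- (c / m)) * c + (- (c / m))\<^sup>2 * (m - 1)"
    using m by (intro add_left_mono mult_left_mono) auto
  also have "\<dots> = - (c / m)\<^sup>2" using m by (simp add: field_simps power2_eq_square)
  finally have "(c / m)\<^sup>2 \<le> 0" by simp
  then show ?thesis using m by simp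
qed

section \<open>The inverse Gauss map\<close>

lemma has_derivative_normalize:
  fixes x :: "'a::euclidean_space"
  assumes "x \<noteq> 0"
  shows "((\<lambda>y. y /\<^sub>R norm y) has_derivative
    (\<lambda>v. v /\<^sub>R norm x - ((x \<bullet> v) / norm x ^ 3) *\<^sub>R x)) (at x)"
proof -
  have "((\<lambda>y. y /\<^sub>R norm y) has_derivative
      (\<lambda>v. inverse (norm x) *\<^sub>R v + (- (inverse (norm x) * (v \<bullet> sgn x) * inverse (norm x))) *\<^sub>R x)) (at x)"
  proof (rule has_derivative_scaleR[OF _ has_derivative_ident])
    show "((\<lambda>y. inverse (norm y)) has_derivative
        (\<lambda>v. - (inverse (norm x) * (v \<bullet> sgn x) * inverse (norm x)))) (at x)"
      by (rule Deriv.has_derivative_inverse[OF _ has_derivative_norm[OF assms]]) (use assms in simp)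
  qed
  moreover have "(- (inverse (norm x) * (v \<bullet> sgn x) * inverse (norm x))) = - ((x \<bullet> v) / norm x ^ 3)" for v
    by (simp add: sgn_div_norm divide_inverse power3_eq_cube inner_commute)
  ultimately show ?thesis by simp
qed

text \<open>Extracts the gradient field \<open>G\<close> of a local equation together with its
  derivative. Symmetry of \<open>G'\<close> is the symmetry of second derivatives and later makes
  the shape operator self-adjoint.\<close>

lemma smooth_hypersurface_defining_function:
  fixes M :: "'a::euclidean_space set"
  assumes M: "smooth_hypersurface M" and x: "x \<in> M"
  obtains U f G G' where "open U" "x \<in> U" "M \<inter> U = {y \<in> U. f y = 0}" "\<And>y. y \<in> U \<Longrightarrow> G y \<noteq> 0"
    "\<And>y. y \<in> U \<Longrightarrow> (f has_derivative (\<lambda>v. G y \<bullet> v)) (at y)"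
    "\<And>y. y \<in> U \<Longrightarrow> (G has_derivative G' y) (at y)" "\<And>v. continuous_on U (\<lambda>y. G' y v)"
    "\<And>y v w. y \<in> U \<Longrightarrow> G' y v \<bullet> w = v \<bullet> G' y w"
proof -
  obtain U and f :: "'a \<Rightarrow> real" where U: "open U" "x \<in> U" "smooth_on f U"
    "\<forall>y\<in>U. frechet_derivative f (at y) \<noteq> (\<lambda>v. 0)" "M \<inter> U = {y \<in> U. f y = 0}"
    using M x unfolding smooth_hypersurface_def by blast
  define f' where "f' y = frechet_derivative f (at y)" for y
  define f'' where "f'' y v = frechet_derivative (\<lambda>y. f' y v) (at y)" for y v
  have C2: "Ck_on (Suc (Suc 0)) f U"
    using U(3) unfolding smooth_on_def by blast
  have f': "(f has_derivative f' y) (at y)" if "y \<in> U" for y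
    using C2 that unfolding f'_def by (simp add: frechet_derivative_works)
  have f'': "((\<lambda>y. f' y v) has_derivative f'' y v) (at y)" if "y \<in> U" for y v
    using C2 that unfolding f''_def f'_def by (simp add: frechet_derivative_works)
  have f''c: "continuous_on U (\<lambda>y. f'' y v w)" for v w
    using C2 unfolding f''_def f'_def by simp
  define G where "G y = (\<Sum>i\<in>Basis. f' y i *\<^sub>R i)" for y
  define G' where "G' y v = (\<Sum>i\<in>Basis. f'' y i v *\<^sub>R i)" for y v
  have G: "f' y v = G y \<bullet> v" if "y \<in> U" for y v
  proof -
    interpret bounded_linear "f' y" using f'[OF that] by (rule has_derivative_bounded_linear)
    have "f' y v = f' y (\<Sum>i\<in>Basis. (v \<bullet> i) *\<^sub>R i)" by (simp add: euclidean_representation)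
    also have "\<dots> = (\<Sum>i\<in>Basis. f' y i * (i \<bullet> v))"
      by (simp add: sum scaleR inner_commute mult.commute)
    finally show ?thesis by (simp add: G_def inner_sum_left)
  qed
  have G': "(G has_derivative G' y) (at y)" if "y \<in> U" for y
    unfolding G_def[abs_def] G'_def[abs_def]
    by (intro has_derivative_sum has_derivative_scaleR_left f'' that)
  have f''G': "f'' y v w = G' y w \<bullet> v" if y: "y \<in> U" for y v w
  proof -
    have "((\<lambda>y. G y \<bullet> v) has_derivative (\<lambda>w. G' y w \<bullet> v)) (at y)"
      using G'[OF y] by (rule has_derivative_inner_left)
    moreover have "((\<lambda>y. G y \<bullet> v) has_derivative f'' y v) (at y)"
      by (rule has_derivative_transform_within_open[OF f''[OF y] U(1) y]) (simp add: G)
    ultimately show ?thesis by (metis has_derivative_unique)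
  qed
  show thesis
  proof
    show "G y \<noteq> 0" if "y \<in> U" for y
    proof
      assume "G y = 0"
      then have "f' y = (\<lambda>v. 0)" using G[OF that] by auto
      then show False using U(4) that by (simp add: f'_def)
    qed
    show "(f has_derivative (\<lambda>v. G y \<bullet> v)) (at y)" if "y \<in> U" for y
    proof -
      have "f' y = (\<lambda>v. G y \<bullet> v)" using G[OF that] by auto
      then show ?thesis using f'[OF that] by simp
    qed
    show "continuous_on U (\<lambda>y. G' y v)" for v
      unfolding G'_def by (intro continuous_intros f''c)
    show "G' y v \<bullet> w = v \<bullet> G' y w" if y: "y \<in> U" for y v w
    proof -
      have "f'' y v w = f'' y w v"
        by (rule second_derivative_symmetric[OF U(1) y f' f''[OF y] f''[OF y]])
      then show ?thesis by (simp add: f''G'[OF y] inner_commute)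
    qed
  qed (use U G' in auto)
qed

section \<open>Outer normals of the body and the shape operator\<close>

locale smooth_convex_body =
  fixes M K :: "'a::euclidean_space set"
  assumes hyp: "smooth_strictly_convex_around_0 M K"
begin

lemma M_smooth: "smooth_hypersurface M" and K_compact: "compact K" and K_convex: "convex K"
  and M_frontier: "M = frontier K" and zero_interior: "0 \<in> interior K"
  and curvature: "\<And>x. x \<in> M \<Longrightarrow> 0 < gauss_curvature K x"
  using hyp unfolding smooth_strictly_convex_around_0_def convex_body_def by auto

lemma M_subset: "M \<subseteq> K"
  using K_compact M_frontier frontier_subset_compact by blast

text \<open>A relation instead of \<open>outer_normal\<close>, because the value of that definite
  description is known only after existence and uniqueness of the normal are shown.\<close>

definition is_normal :: "'a \<Rightarrow> 'a \<Rightarrow> bool" where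
  "is_normal x \<nu> \<longleftrightarrow> norm \<nu> = 1 \<and> (\<forall>y\<in>K. (y - x) \<bullet> \<nu> \<le> 0)"

lemma normal_exists:
  assumes x: "x \<in> M"
  shows "\<exists>\<nu>. is_normal x \<nu>"
proof -
  have "rel_interior K = interior K"
    using zero_interior by (intro rel_interior_nonempty_interior) auto
  then have "x \<notin> rel_interior K" using x M_frontier by (simp add: frontier_def)
  moreover have "x \<in> K" using x M_subset by blast
  ultimately obtain a where a: "a \<noteq> 0" "\<And>y. y \<in> K \<Longrightarrow> a \<bullet> x \<le> a \<bullet> y"
    using supporting_hyperplane_rel_boundary[OF K_convex] by metis
  have "(y - x) \<bullet> (- (a /\<^sub>R norm a)) \<le> 0" if "y \<in> K" for y
  proof -
    have "0 \<le> (a \<bullet> y - a \<bullet> x) / norm a" using a that by simp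
    then show ?thesis by (simp add: inner_diff_left inner_commute divide_inverse algebra_simps)
  qed
  then have "is_normal x (- (a /\<^sub>R norm a))"
    using a by (simp add: is_normal_def)
  then show ?thesis by blast
qed

text \<open>A ball around the origin inside \<open>K\<close> contains a positive multiple of
  \<open>\<nu>\<close>. The inequality orients the normals and makes the support function
  positive.\<close>

lemma normal_inner_pos:
  assumes "is_normal x \<nu>"
  shows "0 < \<nu> \<bullet> x"
proof -
  obtain e where e: "0 < e" "cball 0 e \<subseteq> K"
    using zero_interior mem_interior_cball by blast
  have n: "\<nu> \<bullet> \<nu> = 1" using assms by (simp add: is_normal_def norm_eq_1)
  have "e *\<^sub>R \<nu> \<in> K" using assms e by (intro subsetD[OF e(2)]) (simp add: is_normal_def)
  then have "(e *\<^sub>R \<nu> - x) \<bullet> \<nu> \<le> 0" using assms by (simp add: is_normal_def)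
  moreover have "(e *\<^sub>R \<nu> - x) \<bullet> \<nu> = e - \<nu> \<bullet> x"
    using n by (simp add: inner_diff_left inner_commute[of x])
  ultimately show ?thesis using e(1) by linarith
qed

lemma normal_tangential_le:
  assumes \<nu>: "is_normal x \<nu>" and t: "tangential M x w"
  shows "w \<bullet> \<nu> \<le> 0"
proof -
  have "w \<bullet> \<nu> \<le> 0 + e" if e: "0 < e" for e
  proof -
    obtain s y where s: "0 < s" and y: "y \<in> M" "norm (y - x - s *\<^sub>R w) \<le> e * s"
      using t e unfolding tangential_def by blast
    have "(y - x) \<bullet> \<nu> \<le> 0" using \<nu> y M_subset by (auto simp: is_normal_def)
    moreover have "- ((y - x - s *\<^sub>R w) \<bullet> \<nu>) \<le> norm (y - x - s *\<^sub>R w) * norm \<nu>"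
      using Cauchy_Schwarz_ineq2[of "y - x - s *\<^sub>R w" \<nu>] by linarith
    ultimately have "s * (w \<bullet> \<nu>) \<le> e * s"
      using y(2) \<nu> by (simp add: inner_diff_left is_normal_def)
    then show ?thesis using s by simp
  qed
  then show ?thesis by (rule field_le_epsilon)
qed

text \<open>The inequality for tangential directions, applied to \<open>w\<close> and
  \<open>- w\<close>, makes the normal orthogonal to the kernel of \<open>g\<close>, hence a
  multiple of \<open>g\<close>. Positivity of \<open>\<nu> \<bullet> x\<close> determines the
  sign.\<close>

lemma normal_eq_gradient:
  assumes \<nu>: "is_normal x \<nu>" and g: "g \<noteq> 0" and t: "\<And>w. g \<bullet> w = 0 \<Longrightarrow> tangential M x w"
  shows "\<nu> = sgn (g \<bullet> x) *\<^sub>R (g /\<^sub>R norm g)" and "g \<bullet> x \<noteq> 0"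
proof -
  have orth: "w \<bullet> \<nu> = 0" if "g \<bullet> w = 0" for w
  proof -
    have "w \<bullet> \<nu> \<le> 0" "(- w) \<bullet> \<nu> \<le> 0"
      by (rule normal_tangential_le[OF \<nu>], rule t, use that in simp)+
    then show ?thesis by simp
  qed
  define c where "c = (g \<bullet> \<nu>) / (g \<bullet> g)"
  have gg: "g \<bullet> g \<noteq> 0" using g by simp
  define w where "w = \<nu> - c *\<^sub>R g"
  have gw: "g \<bullet> w = 0" using gg by (simp add: w_def c_def inner_diff_right)
  have "w \<bullet> w = w \<bullet> \<nu> - c * (w \<bullet> g)" by (simp add: w_def inner_diff_right inner_diff_left algebra_simps)
  then have "w = 0" using orth[OF gw] gw by (simp add: inner_commute)
  then have \<nu>c: "\<nu> = c *\<^sub>R g" by (simp add: w_def)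
  have pos: "0 < c * (g \<bullet> x)" using normal_inner_pos[OF \<nu>] by (simp add: \<nu>c)
  then show "g \<bullet> x \<noteq> 0" by auto
  have "norm \<nu> = 1" using \<nu> by (simp add: is_normal_def)
  then have "\<bar>c\<bar> = inverse (norm g)" using g by (simp add: \<nu>c field_simps)
  moreover have "sgn c = sgn (g \<bullet> x)" using pos by (auto simp: zero_less_mult_iff)
  ultimately have "c = sgn (g \<bullet> x) * inverse (norm g)" by (metis mult_sgn_abs)
  then show "\<nu> = sgn (g \<bullet> x) *\<^sub>R (g /\<^sub>R norm g)" by (simp add: \<nu>c)
qed

text \<open>\<open>N\<close> extends the outer normal of \<open>M\<close> near \<open>x\<close> to a
  differentiable unit field on an open set of the ambient space, so that ordinary derivatives are
  available; \<open>c\<close> is the factor between \<open>N\<close> and the gradient of the local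
  equation.\<close>

lemma local_structure:
  assumes x: "x \<in> M"
  obtains U f N N' c where "open U" "x \<in> U" "M \<inter> U = {y \<in> U. f y = 0}"
    "\<And>y. y \<in> U \<Longrightarrow> (f has_derivative (\<lambda>v. c y * (N y \<bullet> v))) (at y)" "\<And>y. y \<in> U \<Longrightarrow> c y \<noteq> 0" "continuous_on U c"
    "\<And>y. y \<in> U \<Longrightarrow> norm (N y) = 1" "\<And>y. y \<in> U \<Longrightarrow> (N has_derivative N' y) (at y)"
    "\<And>v. continuous_on U (\<lambda>y. N' y v)" "\<And>y v. y \<in> U \<Longrightarrow> N' y v \<bullet> N y = 0"
    "\<And>y v w. y \<in> U \<Longrightarrow> v \<bullet> N y = 0 \<Longrightarrow> w \<bullet> N y = 0 \<Longrightarrow> N' y v \<bullet> w = v \<bullet> N' y w"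
    "\<And>y w. y \<in> M \<inter> U \<Longrightarrow> w \<bullet> N y = 0 \<Longrightarrow> tangential M y w"
    "\<And>y \<nu>. y \<in> M \<inter> U \<Longrightarrow> is_normal y \<nu> \<Longrightarrow> \<nu> = N y"
proof -
  obtain U f G G' where U: "open U" "x \<in> U" "M \<inter> U = {y \<in> U. f y = 0}" and G0: "\<And>y. y \<in> U \<Longrightarrow> G y \<noteq> 0"
    and fd: "\<And>y. y \<in> U \<Longrightarrow> (f has_derivative (\<lambda>v. G y \<bullet> v)) (at y)"
    and Gd: "\<And>y. y \<in> U \<Longrightarrow> (G has_derivative G' y) (at y)" and G'c: "\<And>v. continuous_on U (\<lambda>y. G' y v)"
    and sym: "\<And>y v w. y \<in> U \<Longrightarrow> G' y v \<bullet> w = v \<bullet> G' y w"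
    by (rule smooth_hypersurface_defining_function[OF M_smooth x]) (rule that, assumption+)
  have fc: "continuous_on U f"
    by (intro continuous_at_imp_continuous_on ballI has_derivative_continuous[OF fd])
  have Gc: "continuous_on U G"
    by (intro continuous_at_imp_continuous_on ballI has_derivative_continuous[OF Gd])
  have tan: "tangential M y w" if "y \<in> M \<inter> U" "G y \<bullet> w = 0" for y w
  proof (rule tangential_mono)
    show "tangential {y \<in> U. f y = 0} y w"
      using that U fd G0 by (intro tangential_level_set[OF U(1) _ fc]) auto
  qed (use U(3) in blast)
  have nor: "\<nu> = sgn (G y \<bullet> y) *\<^sub>R (G y /\<^sub>R norm (G y))" "G y \<bullet> y \<noteq> 0" if "y \<in> M \<inter> U" "is_normal y \<nu>" for y \<nu>
    using normal_eq_gradient[OF that(2) G0 tan] that(1) by blast+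
  define \<sigma> where "\<sigma> = sgn (G x \<bullet> x)"
  have Gx: "G x \<bullet> x \<noteq> 0" using nor(2) normal_exists[OF x] x U by blast
  then have \<sigma>: "\<sigma> = 1 \<or> \<sigma> = -1" by (auto simp: \<sigma>_def sgn_if)
  \<comment> \<open>The sign that orients the gradient outward is frozen at \<open>x\<close>. On
    \<open>V\<close> the product \<open>G y \<bullet> y\<close> keeps that sign, so one formula for
    \<open>N\<close> serves all of \<open>V\<close>.\<close>
  define V where "V = {y \<in> U. 0 < \<sigma> * (G y \<bullet> y)}"
  have V: "V \<subseteq> U" "x \<in> V"
    using U Gx by (auto simp: V_def \<sigma>_def sgn_if)
  have "continuous_on U (\<lambda>y. \<sigma> * (G y \<bullet> y))"
    by (intro continuous_intros Gc)
  then have "open V"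
    unfolding V_def using U(1)
    using continuous_open_preimage[of U "\<lambda>y. \<sigma> * (G y \<bullet> y)" "{0<..}"]
    by (simp add: vimage_def Int_def)
  define N where "N y = \<sigma> *\<^sub>R (G y /\<^sub>R norm (G y))" for y
  define N' where "N' y v = \<sigma> *\<^sub>R (G' y v /\<^sub>R norm (G y) - ((G y \<bullet> G' y v) / norm (G y) ^ 3) *\<^sub>R G y)" for y v
  define c where "c y = \<sigma> * norm (G y)" for y
  have \<sigma>\<sigma>: "\<sigma> * \<sigma> = 1" "\<bar>\<sigma>\<bar> = 1" using \<sigma> by auto
  have cN: "c y *\<^sub>R N y = G y" if "y \<in> V" for y
  proof -
    have "norm (G y) * inverse (norm (G y)) = 1" using G0[of y] that V by auto
    then have "c y * (\<sigma> * inverse (norm (G y))) = 1" using \<sigma>\<sigma>(1) unfolding c_def by algebra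
    then show ?thesis by (simp add: N_def)
  qed
  have perp: "v \<bullet> N y = 0 \<longleftrightarrow> G y \<bullet> v = 0" if "y \<in> V" for y v
    using G0[of y] that V \<sigma>\<sigma> by (auto simp: N_def inner_commute)
  show thesis
  proof (rule that[of V f c N N'])
    show "open V" "x \<in> V" by fact+
    show "M \<inter> V = {y \<in> V. f y = 0}" using U(3) V by auto
    show "(f has_derivative (\<lambda>v. c y * (N y \<bullet> v))) (at y)" if "y \<in> V" for y
    proof -
      have "(\<lambda>v. c y * (N y \<bullet> v)) = (\<lambda>v. G y \<bullet> v)" using cN[OF that] by (metis inner_scaleR_left)
      then show ?thesis using fd[of y] that V by auto
    qed
    show "c y \<noteq> 0" if "y \<in> V" for y using G0[of y] that V \<sigma> by (auto simp: c_def)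
    show "continuous_on V c" unfolding c_def using Gc V by (intro continuous_intros continuous_on_subset[OF Gc])
    show "norm (N y) = 1" if "y \<in> V" for y using G0[of y] that V \<sigma>\<sigma> by (auto simp: N_def abs_mult)
    show "(N has_derivative N' y) (at y)" if "y \<in> V" for y
      unfolding N_def[abs_def] N'_def[abs_def]
      using has_derivative_compose[OF Gd has_derivative_normalize[OF G0]] that V
      by (intro has_derivative_scaleR_right) auto
    show "continuous_on V (\<lambda>y. N' y v)" for v
      unfolding N'_def using G0 V
      by (intro continuous_intros continuous_on_subset[OF Gc] continuous_on_subset[OF G'c]) auto
    show "N' y v \<bullet> N y = 0" if "y \<in> V" for y v
    proof -
      have n: "norm (G y) \<noteq> 0" using G0[of y] that V by auto
      have "(G' y v /\<^sub>R norm (G y) - ((G y \<bullet> G' y v) / norm (G y) ^ 3) *\<^sub>R G y) \<bullet> G y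
        = (G y \<bullet> G' y v) / norm (G y) - ((G y \<bullet> G' y v) / norm (G y) ^ 3) * (norm (G y))\<^sup>2"
        by (simp add: inner_diff_left inner_diff_right dot_square_norm inner_commute divide_inverse)
      also have "\<dots> = 0" using n by (simp add: field_simps power2_eq_square power3_eq_cube)
      finally show ?thesis by (simp add: N_def N'_def)
    qed
    show "N' y v \<bullet> w = v \<bullet> N' y w" if "y \<in> V" "v \<bullet> N y = 0" "w \<bullet> N y = 0" for y v w
    proof -
      have "G y \<bullet> v = 0" "G y \<bullet> w = 0" using perp that by auto
      then show ?thesis
        using sym[of y v w] that(1) V by (auto simp: N'_def inner_diff_left inner_diff_right inner_commute)
    qed
    show "tangential M y w" if "y \<in> M \<inter> V" "w \<bullet> N y = 0" for y w
      using tan[of y w] perp[of y w] that V by auto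
    show "\<nu> = N y" if "y \<in> M \<inter> V" "is_normal y \<nu>" for y \<nu>
    proof -
      have "sgn (G y \<bullet> y) = \<sigma>" using that(1) \<sigma> by (auto simp: V_def sgn_if)
      then show ?thesis using nor[of y \<nu>] that V by (auto simp: N_def)
    qed
  qed
qed

lemma is_normal_unique:
  assumes x: "x \<in> M" and \<nu>: "is_normal x \<nu>" and \<nu>': "is_normal x \<nu>'"
  shows "\<nu> = \<nu>'"
proof (rule local_structure[OF x])
  fix U N assume "x \<in> U" "\<And>y \<nu>. y \<in> M \<inter> U \<Longrightarrow> is_normal y \<nu> \<Longrightarrow> \<nu> = N y"
  then show ?thesis using x \<nu> \<nu>' by (metis IntI)
qed

lemma outer_normal_eq:
  assumes "x \<in> M" "is_normal x \<nu>"
  shows "outer_normal K x = \<nu>"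
  unfolding outer_normal_def is_normal_def[symmetric]
  by (rule the_equality) (use assms is_normal_unique in auto)

lemma is_normal_outer_normal: "x \<in> M \<Longrightarrow> is_normal x (outer_normal K x)"
  using normal_exists outer_normal_eq by metis


lemma has_derivative_transform_near:
  assumes f: "(f has_derivative f') (at x)" and U: "open U" "x \<in> U" "x \<in> S"
    and eq: "\<And>y. y \<in> S \<inter> U \<Longrightarrow> f y = g y"
  shows "(g has_derivative f') (at x within S)"
proof -
  obtain e where e: "0 < e" "ball x e \<subseteq> U" using U open_contains_ball by blast
  show ?thesis
  proof (rule has_derivative_transform_within[OF has_derivative_at_withinI[OF f] e(1) U(3)])
    fix y assume "y \<in> S" "dist y x < e"
    then have "y \<in> S \<inter> U" using e(2) by (auto simp: subset_iff dist_commute)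
    then show "f y = g y" by (rule eq)
  qed
qed

lemma outer_normal_has_derivative:
  assumes U: "open U" "y \<in> M \<inter> U" and N: "(N has_derivative N') (at y)"
    and eq: "\<And>y \<nu>. y \<in> M \<inter> U \<Longrightarrow> is_normal y \<nu> \<Longrightarrow> \<nu> = N y"
  shows "(outer_normal K has_derivative N') (at y within M)"
  by (rule has_derivative_transform_near[OF N U(1)])
    (use U eq is_normal_outer_normal in \<open>auto dest: sym\<close>)

text \<open>The Gauss curvature is the product of the eigenvalues of \<open>N'\<close> on the
  tangent space. A positive product leaves no zero eigenvalue, so the kernel there is
  trivial.\<close>

lemma shape_operator_injective:
  assumes U: "open U" "y \<in> M \<inter> U" and N: "(N has_derivative N') (at y)"
    and eq: "\<And>y \<nu>. y \<in> M \<inter> U \<Longrightarrow> is_normal y \<nu> \<Longrightarrow> \<nu> = N y"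
    and sym: "\<And>v w. v \<bullet> N y = 0 \<Longrightarrow> w \<bullet> N y = 0 \<Longrightarrow> N' v \<bullet> w = v \<bullet> N' w"
    and tan: "\<And>w. w \<bullet> N y = 0 \<Longrightarrow> tangential M y w"
    and v: "v \<bullet> N y = 0" "N' v = 0"
  shows "v = 0"
proof -
  let ?T = "{v. v \<bullet> N y = 0}"
  have oN: "outer_normal K y = N y"
    using eq[OF U(2)] is_normal_outer_normal U(2) by blast
  have der: "(outer_normal K has_derivative N') (at y within M)"
    by (rule outer_normal_has_derivative[OF U N eq])
  then have "(outer_normal K has_derivative frechet_derivative (outer_normal K) (at y within M)) (at y within M)"
    using differentiableI frechet_derivative_works by blast
  \<comment> \<open>The second fundamental form differentiates within \<open>M\<close>, where the
    derivative is a matter of choice; on tangential vectors it agrees with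
    \<open>N'\<close>.\<close>
  then have fd: "frechet_derivative (outer_normal K) (at y within M) w = N' w" if "w \<bullet> N y = 0" for w
    using tangential_derivative_unique[OF _ der tan[OF that]] by blast
  have L: "linear N'" using N by (rule has_derivative_linear)
  have T: "subspace ?T" by (auto simp: subspace_def inner_simps)
  obtain es where es: "orthonormal_list es" "length es = dim ?T" "set es \<subseteq> ?T"
    "\<And>e w. e \<in> set es \<Longrightarrow> w \<in> ?T \<Longrightarrow> N' e \<bullet> w = (N' e \<bullet> e) * (e \<bullet> w)"
    "form_eigenvalues ?T (second_fundamental_form K y) = map (\<lambda>e. N' e \<bullet> e) es"
  proof (rule form_eigenvalues_eigenbasis[OF T L])
    show "N' v \<bullet> w = v \<bullet> N' w" if "v \<in> ?T" "w \<in> ?T" for v w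
      using sym that by simp
    show "second_fundamental_form K y v w = N' v \<bullet> w" if "v \<in> ?T" "w \<in> ?T" for v w
      using fd that by (simp add: second_fundamental_form_def M_frontier[symmetric])
  qed (rule that, assumption+)
  have "0 < prod_list (map (\<lambda>e. N' e \<bullet> e) es)"
    using curvature[of y] U(2) by (simp add: gauss_curvature_def oN es(5))
  then have nz: "N' e \<bullet> e \<noteq> 0" if "e \<in> set es" for e
    using that by (auto simp: prod_list_zero_iff dest!: less_imp_neq)
  have ve: "v \<bullet> e = 0" if e: "e \<in> set es" for e
  proof -
    have "(N' e \<bullet> e) * (e \<bullet> v) = N' e \<bullet> v" using es(4)[OF e] v(1) by simp
    also have "\<dots> = e \<bullet> N' v" using sym[of e v] e es(3) v(1) by auto
    finally show ?thesis using nz[OF e] v(2) by (simp add: inner_commute)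
  qed
  have ind: "independent (set es)"
    using es(1) by (intro pairwise_orthogonal_independent) (auto simp: orthonormal_list_def)
  have "span (set es) = ?T"
  proof (rule subspace_dim_equal)
    show "span (set es) \<subseteq> ?T" using es(3) T by (rule span_minimal)
    show "dim ?T \<le> dim (span (set es))"
      using dim_eq_card_independent[OF ind] distinct_card[of es] es(1,2) by (simp add: orthonormal_list_def)
  qed (use T in simp_all)
  then have "(\<Sum>e\<in>set es. (v \<bullet> e) *\<^sub>R e) = v"
    using es(1) v(1) by (intro orthonormal_basis_expand) (auto simp: orthonormal_list_def)
  then show "v = 0" using ve by simp
qed

section \<open>Bijectivity of the Gauss map\<close>

lemma normal_imp_frontier:
  assumes "p \<in> K" "is_normal p z"
  shows "p \<in> M"
proof (rule ccontr)
  assume "p \<notin> M"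
  then have "p \<in> interior K"
    using assms(1) closure_subset M_frontier by (auto simp: frontier_def)
  then obtain e where e: "0 < e" "cball p e \<subseteq> K" using mem_interior_cball by blast
  have z: "norm z = 1" using assms(2) by (simp add: is_normal_def)
  have "p + e *\<^sub>R z \<in> K" using e z by (intro subsetD[OF e(2)]) (simp add: dist_norm)
  then have "(p + e *\<^sub>R z - p) \<bullet> z \<le> 0" using assms(2) unfolding is_normal_def by blast
  moreover have "z \<bullet> z = 1" using z by (simp add: norm_eq_1)
  ultimately show False using e(1) by simp
qed

lemma normal_surj:
  assumes z: "norm z = 1"
  shows "\<exists>x\<in>M. is_normal x z"
proof -
  have "K \<noteq> {}" using zero_interior interior_subset by blast
  then obtain x where x: "x \<in> K" "\<And>y. y \<in> K \<Longrightarrow> y \<bullet> z \<le> x \<bullet> z"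
    using continuous_attains_sup[OF K_compact _ continuous_on_inner[OF continuous_on_id continuous_on_const, of K z]] by blast
  then have "is_normal x z" using z by (simp add: is_normal_def inner_diff_left)
  then show ?thesis using normal_imp_frontier x(1) by blast
qed

text \<open>Two points with the same normal \<open>z\<close> span a segment that lies in
  \<open>M\<close> and has normal \<open>z\<close> throughout. Differentiating the constant normal
  along it puts \<open>d\<close> into the kernel of the shape operator.\<close>

lemma normal_inj:
  assumes x: "x \<in> M" "is_normal x z" and x': "x' \<in> M" "is_normal x' z"
  shows "x = x'"
proof (rule local_structure[OF x(1)])
  fix U f N N' c
  assume U: "open U" "x \<in> U" and N: "\<And>y. y \<in> U \<Longrightarrow> (N has_derivative N' y) (at y)"
    and sym: "\<And>y v w. y \<in> U \<Longrightarrow> v \<bullet> N y = 0 \<Longrightarrow> w \<bullet> N y = 0 \<Longrightarrow> N' y v \<bullet> w = v \<bullet> N' y w"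
    and tan: "\<And>y w. y \<in> M \<inter> U \<Longrightarrow> w \<bullet> N y = 0 \<Longrightarrow> tangential M y w"
    and eq: "\<And>y \<nu>. y \<in> M \<inter> U \<Longrightarrow> is_normal y \<nu> \<Longrightarrow> \<nu> = N y"
  define d where "d = x' - x"
  have xK: "x \<in> K" "x' \<in> K" using x x' M_subset by auto
  have "(x' - x) \<bullet> z \<le> 0" "(x - x') \<bullet> z \<le> 0" using x(2) x'(2) xK by (auto simp: is_normal_def)
  then have dz: "d \<bullet> z = 0" by (simp add: d_def inner_diff_left)
  let ?S = "(\<lambda>t. x + t *\<^sub>R d) ` {0..1}"
  have pM: "p \<in> M" "is_normal p z" if pS: "p \<in> ?S" for p
  proof -
    obtain t where t: "p = x + t *\<^sub>R d" and "t \<in> {0..1}" using pS by (rule imageE)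
    then have t01: "0 \<le> t" "t \<le> 1" by auto
    have "x + t *\<^sub>R (x' - x) = (1 - t) *\<^sub>R x + t *\<^sub>R x'" by (simp add: algebra_simps)
    then have "p = (1 - t) *\<^sub>R x + t *\<^sub>R x'" by (simp add: t d_def)
    then have "p \<in> K" using K_convex xK t01 by (simp add: convex_alt)
    moreover show "is_normal p z"
      using x(2) dz by (simp add: is_normal_def t inner_diff_left inner_add_left)
    ultimately show "p \<in> M" using normal_imp_frontier by blast
  qed
  have xS: "x \<in> ?S" by (rule image_eqI[of _ _ 0]) auto
  have xMU: "x \<in> M \<inter> U" using x U by blast
  have zN: "z = N x" using eq[OF xMU x(2)] .
  have "((\<lambda>_. z) has_derivative N' x) (at x within ?S)"
  proof (rule has_derivative_transform_near[OF N[OF U(2)] U xS])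
    show "N p = z" if "p \<in> ?S \<inter> U" for p
      using eq[of p z] pM[of p] that by blast
  qed
  moreover have "tangential ?S x d"
    unfolding tangential_def
  proof (intro allI impI)
    fix e :: real assume e: "0 < e"
    define s where "s = min 1 (e / 2)"
    have "0 < s" "s < e" "s \<le> 1" using e by (auto simp: s_def)
    then show "\<exists>s y. 0 < s \<and> s < e \<and> y \<in> ?S \<and> norm (y - x - s *\<^sub>R d) \<le> e * s"
      using e by (intro exI[of _ s] exI[of _ "x + s *\<^sub>R d"]) auto
  qed
  ultimately have "N' x d = 0"
    using tangential_derivative_unique[OF _ has_derivative_const] by blast
  have "d = 0"
  proof (rule shape_operator_injective[OF U(1) xMU N[OF U(2)] eq])
    show "d \<bullet> N x = 0" using dz zN by simp
  qed (use sym[OF U(2)] tan[OF xMU] \<open>N' x d = 0\<close> in blast)+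
  then show ?thesis by (simp add: d_def)
qed

text \<open>The inverse Gauss map, extended to be constant along rays; it is the gradient of the
  support function. At \<open>0\<close> no point qualifies and the value is arbitrary, so facts
  about its values are stated for nonzero arguments.\<close>

definition contact :: "'a \<Rightarrow> 'a" where
  "contact x = (SOME y. y \<in> M \<and> is_normal y (x /\<^sub>R norm x))"

lemma contact:
  assumes "x \<noteq> 0"
  shows "contact x \<in> M" "is_normal (contact x) (x /\<^sub>R norm x)"
proof -
  have "\<exists>y. y \<in> M \<and> is_normal y (x /\<^sub>R norm x)"
    using normal_surj[of "x /\<^sub>R norm x"] assms by auto
  then have "contact x \<in> M \<and> is_normal (contact x) (x /\<^sub>R norm x)"
    unfolding contact_def by (rule someI_ex)
  then show "contact x \<in> M" "is_normal (contact x) (x /\<^sub>R norm x)" by auto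
qed

lemma contact_scale: "0 < c \<Longrightarrow> contact (c *\<^sub>R x) = contact x"
proof -
  assume "0 < c"
  then have "(c *\<^sub>R x) /\<^sub>R norm (c *\<^sub>R x) = x /\<^sub>R norm x"
    by (metis scaleR_one sgn_div_norm sgn_pos sgn_scaleR)
  then show ?thesis by (simp only: contact_def)
qed

lemma contact_outer_normal:
  assumes "y \<in> M"
  shows "contact (outer_normal K y) = y"
proof (rule normal_inj)
  have "is_normal y (outer_normal K y)" using assms by (rule is_normal_outer_normal)
  then have "norm (outer_normal K y) = 1" by (simp add: is_normal_def)
  moreover have "outer_normal K y \<noteq> 0" using \<open>norm (outer_normal K y) = 1\<close> by (metis norm_zero zero_neq_one)
  ultimately show "contact (outer_normal K y) \<in> M" "is_normal (contact (outer_normal K y)) (outer_normal K y)"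
    using contact[of "outer_normal K y"] by simp_all
  show "is_normal y (outer_normal K y)" by fact
qed fact

lemma outer_normal_contact: "x \<noteq> 0 \<Longrightarrow> outer_normal K (contact x) = x /\<^sub>R norm x"
  by (intro outer_normal_eq contact)

lemma contact_image: "contact ` sphere 0 1 = M"
proof
  show "contact ` sphere 0 1 \<subseteq> M"
  proof safe
    fix x :: 'a assume "x \<in> sphere 0 1"
    then have "x \<noteq> 0" by auto
    then show "contact x \<in> M" by (rule contact)
  qed
  show "M \<subseteq> contact ` sphere 0 1"
  proof
    fix y assume y: "y \<in> M"
    then have "outer_normal K y \<in> sphere 0 1" using is_normal_outer_normal by (simp add: is_normal_def)
    then show "y \<in> contact ` sphere 0 1" using contact_outer_normal[OF y] by (metis imageI)
  qed
qed

lemma inj_on_contact: "inj_on contact (sphere 0 1)"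
proof (rule inj_onI)
  fix x y :: 'a assume xy: "x \<in> sphere 0 1" "y \<in> sphere 0 1" "contact x = contact y"
  then have "x \<noteq> 0" "y \<noteq> 0" by auto
  then have "x = outer_normal K (contact x)" "y = outer_normal K (contact y)"
    using xy(1,2) by (simp_all add: outer_normal_contact)
  then show "x = y" using xy(3) by metis
qed

lemma inner_le_contact:
  assumes "x \<noteq> 0" "y \<in> K"
  shows "y \<bullet> x \<le> contact x \<bullet> x"
proof -
  have "(y - contact x) \<bullet> (x /\<^sub>R norm x) \<le> 0"
    using contact(2)[OF assms(1)] assms(2) by (simp add: is_normal_def)
  then have "((y - contact x) \<bullet> x) / norm x \<le> 0" by (simp add: divide_inverse mult.commute)
  then have "(y - contact x) \<bullet> x \<le> 0" using assms(1) by (simp add: divide_le_0_iff)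
  then show ?thesis by (simp add: inner_diff_left)
qed

lemma support_function_eq:
  assumes "x \<noteq> 0"
  shows "support_function K x = contact x \<bullet> x"
  unfolding support_function_def
proof (rule cSup_eq_maximum)
  show "contact x \<bullet> x \<in> (\<lambda>y. y \<bullet> x) ` K" using contact(1)[OF assms] M_subset by blast
  show "\<And>y. y \<in> (\<lambda>y. y \<bullet> x) ` K \<Longrightarrow> y \<le> contact x \<bullet> x" using inner_le_contact[OF assms] by auto
qed

lemma support_function_pos:
  assumes "x \<noteq> 0"
  shows "0 < contact x \<bullet> x"
proof -
  have "0 < (x /\<^sub>R norm x) \<bullet> contact x" using contact(2)[OF assms] by (rule normal_inner_pos)
  then show ?thesis using assms by (simp add: inner_commute zero_less_mult_iff)
qed

section \<open>Regularity of the inverse Gauss map\<close>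

lemma continuous_outer_normal: "continuous_on M (outer_normal K)"
  unfolding continuous_on_eq_continuous_within
proof
  fix x assume x: "x \<in> M"
  show "continuous (at x within M) (outer_normal K)"
  proof (rule local_structure[OF x])
    fix U N N' assume "open U" "x \<in> U" and "\<And>y. y \<in> U \<Longrightarrow> (N has_derivative N' y) (at y)"
      and "\<And>y \<nu>. y \<in> M \<inter> U \<Longrightarrow> is_normal y \<nu> \<Longrightarrow> \<nu> = N y"
    then have "(outer_normal K has_derivative N' x) (at x within M)"
      using x by (intro outer_normal_has_derivative[of U]) auto
    then show ?thesis by (rule has_derivative_continuous)
  qed
qed

text \<open>On the unit sphere this is the inverse of a continuous injection of the compact set
  \<open>M\<close>; constancy along rays does the rest.\<close>

lemma continuous_contact: "continuous_on (- {0}) contact"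
proof -
  have "compact M" unfolding M_frontier using K_compact by (rule compact_frontier)
  then have "continuous_on (outer_normal K ` M) contact"
    by (rule continuous_on_inv[OF continuous_outer_normal]) (simp add: contact_outer_normal)
  moreover have "outer_normal K ` M = sphere 0 1"
  proof -
    have "x \<in> outer_normal K ` M" if "x \<in> sphere 0 1" for x
    proof -
      have "x \<noteq> 0" using that by auto
      then have "x = outer_normal K (contact x)" using that by (simp add: outer_normal_contact)
      then show ?thesis using contact(1)[OF \<open>x \<noteq> 0\<close>] by (rule image_eqI)
    qed
    moreover have "outer_normal K y \<in> sphere 0 1" if "y \<in> M" for y
      using is_normal_outer_normal[OF that] by (simp add: is_normal_def)
    ultimately show ?thesis by blast
  qed
  ultimately have c: "continuous_on (sphere 0 1) contact" by (simp only:)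
  have "continuous_on (- {0}) (\<lambda>x. contact (x /\<^sub>R norm x))"
  proof (rule continuous_on_compose2[OF c])
    show "(\<lambda>x. x /\<^sub>R norm x) ` (- {0}) \<subseteq> sphere 0 1"
      by (rule image_subsetI) simp
    show "continuous_on (- {0 :: 'a}) (\<lambda>x. x /\<^sub>R norm x)" by (intro continuous_intros) auto
  qed
  then show ?thesis
  proof (rule continuous_on_eq)
    show "contact (x /\<^sub>R norm x) = contact x" if "x \<in> - {0}" for x
      by (rule contact_scale) (use that in simp)
  qed
qed

text \<open>Maximality of the contact points at \<open>x\<close> and at \<open>y\<close> traps the
  remainder between \<open>0\<close> and \<open>(contact y - contact x) \<bullet> (y - x)\<close>,
  so continuity of \<open>contact\<close> yields differentiability.\<close>

lemma support_function_has_derivative: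
  assumes x: "x \<noteq> 0"
  shows "(support_function K has_derivative (\<lambda>v. contact x \<bullet> v)) (at x)"
  unfolding has_derivative_at_alt
proof (intro conjI allI impI)
  show "bounded_linear (\<lambda>v. contact x \<bullet> v)" by (rule bounded_linear_inner_right)
  fix e :: real assume e: "0 < e"
  have "isCont contact x"
    using continuous_contact x by (simp add: continuous_on_eq_continuous_at open_Compl)
  then obtain d where d: "0 < d" "\<And>y. norm (y - x) < d \<Longrightarrow> norm (contact y - contact x) < e"
    using e unfolding continuous_at_eps_delta dist_norm by blast
  show "\<exists>d>0. \<forall>y. norm (y - x) < d \<longrightarrow>
    norm (support_function K y - support_function K x - contact x \<bullet> (y - x)) \<le> e * norm (y - x)"
  proof (intro exI[of _ "min d (norm x)"] conjI allI impI)
    show "0 < min d (norm x)" using d x by simp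
    fix y assume y: "norm (y - x) < min d (norm x)"
    then have y0: "y \<noteq> 0" by auto
    have eq: "support_function K y - support_function K x - contact x \<bullet> (y - x) = contact y \<bullet> y - contact x \<bullet> y"
      using x y0 by (simp add: support_function_eq inner_diff_right)
    have "contact x \<bullet> y \<le> contact y \<bullet> y" "contact y \<bullet> x \<le> contact x \<bullet> x"
      using x y0 contact(1) M_subset by (auto intro!: inner_le_contact)
    then have "0 \<le> contact y \<bullet> y - contact x \<bullet> y"
      "contact y \<bullet> y - contact x \<bullet> y \<le> (contact y - contact x) \<bullet> (y - x)"
      by (auto simp: inner_diff_left inner_diff_right)
    moreover have "(contact y - contact x) \<bullet> (y - x) \<le> norm (contact y - contact x) * norm (y - x)"
      by (rule norm_cauchy_schwarz)
    moreover have "\<dots> \<le> e * norm (y - x)"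
      using d(2)[of y] y by (intro mult_right_mono) auto
    ultimately show "norm (support_function K y - support_function K x - contact x \<bullet> (y - x)) \<le> e * norm (y - x)"
      unfolding eq by simp
  qed
qed

text \<open>On \<open>M\<close> the map taking \<open>q\<close> to \<open>(1 + f q) N q\<close> is
  the Gauss map, since \<open>f\<close> vanishes there. Off \<open>M\<close> the factor varies in
  the normal direction and complements the injective shape operator, so the derivative
  \<open>L\<close> is injective on the whole space. Composed with \<open>contact\<close> the map is
  \<open>y / |y|\<close>, and this identity is solved for the derivative of
  \<open>contact\<close>.\<close>

lemma contact_local_derivative:
  assumes x: "x \<noteq> 0"
  obtains W L where "open W" "x \<in> W" "0 \<notin> W" "\<And>y. y \<in> W \<Longrightarrow> linear (L y)" "\<And>y. y \<in> W \<Longrightarrow> inj (L y)"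
    "\<And>v. continuous_on W (\<lambda>y. L y v)"
    "\<And>y. y \<in> W \<Longrightarrow> \<exists>A. (contact has_derivative A) (at y) \<and>
      (\<forall>v. L y (A v) = v /\<^sub>R norm y - ((y \<bullet> v) / norm y ^ 3) *\<^sub>R y)"
proof (rule local_structure[OF contact(1)[OF x]])
  fix U f N N' c
  assume U: "open U" "contact x \<in> U" and MU: "M \<inter> U = {y \<in> U. f y = 0}"
    and fd: "\<And>y. y \<in> U \<Longrightarrow> (f has_derivative (\<lambda>v. c y * (N y \<bullet> v))) (at y)"
    and c0: "\<And>y. y \<in> U \<Longrightarrow> c y \<noteq> 0" and cc: "continuous_on U c"
    and N1: "\<And>y. y \<in> U \<Longrightarrow> norm (N y) = 1" and Nd: "\<And>y. y \<in> U \<Longrightarrow> (N has_derivative N' y) (at y)"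
    and N'c: "\<And>v. continuous_on U (\<lambda>y. N' y v)" and N'N: "\<And>y v. y \<in> U \<Longrightarrow> N' y v \<bullet> N y = 0"
    and sym: "\<And>y v w. y \<in> U \<Longrightarrow> v \<bullet> N y = 0 \<Longrightarrow> w \<bullet> N y = 0 \<Longrightarrow> N' y v \<bullet> w = v \<bullet> N' y w"
    and tan: "\<And>y w. y \<in> M \<inter> U \<Longrightarrow> w \<bullet> N y = 0 \<Longrightarrow> tangential M y w"
    and eq: "\<And>y \<nu>. y \<in> M \<inter> U \<Longrightarrow> is_normal y \<nu> \<Longrightarrow> \<nu> = N y"
  define W where "W = - {0} \<inter> contact -` U"
  define L where "L y v = (c (contact y) * (N (contact y) \<bullet> v)) *\<^sub>R N (contact y) + N' (contact y) v" for y v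
  have W: "open W" "x \<in> W" "0 \<notin> W"
    using continuous_open_preimage[OF continuous_contact _ U(1)] U(2) x by (auto simp: W_def open_Compl)
  have WU: "contact y \<in> M \<inter> U" if "y \<in> W" for y
    using that contact(1) by (auto simp: W_def)
  have Nc: "continuous_on U N"
    by (intro continuous_at_imp_continuous_on ballI has_derivative_continuous[OF Nd])
  have contW: "continuous_on W (\<lambda>y. g (contact y))" if "continuous_on U g" for g :: "'a \<Rightarrow> 'b::topological_space"
  proof (rule continuous_on_compose2[OF that])
    show "continuous_on W contact" by (rule continuous_on_subset[OF continuous_contact]) (use W(3) in auto)
    show "contact ` W \<subseteq> U" by (auto simp: W_def)
  qed
  have lin: "linear (L y)" if y: "y \<in> W" for y
  proof -
    interpret linear "N' (contact y)" using Nd WU[OF y] by (blast intro: has_derivative_linear)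
    show ?thesis by (rule linearI) (simp_all add: L_def add scale inner_simps algebra_simps)
  qed
  have inj: "inj (L y)" if y: "y \<in> W" for y
    unfolding linear_injective_0[OF lin[OF y]]
  proof (intro allI impI)
    fix v assume v: "L y v = 0"
    let ?p = "contact y"
    have p: "?p \<in> M \<inter> U" "?p \<in> U" using WU[OF y] by auto
    have "N ?p \<bullet> N ?p = 1" using N1[OF p(2)] by (simp add: norm_eq_1)
    then have "L y v \<bullet> N ?p = c ?p * (N ?p \<bullet> v)"
      using N'N[OF p(2)] by (simp add: L_def inner_add_left)
    then have Nv: "N ?p \<bullet> v = 0" using v c0[OF p(2)] by simp
    then have "N' ?p v = 0" using v by (simp add: L_def)
    show "v = 0"
    proof (rule shape_operator_injective[OF U(1) p(1) Nd[OF p(2)] eq])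
      show "v \<bullet> N ?p = 0" using Nv by (simp add: inner_commute)
    qed (use sym[OF p(2)] tan[OF p(1)] \<open>N' ?p v = 0\<close> in blast)+
  qed
  have der: "\<exists>A. (contact has_derivative A) (at y) \<and>
      (\<forall>v. L y (A v) = v /\<^sub>R norm y - ((y \<bullet> v) / norm y ^ 3) *\<^sub>R y)" if y: "y \<in> W" for y
  proof -
    let ?P = "\<lambda>v. v /\<^sub>R norm y - ((y \<bullet> v) / norm y ^ 3) *\<^sub>R y"
    have y0: "y \<noteq> 0" using y W(3) by auto
    have p: "contact y \<in> U" "f (contact y) = 0" using WU[OF y] MU by auto
    obtain g where g: "linear g" "L y \<circ> g = id"
      using linear_surjective_right_inverse[OF lin[OF y]] linear_injective_imp_surjective[OF lin[OF y] inj[OF y]]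
      by blast
    have Lg: "L y (g w) = w" for w using g(2) by (metis comp_apply id_apply)
    have \<Theta>: "((\<lambda>q. (1 + f q) *\<^sub>R N q) has_derivative L y) (at (contact y))"
    proof -
      have "((\<lambda>q. 1 + f q) has_derivative (\<lambda>v. c (contact y) * (N (contact y) \<bullet> v))) (at (contact y))"
        using has_derivative_add[OF has_derivative_const fd[OF p(1)]] by simp
      then have "((\<lambda>q. (1 + f q) *\<^sub>R N q) has_derivative
          (\<lambda>v. (1 + f (contact y)) *\<^sub>R N' (contact y) v + (c (contact y) * (N (contact y) \<bullet> v)) *\<^sub>R N (contact y))) (at (contact y))"
        by (rule has_derivative_scaleR[OF _ Nd[OF p(1)]])
      then show ?thesis using p(2) by (simp add: L_def[abs_def] add.commute)
    qed
    have P: "((\<lambda>y. y /\<^sub>R norm y) has_derivative ?P) (at y)"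
      using y0 by (rule has_derivative_normalize)
    have "(contact has_derivative (\<lambda>v. g (?P v))) (at y)"
    proof (rule has_derivative_implicit[where X = contact, OF \<Theta> inj[OF y]])
      show "isCont contact y"
        using continuous_contact y0 by (simp add: continuous_on_eq_continuous_at open_Compl)
      show "((\<lambda>z. (1 + f (contact z)) *\<^sub>R N (contact z)) has_derivative ?P) (at y)"
      proof (rule has_derivative_transform_within_open[OF P W(1) y])
        fix z assume z: "z \<in> W"
        then have "z /\<^sub>R norm z = N (contact z)"
          using eq[OF WU[OF z]] contact(2)[of z] W(3) by blast
        moreover have "f (contact z) = 0" using WU[OF z] MU by auto
        ultimately show "z /\<^sub>R norm z = (1 + f (contact z)) *\<^sub>R N (contact z)" by simp
      qed
      show "bounded_linear (\<lambda>v. g (?P v))"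
        using bounded_linear_compose[OF linear_conv_bounded_linear[THEN iffD1, OF g(1)] has_derivative_bounded_linear[OF P]] .
      show "\<And>v. L y (g (?P v)) = ?P v" by (rule Lg)
    qed
    then show ?thesis using Lg by blast
  qed
  show thesis
  proof (rule that[OF W lin inj _ der])
    show "continuous_on W (\<lambda>y. L y v)" for v
      unfolding L_def by (intro continuous_intros contW[OF N'c] contW[OF cc] contW[OF Nc])
  qed
qed

definition contact_deriv :: "'a \<Rightarrow> 'a \<Rightarrow> 'a" where
  "contact_deriv x = frechet_derivative contact (at x)"

lemma contact_has_derivative:
  assumes "x \<noteq> 0"
  shows "(contact has_derivative contact_deriv x) (at x)"
proof (rule contact_local_derivative[OF assms])
  fix W L assume "x \<in> W" "\<And>y. y \<in> W \<Longrightarrow> \<exists>A. (contact has_derivative A) (at y) \<and>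
      (\<forall>v. L y (A v) = v /\<^sub>R norm y - ((y \<bullet> v) / norm y ^ 3) *\<^sub>R y)"
  then show ?thesis
    unfolding contact_deriv_def by (metis differentiableI frechet_derivative_works)
qed

text \<open>An injective map takes \<open>contact_deriv x\<close> to the derivative of the
  normalization, so both have the same kernel, the radial line.\<close>

lemma contact_deriv_eq_0_iff:
  assumes x: "x \<noteq> 0"
  shows "contact_deriv x v = 0 \<longleftrightarrow> v /\<^sub>R norm x - ((x \<bullet> v) / norm x ^ 3) *\<^sub>R x = 0"
proof (rule contact_local_derivative[OF x])
  fix W L assume W: "x \<in> W" and lin: "\<And>y. y \<in> W \<Longrightarrow> linear (L y)" and inj: "\<And>y. y \<in> W \<Longrightarrow> inj (L y)"
    and der: "\<And>y. y \<in> W \<Longrightarrow> \<exists>A. (contact has_derivative A) (at y) \<and>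
      (\<forall>v. L y (A v) = v /\<^sub>R norm y - ((y \<bullet> v) / norm y ^ 3) *\<^sub>R y)"
  obtain A where A: "(contact has_derivative A) (at x)" "\<And>v. L x (A v) = v /\<^sub>R norm x - ((x \<bullet> v) / norm x ^ 3) *\<^sub>R x"
    using der[OF W] by blast
  have "A = contact_deriv x"
    using A(1) contact_has_derivative[OF x] by (rule has_derivative_unique)
  then have L: "L x (contact_deriv x v) = v /\<^sub>R norm x - ((x \<bullet> v) / norm x ^ 3) *\<^sub>R x" using A(2) by simp
  have "L x (contact_deriv x v) = 0 \<longleftrightarrow> contact_deriv x v = 0"
    using linear_injective_0[OF lin[OF W]] inj[OF W] linear_0[OF lin[OF W]] by metis
  then show ?thesis unfolding L by blast
qed

lemma continuous_contact_deriv: "continuous_on (- {0}) (\<lambda>x. contact_deriv x v)"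
  unfolding continuous_on_eq_continuous_at[OF open_Compl[OF closed_singleton]]
proof
  fix x :: 'a assume "x \<in> - {0}"
  then have x: "x \<noteq> 0" by simp
  show "isCont (\<lambda>x. contact_deriv x v) x"
  proof (rule contact_local_derivative[OF x])
    fix W L assume W: "open W" "x \<in> W" "0 \<notin> W" and lin: "\<And>y. y \<in> W \<Longrightarrow> linear (L y)" and inj: "\<And>y. y \<in> W \<Longrightarrow> inj (L y)"
      and Lc: "\<And>v. continuous_on W (\<lambda>y. L y v)"
      and der: "\<And>y. y \<in> W \<Longrightarrow> \<exists>A. (contact has_derivative A) (at y) \<and>
        (\<forall>v. L y (A v) = v /\<^sub>R norm y - ((y \<bullet> v) / norm y ^ 3) *\<^sub>R y)"
    have "continuous_on W (\<lambda>x. contact_deriv x v)"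
    proof (rule continuous_on_linear_solution[OF lin inj Lc])
      show "continuous_on W (\<lambda>y. v /\<^sub>R norm y - ((y \<bullet> v) / norm y ^ 3) *\<^sub>R y)"
        using W(3) by (intro continuous_intros) auto
      fix y assume y: "y \<in> W"
      then have y0: "y \<noteq> 0" using W(3) by auto
      obtain A where A: "(contact has_derivative A) (at y)" "\<And>v. L y (A v) = v /\<^sub>R norm y - ((y \<bullet> v) / norm y ^ 3) *\<^sub>R y"
        using der[OF y] by blast
      have "A = contact_deriv y"
        using A(1) contact_has_derivative[OF y0] by (rule has_derivative_unique)
      then show "L y (contact_deriv y v) = v /\<^sub>R norm y - ((y \<bullet> v) / norm y ^ 3) *\<^sub>R y" using A(2) by simp
    qed
    then show ?thesis using W by (simp add: continuous_on_eq_continuous_at)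
  qed
qed

section \<open>The Hessian of the support function\<close>

lemma contact_deriv_symmetric:
  assumes x: "x \<noteq> 0"
  shows "contact_deriv x v \<bullet> w = v \<bullet> contact_deriv x w"
proof -
  have "((\<lambda>y. contact y \<bullet> v) has_derivative (\<lambda>w. contact_deriv x w \<bullet> v)) (at x)" for v
    by (rule has_derivative_inner_left[OF contact_has_derivative[OF x]])
  then have "contact_deriv x w \<bullet> v = contact_deriv x v \<bullet> w"
    using x support_function_has_derivative
    by (intro second_derivative_symmetric[of "- {0}" x "support_function K" "\<lambda>y v. contact y \<bullet> v" v _ w]) (auto simp: open_Compl)
  then show ?thesis by (simp add: inner_commute)
qed

text \<open>\<open>contact\<close> is the gradient of a convex function and hence monotone: the
  support inequalities at \<open>x\<close> and \<open>x + t v\<close> add up to this.\<close>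

lemma contact_deriv_nonneg:
  assumes x: "x \<noteq> 0"
  shows "0 \<le> contact_deriv x v \<bullet> v"
proof (rule ccontr)
  assume neg: "\<not> ?thesis"
  have "((\<lambda>t. x + t *\<^sub>R v) has_derivative (\<lambda>h. h *\<^sub>R v)) (at (0 :: real))"
    by (auto intro!: derivative_eq_intros)
  moreover have "(contact has_derivative contact_deriv x) (at (x + 0 *\<^sub>R v))"
    using contact_has_derivative[OF x] by simp
  ultimately have "((\<lambda>t. contact (x + t *\<^sub>R v)) has_derivative (\<lambda>h. contact_deriv x (h *\<^sub>R v))) (at 0)"
    by (rule has_derivative_compose)
  then have "((\<lambda>t. contact (x + t *\<^sub>R v) \<bullet> v) has_derivative (\<lambda>h. contact_deriv x (h *\<^sub>R v) \<bullet> v)) (at 0)"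
    by (rule has_derivative_inner_left)
  moreover have "(\<lambda>h. contact_deriv x (h *\<^sub>R v) \<bullet> v) = (*) (contact_deriv x v \<bullet> v)"
    using has_derivative_linear[OF contact_has_derivative[OF x]] by (auto simp: linear_cmul mult.commute)
  ultimately have "DERIV (\<lambda>t. contact (x + t *\<^sub>R v) \<bullet> v) 0 :> contact_deriv x v \<bullet> v"
    by (simp add: has_field_derivative_def)
  then obtain d where d: "0 < d" "\<And>t. 0 < t \<Longrightarrow> t < d \<Longrightarrow> contact (x + (0 + t) *\<^sub>R v) \<bullet> v < contact (x + 0 *\<^sub>R v) \<bullet> v"
    using DERIV_neg_dec_right[of "\<lambda>t. contact (x + t *\<^sub>R v) \<bullet> v" "contact_deriv x v \<bullet> v" 0] neg by auto
  \<comment> \<open>\<open>t\<close> is small enough that \<open>x + t v\<close> stays away from the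
    origin, where \<open>contact\<close> carries no information.\<close>
  define t where "t = min (d / 2) (norm x / (2 * (norm v + 1)))"
  have v1: "0 < norm v + 1" by (simp add: add_nonneg_pos)
  have "t \<le> d / 2" unfolding t_def by (rule min.cobounded1)
  moreover have "0 < t" using d(1) x v1 by (simp add: t_def)
  ultimately have t: "0 < t" "t < d" using d(1) by simp_all
  have "t * (norm v + 1) \<le> norm x / 2"
  proof -
    have "t \<le> norm x / (2 * (norm v + 1))" by (simp add: t_def)
    then show ?thesis using v1 by (simp add: pos_le_divide_eq mult_ac)
  qed
  moreover have "t * norm v \<le> t * (norm v + 1)" using t by simp
  moreover have "norm (t *\<^sub>R v) = t * norm v" "0 < norm x" using t x by simp_all
  ultimately have "norm (t *\<^sub>R v) < norm x" by linarith
  then have y0: "x + t *\<^sub>R v \<noteq> 0" by (metis add_eq_0_iff less_irrefl norm_minus_cancel)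
  have "contact (x + t *\<^sub>R v) \<bullet> x \<le> contact x \<bullet> x" "contact x \<bullet> (x + t *\<^sub>R v) \<le> contact (x + t *\<^sub>R v) \<bullet> (x + t *\<^sub>R v)"
    using x y0 contact(1) M_subset by (auto intro!: inner_le_contact)
  then have "t * (contact x \<bullet> v) \<le> t * (contact (x + t *\<^sub>R v) \<bullet> v)" by (simp add: inner_simps)
  then show False using d(2)[OF t] t by simp
qed

text \<open>A nonnegative symmetric form that vanishes at \<open>v\<close> has \<open>v\<close> in
  its kernel, and the kernel is the radial line.\<close>

lemma contact_deriv_pos:
  assumes x: "x \<noteq> 0" and v: "v \<noteq> 0" "x \<bullet> v = 0"
  shows "0 < contact_deriv x v \<bullet> v"
proof -
  interpret A: linear "contact_deriv x" using contact_has_derivative[OF x] by (rule has_derivative_linear)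
  have "contact_deriv x v \<bullet> v \<noteq> 0"
  proof
    assume z: "contact_deriv x v \<bullet> v = 0"
    have "2 * (contact_deriv x v \<bullet> w) = 0" for w
    proof (rule linear_coefficient_zero)
      fix t
      have "0 \<le> contact_deriv x (v + t *\<^sub>R w) \<bullet> (v + t *\<^sub>R w)" by (rule contact_deriv_nonneg[OF x])
      also have "\<dots> = t * (2 * (contact_deriv x v \<bullet> w)) + t\<^sup>2 * (contact_deriv x w \<bullet> w)"
        using z contact_deriv_symmetric[OF x, of w v]
        by (simp add: A.add A.scale inner_simps inner_commute power2_eq_square algebra_simps)
      finally show "0 \<le> t * (2 * (contact_deriv x v \<bullet> w)) + t\<^sup>2 * (contact_deriv x w \<bullet> w)" .
    qed
    then have "contact_deriv x v \<bullet> contact_deriv x v = 0" by simp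
    then have "contact_deriv x v = 0" by simp
    then show False using contact_deriv_eq_0_iff[OF x, of v] v x by simp
  qed
  then show ?thesis using contact_deriv_nonneg[OF x, of v] by simp
qed

lemma contact_deriv_self: "x \<noteq> 0 \<Longrightarrow> contact_deriv x x = 0"
proof -
  assume "x \<noteq> 0"
  then have "(x \<bullet> x) / norm x ^ 3 = inverse (norm x)"
    by (simp add: dot_square_norm power2_eq_square power3_eq_cube field_simps)
  then show ?thesis using \<open>x \<noteq> 0\<close> by (simp add: contact_deriv_eq_0_iff)
qed

end

section \<open>Gradient and Hessian of a support function\<close>

text \<open>The integral identities rest on these properties: \<open>h\<close> is a support
  function, \<open>X\<close> its gradient of degree zero, and \<open>A\<close> its Hessian, which
  annihilates the radial direction and is positive across it. \<open>X_le\<close> encodes convexity;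
  \<open>X_inj\<close> says that a boundary point has only one unit normal. No condition is put on
  values at the origin.\<close>

locale support_gradient =
  fixes h :: "real^'d::finite \<Rightarrow> real" and X :: "real^'d \<Rightarrow> real^'d" and A :: "real^'d \<Rightarrow> real^'d \<Rightarrow> real^'d"
    and n :: nat
  assumes dim: "CARD('d) = n + 1" and n_pos: "1 \<le> n"
    and h_deriv: "x \<noteq> 0 \<Longrightarrow> (h has_derivative (\<lambda>v. X x \<bullet> v)) (at x)"
    and X_deriv: "x \<noteq> 0 \<Longrightarrow> (X has_derivative A x) (at x)"
    and A_cont: "continuous_on (- {0}) (\<lambda>x. A x v)"
    and A_sym: "x \<noteq> 0 \<Longrightarrow> A x v \<bullet> w = v \<bullet> A x w"
    and A_self: "x \<noteq> 0 \<Longrightarrow> A x x = 0"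
    and A_pos: "x \<noteq> 0 \<Longrightarrow> v \<noteq> 0 \<Longrightarrow> x \<bullet> v = 0 \<Longrightarrow> 0 < A x v \<bullet> v"
    and X_scale: "0 < c \<Longrightarrow> X (c *\<^sub>R x) = X x"
    and h_eq: "x \<noteq> 0 \<Longrightarrow> h x = X x \<bullet> x"
    and h_pos: "x \<noteq> 0 \<Longrightarrow> 0 < h x"
    and X_le: "x \<noteq> 0 \<Longrightarrow> y \<noteq> 0 \<Longrightarrow> X y \<bullet> x \<le> h x"
    and X_inj: "inj_on X (sphere 0 1)"
begin

lemma A_linear: "x \<noteq> 0 \<Longrightarrow> linear (A x)"
  by (rule has_derivative_linear[OF X_deriv])

lemma h_scale:
  assumes "0 < c" "x \<noteq> 0"
  shows "h (c *\<^sub>R x) = c * h x"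
  using assms by (simp add: h_eq X_scale)

lemma A_scale:
  assumes c: "0 < c" and x: "x \<noteq> 0"
  shows "A (c *\<^sub>R x) v = A x v /\<^sub>R c"
proof -
  have cx: "c *\<^sub>R x \<noteq> 0" using c x by simp
  have "((\<lambda>y. c *\<^sub>R y) has_derivative (\<lambda>v. c *\<^sub>R v)) (at x)" by (auto intro!: derivative_eq_intros)
  then have "((\<lambda>y. X (c *\<^sub>R y)) has_derivative (\<lambda>v. A (c *\<^sub>R x) (c *\<^sub>R v))) (at x)"
    by (rule has_derivative_compose) (rule X_deriv[OF cx])
  then have "(X has_derivative (\<lambda>v. A (c *\<^sub>R x) (c *\<^sub>R v))) (at x)"
    using c by (simp add: X_scale)
  then have "(\<lambda>v. A (c *\<^sub>R x) (c *\<^sub>R v)) = A x"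
    using X_deriv[OF x] by (rule has_derivative_unique)
  then have "A x v = A (c *\<^sub>R x) (c *\<^sub>R v)" by metis
  also have "\<dots> = c *\<^sub>R A (c *\<^sub>R x) v" by (rule linear_cmul[OF A_linear[OF cx]])
  finally show ?thesis using c by simp
qed

lemma X_cont: "continuous_on (- {0}) X"
  by (intro continuous_at_imp_continuous_on ballI has_derivative_continuous[OF X_deriv]) auto

lemma h_cont: "continuous_on (- {0}) h"
  by (intro continuous_at_imp_continuous_on ballI has_derivative_continuous[OF h_deriv]) auto

text \<open>The nonnegative function \<open>h x - X w \<bullet> x\<close> has a minimum at
  \<open>z\<close>, so its gradient \<open>X z - X w\<close> vanishes there: equality in the support
  inequality identifies the contact point.\<close>

lemma X_eqI:
  assumes z: "z \<noteq> 0" and w: "w \<noteq> 0" and eq: "X w \<bullet> z = h z"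
  shows "X w = X z"
proof -
  have "((\<lambda>x. h x - X w \<bullet> x) has_derivative (\<lambda>v. X z \<bullet> v - X w \<bullet> v)) (at z)"
    by (intro has_derivative_diff h_deriv[OF z] bounded_linear.has_derivative[OF bounded_linear_inner_right] has_derivative_ident)
  then have "(\<lambda>v. X z \<bullet> v - X w \<bullet> v) = (\<lambda>v. 0)"
    by (rule differential_zero_maxmin[of z "- {0}", rotated 2])
      (use z w X_le eq in \<open>auto simp: open_Compl\<close>)
  then have "X z \<bullet> (X z - X w) - X w \<bullet> (X z - X w) = 0" by metis
  then have "(X z - X w) \<bullet> (X z - X w) = 0" by (simp add: inner_diff_left)
  then show ?thesis by simp
qed

text \<open>The factor \<open>norm x\<close> makes the eigenvalues homogeneous of degree zero, as the Hessian \<open>A\<close> of the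
  support function has degree \<open>- 1\<close>.\<close>

definition ev :: "real^'d \<Rightarrow> real list" where
  "ev x = form_eigenvalues {v. v \<bullet> (x /\<^sub>R norm x) = 0} (\<lambda>v w. norm x * (A x v \<bullet> w))"

text \<open>Symmetry and \<open>A x x = 0\<close> keep \<open>A x e\<close> orthogonal to
  \<open>x\<close>. This upgrades the eigenvalue relation, known only against tangent vectors, to an
  identity of vectors.\<close>

lemma ev_eigenbasis:
  assumes x: "x \<noteq> 0"
  obtains es where "orthonormal_list (x /\<^sub>R norm x # es)" "length es = n"
    "\<And>e. e \<in> set es \<Longrightarrow> A x e = (A x e \<bullet> e) *\<^sub>R e" "ev x = map (\<lambda>e. norm x * (A x e \<bullet> e)) es"
proof -
  let ?z = "x /\<^sub>R norm x" and ?T = "{v. v \<bullet> (x /\<^sub>R norm x) = 0}"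
  have T: "subspace ?T" by (auto simp: subspace_def inner_simps)
  have L: "linear (\<lambda>v. norm x *\<^sub>R A x v)"
    using A_linear[OF x] by (auto intro!: linearI simp: linear_add linear_cmul scaleR_add_right)
  have "?z \<noteq> 0" using x by simp
  then have "dim ?T = n"
    using dim_hyperplane[of ?z] dim by (simp add: inner_commute)
  moreover obtain es where es: "orthonormal_list es" "length es = dim ?T" "set es \<subseteq> ?T"
    "\<And>e w. e \<in> set es \<Longrightarrow> w \<in> ?T \<Longrightarrow> norm x *\<^sub>R A x e \<bullet> w = (norm x *\<^sub>R A x e \<bullet> e) * (e \<bullet> w)"
    "form_eigenvalues ?T (\<lambda>v w. norm x * (A x v \<bullet> w)) = map (\<lambda>e. norm x *\<^sub>R A x e \<bullet> e) es"
    by (rule form_eigenvalues_eigenbasis[OF T L, where form = "\<lambda>v w. norm x * (A x v \<bullet> w)"])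
      (use A_sym[OF x] in \<open>simp, simp, blast\<close>)
  moreover have "orthonormal_list (?z # es)"
  proof -
    have "?z \<notin> set es"
    proof
      assume "?z \<in> set es"
      then have "?z \<bullet> ?z = 0" using es(3) by blast
      then show False using \<open>?z \<noteq> 0\<close> by (metis inner_eq_zero_iff)
    qed
    then show ?thesis
      using es(1,3) x by (auto simp: orthonormal_list_def pairwise_insert orthogonal_def inner_commute)
  qed
  moreover have "A x e = (A x e \<bullet> e) *\<^sub>R e" if e: "e \<in> set es" for e
  proof -
    have "A x e \<bullet> x = 0" using A_sym[OF x, of e x] A_self[OF x] by simp
    moreover have "e \<bullet> x = 0" using e es(3) x by auto
    ultimately have w: "A x e - (A x e \<bullet> e) *\<^sub>R e \<in> ?T" by (simp add: inner_diff_left)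
    have "A x e \<bullet> w = (A x e \<bullet> e) * (e \<bullet> w)" if "w \<in> ?T" for w
      using es(4)[OF e that] x by simp
    from this[OF w] have "(A x e - (A x e \<bullet> e) *\<^sub>R e) \<bullet> (A x e - (A x e \<bullet> e) *\<^sub>R e) = 0"
      by (simp add: inner_diff_left)
    then show ?thesis by simp
  qed
  ultimately show thesis
    using that[of es] by (simp add: ev_def)
qed

lemma ev_pos:
  assumes x: "x \<noteq> 0" and i: "i < n"
  shows "0 < ev x ! i"
proof (rule ev_eigenbasis[OF x])
  fix es assume es: "orthonormal_list (x /\<^sub>R norm x # es)" "length es = n"
    "ev x = map (\<lambda>e. norm x * (A x e \<bullet> e)) es"
  have e: "es ! i \<in> set es" using i es(2) by simp
  then have "norm (es ! i) = 1" using es(1) by (simp add: orthonormal_list_def)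
  then have "es ! i \<noteq> 0" by auto
  moreover have "x \<bullet> es ! i = 0"
  proof -
    have "x /\<^sub>R norm x \<noteq> es ! i" using e es(1) by (auto simp: orthonormal_list_def)
    then have "(x /\<^sub>R norm x) \<bullet> es ! i = 0"
      using orthonormal_list_inner[OF es(1), of "x /\<^sub>R norm x" "es ! i"] e by simp
    then show ?thesis using x by simp
  qed
  ultimately have "0 < A x (es ! i) \<bullet> es ! i" by (rule A_pos[OF x])
  then show ?thesis using x i es(2) by (simp add: es(3))
qed

lemma ev_scale:
  assumes "0 < c" "x \<noteq> 0"
  shows "ev (c *\<^sub>R x) = ev x"
proof -
  have "(c *\<^sub>R x) /\<^sub>R norm (c *\<^sub>R x) = x /\<^sub>R norm x"
    using assms by (metis scaleR_one sgn_div_norm sgn_pos sgn_scaleR)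
  moreover have "norm (c *\<^sub>R x) * (A (c *\<^sub>R x) v \<bullet> w) = norm x * (A x v \<bullet> w)" for v w
    using assms by (simp add: A_scale)
  ultimately show ?thesis by (simp only: ev_def)
qed

text \<open>All Jacobians below have this shape. The radial unit vector goes to \<open>p\<close> and
  each principal direction is an eigenvector. Division by \<open>norm x\<close> undoes the
  normalization in \<open>ev\<close>.\<close>

lemma det_radial:
  assumes x: "x \<noteq> 0" and D: "\<And>v. D v = ((x /\<^sub>R norm x) \<bullet> v) *\<^sub>R p + a *\<^sub>R A x v + b *\<^sub>R (v - ((x /\<^sub>R norm x) \<bullet> v) *\<^sub>R (x /\<^sub>R norm x))"
  shows "det (matrix D) = (p \<bullet> (x /\<^sub>R norm x)) * (\<Prod>i<n. a * (ev x ! i) / norm x + b)"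
proof (rule ev_eigenbasis[OF x])
  fix es assume es: "orthonormal_list (x /\<^sub>R norm x # es)" "length es = n"
    "\<And>e. e \<in> set es \<Longrightarrow> A x e = (A x e \<bullet> e) *\<^sub>R e" "ev x = map (\<lambda>e. norm x * (A x e \<bullet> e)) es"
  let ?z = "x /\<^sub>R norm x"
  have zz: "?z \<bullet> ?z = 1" using orthonormal_list_inner[OF es(1), of ?z ?z] by simp
  have L: "linear D"
    unfolding D using A_linear[OF x]
    by (auto intro!: linearI simp: linear_add linear_cmul inner_add_right algebra_simps)
  have De: "D e = (a * (A x e \<bullet> e) + b) *\<^sub>R e" if e: "e \<in> set es" for e
  proof -
    have "?z \<bullet> e = 0"
      using orthonormal_list_inner[OF es(1), of ?z e] e es(1) by (auto simp: orthonormal_list_def)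
    then have "D e = a *\<^sub>R A x e + b *\<^sub>R e" by (simp only: D) simp
    also have "A x e = (A x e \<bullet> e) *\<^sub>R e" using es(3)[OF e] .
    finally show ?thesis by (simp add: algebra_simps)
  qed
  have Dz: "D ?z = p"
  proof -
    have "A x ?z = 0" using linear_cmul[OF A_linear[OF x]] A_self[OF x] by simp
    then show ?thesis unfolding D zz by simp
  qed
  have "det (matrix D) = (D ?z \<bullet> ?z) * (\<Prod>e\<leftarrow>es. a * (A x e \<bullet> e) + b)"
    by (rule det_orthonormal_triangular[OF L es(1) _ De]) (use es(2) dim in simp_all)
  also have "(\<Prod>e\<leftarrow>es. a * (A x e \<bullet> e) + b) = (\<Prod>i<n. a * (ev x ! i) / norm x + b)"
    using x es(2) by (simp add: es(4) prod.list_conv_set_nth atLeast0LessThan)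
  finally show ?thesis by (simp add: Dz)
qed

lemma trace_A:
  assumes x: "x \<noteq> 0"
  shows "(\<Sum>e\<in>Basis. A x e \<bullet> e) = (\<Sum>i<n. ev x ! i) / norm x"
proof (rule ev_eigenbasis[OF x])
  fix es assume es: "orthonormal_list (x /\<^sub>R norm x # es)" "length es = n"
    "ev x = map (\<lambda>e. norm x * (A x e \<bullet> e)) es"
  let ?z = "x /\<^sub>R norm x"
  have d: "distinct (?z # es)" using es(1) by (simp add: orthonormal_list_def)
  have "(\<Sum>e\<in>Basis. A x e \<bullet> e) = (\<Sum>e\<in>set (?z # es). A x e \<bullet> e)"
  proof (rule sum_inner_orthonormal_basis[OF A_linear[OF x]])
    show "card (set (?z # es)) = DIM(real^'d)"
      using distinct_card[OF d] es(2) dim by simp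
  qed (use es(1) in \<open>auto simp: orthonormal_list_def\<close>)
  also have "\<dots> = A x ?z \<bullet> ?z + (\<Sum>e\<leftarrow>es. A x e \<bullet> e)"
    using d by (simp add: sum.distinct_set_conv_list)
  also have "A x ?z = 0" using linear_cmul[OF A_linear[OF x]] A_self[OF x] by simp
  also have "(\<Sum>e\<leftarrow>es. A x e \<bullet> e) = (\<Sum>i<n. ev x ! i) / norm x"
    using x es(2) by (simp add: es(3) sum.list_conv_set_nth atLeast0LessThan sum_divide_distrib)
  finally show ?thesis by simp
qed

end

text \<open>The constant coefficient is the limit of the values as \<open>t\<close> decreases to
  \<open>0\<close>; subtract it, divide by \<open>t\<close> and induct. Applied to the product of
  the \<open>ev x ! i + t\<close>, this derives measurability of the symmetric functions from
  continuity of determinants.\<close>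

lemma borel_measurable_polynomial_coeff:
  fixes c :: "nat \<Rightarrow> 'a \<Rightarrow> real"
  assumes "\<And>t. 0 < t \<Longrightarrow> (\<lambda>x. \<Sum>m\<le>n. c m x * t ^ m) \<in> borel_measurable M" "m \<le> n"
  shows "c m \<in> borel_measurable M"
  using assms
proof (induction n arbitrary: c m)
  case 0
  then show ?case using "0.prems"(1)[of 1] by simp
next
  case (Suc n)
  have c0: "c 0 \<in> borel_measurable M"
  proof (rule borel_measurable_LIMSEQ_real)
    fix x
    have "isCont (\<lambda>t. \<Sum>m\<le>Suc n. c m x * t ^ m) 0" by (intro continuous_intros)
    then have "((\<lambda>t. \<Sum>m\<le>Suc n. c m x * t ^ m) \<longlongrightarrow> (\<Sum>m\<le>Suc n. c m x * 0 ^ m)) (at 0)"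
      by (simp only: isCont_def)
    moreover have "filterlim (\<lambda>k. 1 / real (Suc k)) (at 0) sequentially"
      using LIMSEQ_inverse_real_of_nat by (auto simp: filterlim_at inverse_eq_divide)
    ultimately have "(\<lambda>k. \<Sum>m\<le>Suc n. c m x * (1 / real (Suc k)) ^ m) \<longlonglongrightarrow> (\<Sum>m\<le>Suc n. c m x * 0 ^ m)"
      by (rule filterlim_compose)
    moreover have "(\<Sum>m\<le>Suc n. c m x * 0 ^ m) = c 0 x"
      by (subst sum.atMost_Suc_shift) simp
    ultimately show "(\<lambda>k. \<Sum>m\<le>Suc n. c m x * (1 / real (Suc k)) ^ m) \<longlonglongrightarrow> c 0 x" by simp
  qed (rule Suc.prems(1), simp)
  show ?case
  proof (cases m)
    case 0
    then show ?thesis using c0 by simp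
  next
    case (Suc k)
    have "(\<lambda>x. \<Sum>m\<le>n. c (Suc m) x * t ^ m) \<in> borel_measurable M" if t: "0 < t" for t
    proof -
      have "(\<lambda>x. ((\<Sum>m\<le>Suc n. c m x * t ^ m) - c 0 x) / t) \<in> borel_measurable M"
        using Suc.prems(1)[OF t] c0 by (intro borel_measurable_divide borel_measurable_diff) auto
      moreover have "((\<Sum>m\<le>Suc n. c m x * t ^ m) - c 0 x) / t = (\<Sum>m\<le>n. c (Suc m) x * t ^ m)" for x
      proof -
        have "(\<Sum>m\<le>Suc n. c m x * t ^ m) - c 0 x = t * (\<Sum>m\<le>n. c (Suc m) x * t ^ m)"
          by (subst sum.atMost_Suc_shift) (simp add: sum_distrib_left mult_ac)
        then show ?thesis using t by simp
      qed
      ultimately show ?thesis by simp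
    qed
    from Suc.IH[OF this] show ?thesis using \<open>m = Suc k\<close> Suc.prems(2) by simp
  qed
qed

lemma polynomial_zero_on_pos:
  fixes c :: "nat \<Rightarrow> real"
  assumes "\<And>t. 0 < t \<Longrightarrow> (\<Sum>m\<le>n. c m * t ^ m) = 0" "m \<le> n"
  shows "c m = 0"
proof (rule ccontr)
  assume "c m \<noteq> 0"
  then have "finite {t. (\<Sum>m\<le>n. c m * t ^ m) = 0}"
    using polyfun_finite_roots[of c n] assms(2) by blast
  then have "finite {0 :: real<..}" by (rule rev_finite_subset) (use assms(1) in auto)
  then show False by (simp add: infinite_Ioi)
qed

section \<open>Functions on the punctured space and integrals over the unit ball\<close>

lemma borel_measurable_punctured:
  fixes f :: "'a::euclidean_space \<Rightarrow> real"
  assumes "continuous_on (- {0}) f"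
  shows "(\<lambda>x. if x = 0 then c else f x) \<in> borel_measurable borel"
proof -
  have "(\<lambda>x. if x \<in> - {0} then f x else c) \<in> borel_measurable borel"
    by (rule borel_measurable_continuous_on_if) (use assms in auto)
  moreover have "(\<lambda>x. if x \<in> - {0} then f x else c) = (\<lambda>x. if x = 0 then c else f x)" by auto
  ultimately show ?thesis by simp
qed

lemma continuous_on_det_matrix:
  fixes D :: "'p::topological_space \<Rightarrow> real^'d::finite \<Rightarrow> real^'d"
  assumes "\<And>v. continuous_on S (\<lambda>x. D x v)"
  shows "continuous_on S (\<lambda>x. det (matrix (D x)))"
  unfolding det_def matrix_def using assms
  by (auto intro!: continuous_intros)

definition ball_integral :: "('a::euclidean_space \<Rightarrow> real) \<Rightarrow> real" where
  "ball_integral g = (\<integral>x. indicator (ball 0 1) x * g x \<partial>lborel)"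

lemma ball_integrable:
  fixes g :: "'a::euclidean_space \<Rightarrow> real"
  assumes "g \<in> borel_measurable borel" "\<And>x. norm x < 1 \<Longrightarrow> \<bar>g x\<bar> \<le> C"
  shows "integrable lborel (\<lambda>x. indicator (ball 0 1) x * g x)"
proof (rule Bochner_Integration.integrable_bound)
  show "integrable lborel (\<lambda>x :: 'a. \<bar>C\<bar> * indicator (ball 0 1) x)"
    using emeasure_bounded_finite[of "ball (0 :: 'a) 1"] by (intro integrable_mult_right integrable_real_indicator) auto
  have "ball (0 :: 'a) 1 \<in> sets borel" by simp
  then show "(\<lambda>x. indicator (ball 0 1) x * g x) \<in> borel_measurable lborel" using assms(1) by measurable
  show "AE x in lborel. norm (indicator (ball 0 1) x * g x) \<le> norm (\<bar>C\<bar> * indicator (ball 0 1) x :: real)"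
    using assms(2) by (intro AE_I2) (force simp: indicator_def)
qed

lemma nn_integral_ball:
  fixes g :: "'a::euclidean_space \<Rightarrow> real"
  assumes "g \<in> borel_measurable borel" "\<And>x. norm x < 1 \<Longrightarrow> \<bar>g x\<bar> \<le> C" "\<And>x. 0 \<le> g x"
  shows "(\<integral>\<^sup>+x\<in>ball 0 1. ennreal (g x) \<partial>lborel) = ennreal (ball_integral g)"
proof -
  have "(\<integral>\<^sup>+x\<in>ball 0 1. ennreal (g x) \<partial>lborel) = (\<integral>\<^sup>+x. ennreal (indicator (ball 0 1) x * g x) \<partial>lborel)"
    by (intro nn_integral_cong) (simp add: indicator_def)
  also have "\<dots> = ennreal (ball_integral g)"
    unfolding ball_integral_def using assms(3)
    by (intro nn_integral_eq_integral ball_integrable[OF assms(1,2)]) auto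
  finally show ?thesis .
qed

text \<open>In polar coordinates the weight replaces \<open>\<rho>^(N - 1)\<close> by
  \<open>\<rho>^(N + m - 1)\<close> on the unit interval, where \<open>N\<close> is the dimension,
  so \<open>1 / N\<close> becomes \<open>1 / (N + m)\<close>. These factors distinguish the two
  volume polynomials compared later.\<close>

lemma ball_integral_power:
  fixes g :: "'a::euclidean_space \<Rightarrow> real"
  assumes g: "g \<in> borel_measurable borel" "\<And>x. norm x < 1 \<Longrightarrow> \<bar>g x\<bar> \<le> C" "\<And>x. 0 \<le> g x"
    and hom: "\<And>c x. 0 < c \<Longrightarrow> x \<noteq> 0 \<Longrightarrow> g (c *\<^sub>R x) = g x"
  shows "ball_integral (\<lambda>x. norm x ^ m * g x) = DIM('a) / (DIM('a) + m) * ball_integral g"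
proof -
  let ?N = "DIM('a)"
  have [measurable]: "g \<in> borel_measurable borel" "ball (0 :: 'a) 1 \<in> sets borel" using g(1) by auto
  have N: "0 < real ?N + real m" by (simp add: add_pos_nonneg)
  have b: "\<bar>norm x ^ m * g x\<bar> \<le> \<bar>C\<bar>" if "norm x < 1" for x :: 'a
  proof -
    have "norm x ^ m \<le> 1" using that by (intro power_le_one) auto
    then have "norm x ^ m * g x \<le> 1 * g x" using g(3) by (intro mult_right_mono) auto
    then show ?thesis using g(2)[OF that] g(3)[of x] by simp
  qed
  have "ennreal (ball_integral (\<lambda>x. norm x ^ m * g x)) = (\<integral>\<^sup>+x\<in>ball 0 1. ennreal (norm x ^ m * g x) \<partial>lborel)"
    by (rule nn_integral_ball[OF _ b, symmetric]) (use g(3) in auto)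
  also have "\<dots> = (\<integral>\<^sup>+x. ennreal (g x) * (ennreal (norm x ^ m) * indicator {..<1} (norm x)) \<partial>lborel)"
    using g(3) by (intro nn_integral_cong) (auto simp: indicator_def ennreal_mult mult_ac)
  also have "\<dots> = of_nat ?N * (\<integral>\<^sup>+\<rho>\<in>{0<..}. (ennreal (\<rho> ^ m) * indicator {..<1} \<rho>) * ennreal (\<rho> ^ (?N - 1)) \<partial>lborel) *
      (\<integral>\<^sup>+y\<in>ball 0 1. ennreal (g y) \<partial>lborel)"
    by (rule nn_integral_polar_product) (auto simp: hom)
  also have "(\<integral>\<^sup>+\<rho>\<in>{0<..}. (ennreal (\<rho> ^ m) * indicator {..<1} \<rho>) * ennreal (\<rho> ^ (?N - 1)) \<partial>lborel)
      = (\<integral>\<^sup>+\<rho>\<in>{0..1}. ennreal (\<rho> ^ (?N + m - 1)) \<partial>lborel)"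
  proof (rule nn_integral_cong_AE, use AE_lborel_singleton[of 0] AE_lborel_singleton[of 1] in eventually_elim)
    fix \<rho> :: real assume "\<rho> \<noteq> 0" "\<rho> \<noteq> 1"
    moreover have "\<rho> ^ m * \<rho> ^ (?N - 1) = \<rho> ^ (?N + m - 1)"
      by (simp add: power_add[symmetric] add.commute Nat.add_diff_assoc Suc_leI)
    ultimately show "(ennreal (\<rho> ^ m) * indicator {..<1} \<rho>) * ennreal (\<rho> ^ (?N - 1)) * indicator {0<..} \<rho>
        = ennreal (\<rho> ^ (?N + m - 1)) * indicator {0..1} \<rho>"
      by (auto simp: indicator_def ennreal_mult[symmetric])
  qed
  also have "\<dots> = ennreal (1 ^ (?N + m) / real (?N + m) - 0 ^ (?N + m) / real (?N + m))"
  proof (rule nn_integral_FTC_Icc)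
    show "((\<lambda>\<rho>. \<rho> ^ (?N + m) / real (?N + m)) has_real_derivative \<rho> ^ (?N + m - 1)) (at \<rho>)" for \<rho>
      using N by (auto intro!: derivative_eq_intros)
  qed auto
  also have "\<dots> = ennreal (1 / real (?N + m))" by (simp add: power_0_left)
  also have "(\<integral>\<^sup>+y\<in>ball 0 1. ennreal (g y) \<partial>lborel) = ennreal (ball_integral g)"
    by (rule nn_integral_ball[OF g])
  also have "of_nat ?N * ennreal (1 / real (?N + m)) * ennreal (ball_integral g)
      = ennreal (?N / (?N + m) * ball_integral g)"
    by (simp add: ennreal_of_nat_eq_real_of_nat ennreal_mult'[symmetric] ennreal_mult''[symmetric])
  finally show ?thesis
    using g(3) by (subst (asm) ennreal_inj) (auto simp: ball_integral_def intro!: integral_nonneg_AE mult_nonneg_nonneg divide_nonneg_nonneg)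
qed

section \<open>Symmetric functions of the principal radii\<close>

context support_gradient
begin

definition E :: "nat \<Rightarrow> real^'d \<Rightarrow> real" where
  "E k x = (if x = 0 then 0 else esym n k ((!) (ev x)))"

text \<open>In contrast to \<open>h\<close>, which has degree one, this is the degree zero extension
  of the support function on the sphere. The value at \<open>0\<close> is a convention on a null
  set.\<close>

definition u :: "real^'d \<Rightarrow> real" where
  "u x = (if x = 0 then 0 else h x / norm x)"

definition ev_sum :: "real^'d \<Rightarrow> real" where
  "ev_sum x = (if x = 0 then 0 else \<Sum>i<n. ev x ! i)"

text \<open>Expresses the product through a matrix with entries continuous in \<open>x\<close>, so
  that no continuous choice of eigenvectors is involved.\<close>

lemma prod_ev_det:
  assumes x: "x \<noteq> 0"
  shows "(\<Prod>i<n. ev x ! i + t) = det (matrix (\<lambda>v. ((x /\<^sub>R norm x) \<bullet> v) *\<^sub>R (x /\<^sub>R norm x) + norm x *\<^sub>R A x v +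
    t *\<^sub>R (v - ((x /\<^sub>R norm x) \<bullet> v) *\<^sub>R (x /\<^sub>R norm x))))"
proof -
  have "(x /\<^sub>R norm x) \<bullet> (x /\<^sub>R norm x) = 1" using x by (simp add: dot_square_norm power2_eq_square)
  then show ?thesis using x by (subst det_radial[OF x refl]) simp
qed

lemma continuous_prod_ev: "continuous_on (- {0}) (\<lambda>x. \<Prod>i<n. ev x ! i + t)"
proof (rule continuous_on_eq)
  show "continuous_on (- {0}) (\<lambda>x. det (matrix (\<lambda>v. ((x /\<^sub>R norm x) \<bullet> v) *\<^sub>R (x /\<^sub>R norm x) + norm x *\<^sub>R A x v +
    t *\<^sub>R (v - ((x /\<^sub>R norm x) \<bullet> v) *\<^sub>R (x /\<^sub>R norm x)))))"
    by (intro continuous_on_det_matrix continuous_intros A_cont) auto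
qed (use prod_ev_det in auto)

lemma prod_ev_polynomial:
  assumes x: "x \<noteq> 0"
  shows "(\<Prod>i<n. ev x ! i + t) = (\<Sum>m\<le>n. E (n - m) x * t ^ m)"
proof -
  have "(\<Prod>i<n. ev x ! i + t) = (\<Sum>k\<le>n. E k x * t ^ (n - k))"
    using x by (simp add: prod_add_const_esym E_def)
  also have "\<dots> = (\<Sum>m\<le>n. E (n - m) x * t ^ m)"
    by (rule sum.reindex_bij_witness[of _ "\<lambda>m. n - m" "\<lambda>m. n - m"]) auto
  finally show ?thesis .
qed

lemma E_measurable [measurable]:
  assumes "k \<le> n"
  shows "E k \<in> borel_measurable borel"
proof -
  have "(\<lambda>x. \<Sum>m\<le>n. E (n - m) x * t ^ m) \<in> borel_measurable borel" for t
  proof -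
    have "(\<lambda>x. if x = 0 then 0 else \<Prod>i<n. ev x ! i + t) \<in> borel_measurable borel"
      by (rule borel_measurable_punctured[OF continuous_prod_ev])
    moreover have "(\<lambda>x. if x = 0 then 0 else \<Prod>i<n. ev x ! i + t) = (\<lambda>x. \<Sum>m\<le>n. E (n - m) x * t ^ m)"
      by (auto simp: prod_ev_polynomial fun_eq_iff) (simp add: E_def)
    ultimately show ?thesis by simp
  qed
  then have "E (n - (n - k)) \<in> borel_measurable borel"
    by (rule borel_measurable_polynomial_coeff) simp
  then show ?thesis using assms by simp
qed

lemma u_cont: "continuous_on (- {0}) (\<lambda>x. h x / norm x)"
  by (intro continuous_intros h_cont) auto

lemma u_measurable [measurable]: "u \<in> borel_measurable borel"
  unfolding u_def by (rule borel_measurable_punctured[OF u_cont])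

lemma E_nonneg: "0 \<le> E k x"
  by (simp add: E_def esym_nonneg ev_pos less_imp_le)

lemma u_nonneg: "0 \<le> u x"
  unfolding u_def using h_pos[of x] by auto

lemma E_scale: "0 < c \<Longrightarrow> x \<noteq> 0 \<Longrightarrow> E k (c *\<^sub>R x) = E k x"
  by (simp add: E_def ev_scale)

lemma u_scale: "0 < c \<Longrightarrow> x \<noteq> 0 \<Longrightarrow> u (c *\<^sub>R x) = u x"
  by (simp add: u_def h_scale)

lemma ev_sum_trace: "x \<noteq> 0 \<Longrightarrow> ev_sum x = norm x * (\<Sum>e\<in>Basis. A x e \<bullet> e)"
  by (simp add: ev_sum_def trace_A)

lemma trace_cont: "continuous_on (- {0}) (\<lambda>x. norm x * (\<Sum>e\<in>Basis. A x e \<bullet> e))"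
  by (intro continuous_intros A_cont)

lemma ev_sum_measurable [measurable]: "ev_sum \<in> borel_measurable borel"
proof -
  have "ev_sum = (\<lambda>x. if x = 0 then 0 else norm x * (\<Sum>e\<in>Basis. A x e \<bullet> e))"
    using ev_sum_trace by (auto simp: fun_eq_iff ev_sum_def)
  then show ?thesis using borel_measurable_punctured[OF trace_cont] by simp
qed

lemma ev_sum_nonneg: "0 \<le> ev_sum x"
  by (auto simp: ev_sum_def ev_pos less_imp_le intro!: sum_nonneg)

lemma ev_sum_scale: "0 < c \<Longrightarrow> x \<noteq> 0 \<Longrightarrow> ev_sum (c *\<^sub>R x) = ev_sum x"
  by (simp add: ev_sum_def ev_scale)

lemma homogeneous_bounded:
  fixes g :: "real^'d \<Rightarrow> real"
  assumes cont: "continuous_on (- {0}) g" and hom: "\<And>c x. 0 < c \<Longrightarrow> x \<noteq> 0 \<Longrightarrow> g (c *\<^sub>R x) = g x"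
  shows "\<exists>C. \<forall>x. x \<noteq> 0 \<longrightarrow> \<bar>g x\<bar> \<le> C"
proof -
  have "bounded (g ` sphere 0 1)"
    by (intro compact_imp_bounded compact_continuous_image continuous_on_subset[OF cont]) auto
  then obtain C where C: "\<forall>y\<in>g ` sphere 0 1. norm y \<le> C"
    unfolding bounded_iff by blast
  then have C': "\<bar>g y\<bar> \<le> C" if "y \<in> sphere 0 1" for y using that by simp
  have "\<bar>g x\<bar> \<le> C" if "x \<noteq> 0" for x
  proof -
    have "g (inverse (norm x) *\<^sub>R x) = g x" using that by (intro hom) auto
    then show ?thesis using C'[of "inverse (norm x) *\<^sub>R x"] that by simp
  qed
  then show ?thesis by blast
qed

lemma ev_le_ev_sum: "x \<noteq> 0 \<Longrightarrow> i < n \<Longrightarrow> ev x ! i \<le> ev_sum x"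
  using member_le_sum[of i "{..<n}" "(!) (ev x)"] by (simp add: ev_sum_def ev_pos less_imp_le)

lemma bounds:
  obtains C where "0 < C" "\<And>x. u x \<le> C" "\<And>x. ev_sum x \<le> C" "\<And>x k. k \<le> n \<Longrightarrow> E k x \<le> C"
proof -
  obtain a where a: "\<And>x. x \<noteq> 0 \<Longrightarrow> \<bar>h x / norm x\<bar> \<le> a"
    using homogeneous_bounded[OF u_cont] by (auto simp: h_scale)
  have "norm (c *\<^sub>R x) * (\<Sum>e\<in>Basis. A (c *\<^sub>R x) e \<bullet> e) = norm x * (\<Sum>e\<in>Basis. A x e \<bullet> e)"
    if "0 < c" "x \<noteq> 0" for c x
  proof -
    have cx: "c *\<^sub>R x \<noteq> 0" using that by simp
    show ?thesis using ev_sum_trace[OF cx] ev_sum_trace[OF that(2)] ev_sum_scale[OF that] by linarith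
  qed
  then obtain b where b: "\<And>x. x \<noteq> 0 \<Longrightarrow> \<bar>norm x * (\<Sum>e\<in>Basis. A x e \<bullet> e)\<bar> \<le> b"
    using homogeneous_bounded[OF trace_cont] by blast
  \<comment> \<open>\<open>b\<close> bounds the sum of the positive eigenvalues and hence each of
    them. \<open>E k\<close> is at most the sum of all elementary symmetric functions, which is the
    product of the \<open>ev x ! i + 1\<close>.\<close>
  define C where "C = \<bar>a\<bar> + \<bar>b\<bar> + (\<bar>b\<bar> + 1) ^ n + 1"
  have "0 \<le> (\<bar>b\<bar> + 1) ^ n" by simp
  then have C: "\<bar>a\<bar> \<le> C" "\<bar>b\<bar> \<le> C" "(\<bar>b\<bar> + 1) ^ n \<le> C" "0 < C"
    unfolding C_def by linarith+
  have S: "ev_sum x \<le> \<bar>b\<bar>" for x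
    using b[of x] ev_sum_trace[of x] by (cases "x = 0") (auto simp: ev_sum_def)
  have "E k x \<le> C" if k: "k \<le> n" for x k
  proof (cases "x = 0")
    case False
    have "E k x \<le> (\<Sum>m\<le>n. E (n - m) x * 1 ^ m)"
      using member_le_sum[of "n - k" "{..n}" "\<lambda>m. E (n - m) x"] E_nonneg k by simp
    also have "\<dots> = (\<Prod>i<n. ev x ! i + 1)" using False by (simp add: prod_ev_polynomial)
    also have "\<dots> \<le> (\<Prod>i<n. \<bar>b\<bar> + 1)"
    proof (intro prod_mono conjI)
      fix i assume "i \<in> {..<n}"
      then have "0 < ev x ! i" "ev x ! i \<le> ev_sum x" using ev_pos[OF False] ev_le_ev_sum[OF False] by simp_all
      then show "0 \<le> ev x ! i + 1" "ev x ! i + 1 \<le> \<bar>b\<bar> + 1" using S[of x] by linarith+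
    qed
    finally show ?thesis using C(3) by simp
  qed (use C(4) in \<open>simp add: E_def\<close>)
  moreover have "u x \<le> C" for x
  proof (cases "x = 0")
    case False
    then have "u x \<le> \<bar>a\<bar>" using abs_le_D1[OF a[OF False]] by (simp add: u_def)
    then show ?thesis using C(1) by linarith
  qed (use C(4) in \<open>simp add: u_def\<close>)
  moreover have "ev_sum x \<le> C" for x using S[of x] C(2) by linarith
  ultimately show thesis using that C(4) by blast
qed

end

section \<open>Minkowski formulas and the Heintze-Karcher inequality\<close>

text \<open>The gradient vanishes at \<open>z\<close>. A negative second derivative would make its
  component along \<open>v\<close> negative just after \<open>z\<close>, and the mean value theorem
  would produce a value below the minimum.\<close>

lemma minimum_second_derivative_nonneg:
  fixes F :: "'a::euclidean_space \<Rightarrow> real"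
  assumes U: "open U" "z \<in> U" and min: "\<And>x. x \<in> U \<Longrightarrow> F z \<le> F x"
    and F: "\<And>x. x \<in> U \<Longrightarrow> (F has_derivative (\<lambda>v. g x \<bullet> v)) (at x)"
    and g: "(g has_derivative Q) (at z)"
  shows "0 \<le> Q v \<bullet> v"
proof (rule ccontr)
  assume neg: "\<not> 0 \<le> Q v \<bullet> v"
  have line: "((\<lambda>t. z + t *\<^sub>R v) has_derivative (\<lambda>s. s *\<^sub>R v)) (at t)" for t
    by (auto intro!: derivative_eq_intros)
  have "((\<lambda>v. g z \<bullet> v)) = (\<lambda>v. 0)"
    by (rule differential_zero_maxmin[OF U(2,1) F[OF U(2)]]) (use min in auto)
  then have g0: "g z \<bullet> v = 0" by metis
  have "((\<lambda>t. g (z + t *\<^sub>R v)) has_derivative (\<lambda>s. Q (s *\<^sub>R v))) (at 0)"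
    by (rule has_derivative_compose[OF line]) (simp add: g)
  then have "((\<lambda>t. g (z + t *\<^sub>R v) \<bullet> v) has_derivative (\<lambda>s. Q (s *\<^sub>R v) \<bullet> v)) (at 0)"
    by (rule has_derivative_inner_left)
  moreover have "(\<lambda>s. Q (s *\<^sub>R v) \<bullet> v) = (*) (Q v \<bullet> v)"
    using has_derivative_linear[OF g] by (auto simp: linear_cmul mult.commute)
  ultimately have "DERIV (\<lambda>t. g (z + t *\<^sub>R v) \<bullet> v) 0 :> Q v \<bullet> v"
    by (simp add: has_field_derivative_def)
  then obtain d where d: "0 < d" "\<And>t. 0 < t \<Longrightarrow> t < d \<Longrightarrow> g (z + t *\<^sub>R v) \<bullet> v < 0"
    using DERIV_neg_dec_right[of "\<lambda>t. g (z + t *\<^sub>R v) \<bullet> v" "Q v \<bullet> v" 0] neg g0 by auto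
  obtain r where r: "0 < r" "ball z r \<subseteq> U" using U open_contains_ball by blast
  define t where "t = min (d / 2) (r / (2 * (norm v + 1)))"
  have v1: "0 < norm v + 1" by (simp add: add_nonneg_pos)
  have "t \<le> d / 2" unfolding t_def by (rule min.cobounded1)
  moreover have t0: "0 < t" using d(1) r(1) v1 by (simp add: t_def)
  ultimately have td: "t < d" using d(1) by simp
  have "t \<le> r / (2 * (norm v + 1))" unfolding t_def by (rule min.cobounded2)
  then have tr: "t * (norm v + 1) \<le> r / 2" using v1 by (simp add: pos_le_divide_eq mult_ac)
  have inU: "z + s *\<^sub>R v \<in> U" if "0 \<le> s" "s \<le> t" for s
  proof -
    have "norm (s *\<^sub>R v) = s * norm v" using that by simp
    also have "\<dots> \<le> t * (norm v + 1)" using that by (intro mult_mono) auto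
    finally have "norm (s *\<^sub>R v) < r" using tr r(1) by linarith
    then show ?thesis using r(2) by (intro subsetD[OF r(2)]) (simp add: dist_norm)
  qed
  have der: "DERIV (\<lambda>s. F (z + s *\<^sub>R v)) s :> g (z + s *\<^sub>R v) \<bullet> v" if "0 \<le> s" "s \<le> t" for s
  proof -
    have "((\<lambda>s. F (z + s *\<^sub>R v)) has_derivative (\<lambda>a. g (z + s *\<^sub>R v) \<bullet> (a *\<^sub>R v))) (at s)"
      by (rule has_derivative_compose[OF line F[OF inU[OF that]]])
    moreover have "(\<lambda>a. g (z + s *\<^sub>R v) \<bullet> (a *\<^sub>R v)) = (*) (g (z + s *\<^sub>R v) \<bullet> v)" by (auto simp: mult.commute)
    ultimately show ?thesis by (simp add: has_field_derivative_def)
  qed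
  obtain s where s: "0 < s" "s < t" "F (z + t *\<^sub>R v) - F (z + 0 *\<^sub>R v) = (t - 0) * (g (z + s *\<^sub>R v) \<bullet> v)"
    using MVT2[OF t0, of "\<lambda>s. F (z + s *\<^sub>R v)" "\<lambda>s. g (z + s *\<^sub>R v) \<bullet> v"] der by auto
  have "g (z + s *\<^sub>R v) \<bullet> v < 0" using d(2)[of s] s td by simp
  then have "t * (g (z + s *\<^sub>R v) \<bullet> v) < 0" using t0 by (simp only: mult_pos_neg)
  then have "F (z + t *\<^sub>R v) < F z" using s(3) by simp
  then show False using min[OF inU[of t]] t0 by simp
qed

section \<open>Two parametrizations of the parallel bodies\<close>

context support_gradient
begin

text \<open>For nonnegative \<open>t\<close>, the interior of the outer parallel body at distance
  \<open>t\<close>, described by the support function \<open>h + t\<close> on unit vectors. The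
  origin is removed because the image of the punctured ball under \<open>Phi\<close> misses
  it.\<close>

definition inner_region :: "real \<Rightarrow> (real^'d) set" where
  "inner_region t = {y. y \<noteq> 0 \<and> (\<forall>z. norm z = 1 \<longrightarrow> y \<bullet> z < h z + t)}"

lemma unit_sphere_nonempty: "sphere (0 :: real^'d) 1 \<noteq> {}"
  by simp

lemma h_cont_sphere: "continuous_on (sphere 0 1) h"
  by (rule continuous_on_subset[OF h_cont]) auto

lemma attains_min_gap:
  fixes t :: real and y :: "real^'d"
  obtains z where "norm z = 1" "\<And>w. norm w = 1 \<Longrightarrow> h z + t - y \<bullet> z \<le> h w + t - y \<bullet> w"
proof -
  have "continuous_on (sphere 0 1) (\<lambda>z. h z + t - y \<bullet> z)"
    by (intro continuous_intros h_cont_sphere)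
  then obtain z where "z \<in> sphere 0 1" "\<forall>w\<in>sphere 0 1. h z + t - y \<bullet> z \<le> h w + t - y \<bullet> w"
    using continuous_attains_inf[OF compact_sphere unit_sphere_nonempty] by blast
  then show thesis by (intro that[of z]) simp_all
qed

lemma open_inner_region: "open (inner_region t)"
proof -
  have "open {y. \<forall>z. norm z = 1 \<longrightarrow> y \<bullet> z < h z + t}"
    unfolding open_dist
  proof (intro ballI)
    fix y assume y: "y \<in> {y. \<forall>z. norm z = 1 \<longrightarrow> y \<bullet> z < h z + t}"
    obtain z where z: "norm z = 1" "\<And>w. norm w = 1 \<Longrightarrow> h z + t - y \<bullet> z \<le> h w + t - y \<bullet> w"
      by (rule attains_min_gap[of t y]) (rule that)
    show "\<exists>e>0. \<forall>y'. dist y' y < e \<longrightarrow> y' \<in> {y. \<forall>z. norm z = 1 \<longrightarrow> y \<bullet> z < h z + t}"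
    proof (intro exI[of _ "h z + t - y \<bullet> z"] conjI allI impI)
      show "0 < h z + t - y \<bullet> z" using y z(1) by auto
      fix y' assume d: "dist y' y < h z + t - y \<bullet> z"
      have "y' \<bullet> w < h w + t" if w: "norm w = 1" for w
      proof -
        have "(y' - y) \<bullet> w \<le> norm (y' - y)" using norm_cauchy_schwarz[of "y' - y" w] w by simp
        then show ?thesis using d z(2)[OF w] by (simp add: dist_norm inner_diff_left)
      qed
      then show "y' \<in> {y. \<forall>z. norm z = 1 \<longrightarrow> y \<bullet> z < h z + t}" by simp
    qed
  qed
  then have "open (- {0} \<inter> {y. \<forall>z. norm z = 1 \<longrightarrow> y \<bullet> z < h z + t})"
    by (intro open_Int) auto
  moreover have "- {0} \<inter> {y. \<forall>z. norm z = 1 \<longrightarrow> y \<bullet> z < h z + t} = inner_region t"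
    by (auto simp: inner_region_def)
  ultimately show ?thesis by simp
qed

text \<open>For both \<open>j = 0\<close> and \<open>j = 1\<close> this maps the unit sphere to the boundary of the outer parallel
  body at distance \<open>t\<close> and the punctured unit ball bijectively onto its punctured interior.
  Comparing the two resulting formulas for the volume yields the Minkowski formulas.\<close>

definition Phi :: "nat \<Rightarrow> real \<Rightarrow> real^'d \<Rightarrow> real^'d" where
  "Phi j t x = norm x *\<^sub>R X x + (t * norm x ^ j) *\<^sub>R x"

text \<open>The bodies whose support function on unit vectors is \<open>r h + t r^(j + 1)\<close>
  increase with \<open>r\<close>. This bound places \<open>Phi j t x\<close> in the member with
  \<open>r = norm x\<close>, and \<open>Phi_inner_eq\<close> puts it on the boundary with normal
  \<open>x / norm x\<close>.\<close>

lemma Phi_inner_le: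
  assumes x: "x \<noteq> 0" and w: "norm w = 1" and t: "0 \<le> t"
  shows "Phi j t x \<bullet> w \<le> norm x * h w + t * norm x ^ Suc j"
proof -
  have "w \<noteq> 0" using w by auto
  then have "norm x * (X x \<bullet> w) \<le> norm x * h w" using X_le x by (intro mult_left_mono) auto
  moreover have "(t * norm x ^ j) * (x \<bullet> w) \<le> (t * norm x ^ j) * norm x"
    using norm_cauchy_schwarz[of x w] w t by (intro mult_left_mono) auto
  ultimately show ?thesis by (simp add: Phi_def inner_add_left mult_ac)
qed

lemma X_normalize: "x \<noteq> 0 \<Longrightarrow> X (x /\<^sub>R norm x) = X x"
  by (rule X_scale) simp

lemma h_normalize: "x \<noteq> 0 \<Longrightarrow> h (x /\<^sub>R norm x) = X x \<bullet> (x /\<^sub>R norm x)"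
  using h_eq[of "x /\<^sub>R norm x"] X_normalize by simp

lemma Phi_inner_eq:
  assumes x: "x \<noteq> 0"
  shows "Phi j t x \<bullet> (x /\<^sub>R norm x) = norm x * h (x /\<^sub>R norm x) + t * norm x ^ Suc j"
proof -
  have "x \<bullet> (x /\<^sub>R norm x) = norm x" using x by (simp add: dot_square_norm power2_eq_square)
  then show ?thesis
    unfolding h_normalize[OF x] by (simp only: Phi_def inner_add_left inner_scaleR_left power_Suc mult_ac)
qed

text \<open>The norm of \<open>x\<close> is recovered from the increasing family of bodies. Testing
  with the direction of \<open>x'\<close> then forces equality in the support inequality, so
  \<open>x\<close> and \<open>x'\<close> have the same contact point and hence the same
  direction.\<close>

lemma inj_on_Phi:
  assumes t: "0 \<le> t"
  shows "inj_on (Phi j t) (- {0})"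
proof -
  have le: "norm x \<le> norm x'" if x: "x \<noteq> 0" "x' \<noteq> 0" and eq: "Phi j t x = Phi j t x'" for x x'
  proof (rule ccontr)
    assume "\<not> norm x \<le> norm x'"
    then have lt: "norm x' < norm x" by simp
    let ?z = "x /\<^sub>R norm x"
    have z: "norm ?z = 1" "?z \<noteq> 0" using x(1) by auto
    have "norm x * h ?z + t * norm x ^ Suc j \<le> norm x' * h ?z + t * norm x' ^ Suc j"
      using Phi_inner_eq[OF x(1), of j t] Phi_inner_le[OF x(2) z(1) t, of j] eq by simp
    moreover have "t * norm x' ^ Suc j \<le> t * norm x ^ Suc j"
      using lt t by (intro mult_left_mono power_mono) auto
    moreover have "norm x' * h ?z < norm x * h ?z" using lt h_pos[OF z(2)] by simp
    ultimately show False by linarith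
  qed
  show ?thesis
  proof (rule inj_onI)
    fix x x' assume "x \<in> - {0}" "x' \<in> - {0}" and eq: "Phi j t x = Phi j t x'"
    then have x: "x \<noteq> 0" "x' \<noteq> 0" by auto
    have n: "norm x = norm x'" using le[OF x eq] le[OF x(2,1) eq[symmetric]] by simp
    let ?z = "x' /\<^sub>R norm x'"
    have z: "norm ?z = 1" "?z \<noteq> 0" using x(2) by auto
    have "Phi j t x \<bullet> ?z = norm x' * h ?z + t * norm x' ^ Suc j"
      using Phi_inner_eq[OF x(2), of j t] eq by simp
    moreover have "(t * norm x ^ j) * (x \<bullet> ?z) \<le> (t * norm x ^ j) * norm x"
      using norm_cauchy_schwarz[of x ?z] z(1) t by (intro mult_left_mono) auto
    moreover have "Phi j t x \<bullet> ?z = norm x * (X x \<bullet> ?z) + (t * norm x ^ j) * (x \<bullet> ?z)"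
      by (simp only: Phi_def inner_add_left inner_scaleR_left)
    moreover have "(t * norm x ^ j) * norm x = t * norm x' ^ Suc j" by (simp add: n)
    ultimately have "norm x' * h ?z \<le> norm x * (X x \<bullet> ?z)" by linarith
    then have "norm x' * h ?z \<le> norm x' * (X x \<bullet> ?z)" by (simp only: n)
    then have "h ?z \<le> X x \<bullet> ?z" by (rule mult_left_le_imp_le) (use x(2) in simp)
    then have "X x \<bullet> ?z = h ?z" using X_le[OF z(2) x(1)] by simp
    then have "X x = X ?z" by (rule X_eqI[OF z(2) x(1)])
    then have "X (x /\<^sub>R norm x) = X ?z" using X_normalize[OF x(1)] by simp
    then have "x /\<^sub>R norm x = ?z"
      by (rule inj_onD[OF X_inj]) (use x in auto)
    then show "x = x'" using n x by simp
  qed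
qed

text \<open>For surjectivity, the smallest body of the increasing family that contains
  \<open>y\<close> has \<open>y\<close> on its boundary, with some normal \<open>z\<close>. If
  \<open>r\<close> is its parameter, then \<open>y\<close> is the image of
  \<open>r z\<close>.\<close>

lemma Phi_image:
  assumes t: "0 \<le> t"
  shows "Phi j t ` (ball 0 1 - {0}) = inner_region t"
proof
  show "Phi j t ` (ball 0 1 - {0}) \<subseteq> inner_region t"
  proof (rule image_subsetI)
    fix x :: "real^'d" assume "x \<in> ball 0 1 - {0}"
    then have x: "x \<noteq> 0" "norm x < 1" by auto
    have "Phi j t x \<bullet> w < h w + t" if w: "norm w = 1" for w
    proof -
      have "w \<noteq> 0" using w by auto
      then have "norm x * h w < 1 * h w" using x h_pos by (intro mult_strict_right_mono) auto
      moreover have "t * norm x ^ Suc j \<le> t * 1"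
        using x t by (intro mult_left_mono power_le_one) auto
      ultimately show ?thesis using Phi_inner_le[OF x(1) w t, of j] by linarith
    qed
    moreover have "Phi j t x \<noteq> 0"
    proof
      assume "Phi j t x = 0"
      then have "norm x * h (x /\<^sub>R norm x) + t * norm x ^ Suc j = 0"
        using Phi_inner_eq[OF x(1), of j t] by simp
      moreover have "0 < norm x * h (x /\<^sub>R norm x)" using x h_pos[of "x /\<^sub>R norm x"] by simp
      moreover have "0 \<le> t * norm x ^ Suc j" using t by simp
      ultimately show False by linarith
    qed
    ultimately show "Phi j t x \<in> inner_region t" by (simp add: inner_region_def)
  qed
  show "inner_region t \<subseteq> Phi j t ` (ball 0 1 - {0})"
  proof
    fix y assume "y \<in> inner_region t"
    then have y: "y \<noteq> 0" "\<And>z. norm z = 1 \<Longrightarrow> y \<bullet> z < h z + t" by (auto simp: inner_region_def)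
    let ?D = "{0..1 :: real} \<times> sphere (0 :: real^'d) 1"
    let ?f = "\<lambda>p. y \<bullet> snd p - fst p * h (snd p) - t * fst p ^ Suc j"
    have fc: "continuous_on ?D ?f"
      by (intro continuous_intros continuous_on_compose2[OF h_cont_sphere]) auto
    \<comment> \<open>Pairs of a parameter and a direction in which \<open>y\<close> does not lie
      strictly inside the corresponding body. The largest such parameter belongs to the smallest
      body containing \<open>y\<close>.\<close>
    define C where "C = ?D \<inter> ?f -` {0..}"
    have "compact C"
    proof -
      have "closedin (top_of_set ?D) C" unfolding C_def by (rule continuous_closedin_preimage[OF fc]) simp
      then show ?thesis by (rule closedin_compact[rotated]) (intro compact_Times compact_Icc compact_sphere)
    qed
    moreover have "C \<noteq> {}"
    proof -
      have "(0, y /\<^sub>R norm y) \<in> C" using y(1) by (simp add: C_def)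
      then show ?thesis by blast
    qed
    ultimately obtain p where p: "p \<in> C" "\<forall>q\<in>C. fst q \<le> fst p"
      using continuous_attains_sup[of C fst] continuous_on_fst[OF continuous_on_id] by blast
    obtain r z where rz: "p = (r, z)" by (cases p)
    have r: "0 \<le> r" "r \<le> 1" and z: "norm z = 1" and ge: "r * h z + t * r ^ Suc j \<le> y \<bullet> z"
      using p(1) by (auto simp: rz C_def)
    have z0: "z \<noteq> 0" using z by auto
    have "r \<noteq> 1" using ge y(2)[OF z] by auto
    then have r1: "r < 1" using r by simp
    have le: "y \<bullet> w \<le> r * h w + t * r ^ Suc j" if w: "norm w = 1" for w
    proof (rule ccontr)
      assume neg: "\<not> ?thesis"
      let ?g = "\<lambda>a. y \<bullet> w - a * h w - t * a ^ Suc j"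
      have "?g 1 \<le> 0" "0 \<le> ?g r" using y(2)[OF w] neg by auto
      moreover have "continuous_on {r..1} ?g" by (intro continuous_intros)
      ultimately obtain a where a: "r \<le> a" "a \<le> 1" "?g a = 0"
        using IVT2'[of ?g 1 0 r] r by auto
      have "(a, w) \<in> C" using a r w by (auto simp: C_def)
      then have "a \<le> r" using p(2) rz by auto
      then show False using a neg by auto
    qed
    have rpos: "0 < r"
    proof (rule ccontr)
      assume "\<not> 0 < r"
      then have "r = 0" using r by simp
      then have "y \<bullet> (y /\<^sub>R norm y) \<le> 0" using le[of "y /\<^sub>R norm y"] y(1) by simp
      moreover have "y \<bullet> (y /\<^sub>R norm y) = norm y" using y(1) by (simp add: dot_square_norm power2_eq_square)
      ultimately show False using y(1) by simp
    qed
    \<comment> \<open>The gap in the support inequality, extended to degree one, has a minimum at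
      \<open>z\<close>; its vanishing gradient is the equation
      \<open>y = Phi j t (r z)\<close>.\<close>
    let ?F = "\<lambda>x. r * h x + (t * r ^ Suc j) * norm x - y \<bullet> x"
    have F0: "?F z = 0" using le[OF z] ge z by simp
    have Fnn: "0 \<le> ?F x" if x: "x \<noteq> 0" for x
    proof -
      have hx: "h x = norm x * h (x /\<^sub>R norm x)"
        using h_scale[of "norm x" "x /\<^sub>R norm x"] x by simp
      have yx: "y \<bullet> x = norm x * (y \<bullet> (x /\<^sub>R norm x))" using x by simp
      have "norm x * (y \<bullet> (x /\<^sub>R norm x)) \<le> norm x * (r * h (x /\<^sub>R norm x) + t * r ^ Suc j)"
        using le[of "x /\<^sub>R norm x"] x by (intro mult_left_mono) auto
      then show ?thesis unfolding hx yx by (simp add: algebra_simps)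
    qed
    have "(?F has_derivative (\<lambda>v. r * (X z \<bullet> v) + (t * r ^ Suc j) * (v \<bullet> sgn z) - y \<bullet> v)) (at z)"
      by (intro has_derivative_diff has_derivative_add has_derivative_mult_right h_deriv[OF z0]
          has_derivative_norm[OF z0] bounded_linear.has_derivative[OF bounded_linear_inner_right] has_derivative_ident)
    then have "(\<lambda>v. r * (X z \<bullet> v) + (t * r ^ Suc j) * (v \<bullet> sgn z) - y \<bullet> v) = (\<lambda>v. 0)"
      by (rule differential_zero_maxmin[of z "- {0}", rotated 2]) (use z0 F0 Fnn in \<open>auto simp: open_Compl\<close>)
    then have all: "r * (X z \<bullet> v) + (t * r ^ Suc j) * (v \<bullet> sgn z) - y \<bullet> v = 0" for v by metis
    have "(r *\<^sub>R X z + (t * r ^ Suc j) *\<^sub>R z - y) \<bullet> v = 0" for v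
      using all[of v] z by (simp add: inner_diff_left inner_add_left inner_diff_right inner_add_right inner_commute sgn_div_norm)
    then have "r *\<^sub>R X z + (t * r ^ Suc j) *\<^sub>R z - y = 0" using inner_eq_zero_iff by blast
    then have "y = Phi j t (r *\<^sub>R z)"
      using rpos z by (simp add: Phi_def X_scale mult_ac)
    moreover have "r *\<^sub>R z \<in> ball 0 1 - {0}" using rpos r1 z z0 by simp
    ultimately show "y \<in> Phi j t ` (ball 0 1 - {0})" by blast
  qed
qed

text \<open>The Jacobian of \<open>Phi j t\<close>. The \<open>j + 1\<close> in the radial factor
  comes from differentiating \<open>t \<rho>^(j + 1)\<close>. The other factor is the product of the
  \<open>ev x ! i + t \<rho>^j\<close> with \<open>\<rho> = norm x\<close>, expanded in powers of
  \<open>t\<close> for a comparison of coefficients.\<close>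

definition jac :: "nat \<Rightarrow> real \<Rightarrow> real^'d \<Rightarrow> real" where
  "jac j t x = (u x + (real j + 1) * t * norm x ^ j) * (\<Sum>m\<le>n. E (n - m) x * (t * norm x ^ j) ^ m)"

lemma Phi_has_derivative:
  assumes x: "x \<noteq> 0"
  obtains D where "(Phi j t has_derivative D) (at x)" "det (matrix D) = jac j t x"
proof -
  let ?z = "x /\<^sub>R norm x"
  define p where "p = X x + (real j * t * norm x ^ j + t * norm x ^ j) *\<^sub>R ?z"
  define D where "D v = (?z \<bullet> v) *\<^sub>R p + norm x *\<^sub>R A x v + (t * norm x ^ j) *\<^sub>R (v - (?z \<bullet> v) *\<^sub>R ?z)" for v
  have n1: "((\<lambda>y. norm y *\<^sub>R X y) has_derivative (\<lambda>v. norm x *\<^sub>R A x v + (v \<bullet> sgn x) *\<^sub>R X x)) (at x)"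
    by (rule has_derivative_scaleR[OF has_derivative_norm[OF x] X_deriv[OF x]])
  have "((\<lambda>y. norm y ^ j) has_derivative (\<lambda>v. real j * (v \<bullet> sgn x) * norm x ^ (j - 1))) (at x)"
    using has_derivative_power[OF has_derivative_norm[OF x], of j] by simp
  then have "((\<lambda>y. t * norm y ^ j) has_derivative (\<lambda>v. t * (real j * (v \<bullet> sgn x) * norm x ^ (j - 1)))) (at x)"
    by (rule has_derivative_mult_right)
  then have n2: "((\<lambda>y. (t * norm y ^ j) *\<^sub>R y) has_derivative
      (\<lambda>v. (t * norm x ^ j) *\<^sub>R v + (t * (real j * (v \<bullet> sgn x) * norm x ^ (j - 1))) *\<^sub>R x)) (at x)"
    by (rule has_derivative_scaleR[OF _ has_derivative_ident])
  have eq: "norm x *\<^sub>R A x v + (v \<bullet> sgn x) *\<^sub>R X x + ((t * norm x ^ j) *\<^sub>R v + (t * (real j * (v \<bullet> sgn x) * norm x ^ (j - 1))) *\<^sub>R x)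
      = D v" for v
  proof -
    have s: "v \<bullet> sgn x = ?z \<bullet> v" by (simp add: sgn_div_norm inner_commute)
    \<comment> \<open>For \<open>j = 0\<close> the truncated exponent \<open>j - 1\<close> does no
      harm, since the factor \<open>real j\<close> vanishes.\<close>
    have "(t * (real j * (?z \<bullet> v) * norm x ^ (j - 1))) *\<^sub>R x = ((?z \<bullet> v) * (real j * t * norm x ^ j)) *\<^sub>R ?z"
    proof (cases j)
      case (Suc i)
      then show ?thesis using x by simp
    qed simp
    then show ?thesis unfolding s D_def p_def by (simp add: algebra_simps)
  qed
  have "(Phi j t has_derivative D) (at x)"
    unfolding Phi_def[abs_def] using has_derivative_add[OF n1 n2] by (simp only: eq)
  moreover have "det (matrix D) = jac j t x"
  proof -
    have zz: "?z \<bullet> ?z = 1" using x by (simp add: dot_square_norm power2_eq_square)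
    have "X x \<bullet> ?z = u x" using x by (simp add: u_def h_eq divide_inverse mult.commute)
    then have pz: "p \<bullet> ?z = u x + (real j + 1) * t * norm x ^ j"
      unfolding p_def inner_add_left inner_scaleR_left[of _ ?z ?z] zz by (simp add: algebra_simps)
    have "det (matrix D) = (p \<bullet> ?z) * (\<Prod>i<n. norm x * (ev x ! i) / norm x + t * norm x ^ j)"
      by (rule det_radial[OF x]) (simp add: D_def)
    also have "(\<Prod>i<n. norm x * (ev x ! i) / norm x + t * norm x ^ j) = (\<Sum>m\<le>n. E (n - m) x * (t * norm x ^ j) ^ m)"
      using x by (simp add: prod_ev_polynomial[symmetric])
    finally show ?thesis by (simp only: pz jac_def)
  qed
  ultimately show thesis by (rule that)
qed

lemma jac_nonneg: "0 \<le> t \<Longrightarrow> 0 \<le> jac j t x"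
  unfolding jac_def by (intro mult_nonneg_nonneg add_nonneg_nonneg sum_nonneg u_nonneg E_nonneg zero_le_power) auto

lemma jac_measurable [measurable]: "jac j t \<in> borel_measurable borel"
  unfolding jac_def[abs_def] by measurable

lemma jac_bounded:
  assumes t: "0 \<le> t"
  obtains C where "\<And>x. norm x < 1 \<Longrightarrow> \<bar>jac j t x\<bar> \<le> C"
proof -
  obtain C where C: "0 < C" "\<And>x. u x \<le> C" "\<And>x k. k \<le> n \<Longrightarrow> E k x \<le> C" using bounds by metis
  have "\<bar>jac j t x\<bar> \<le> (C + (real j + 1) * t) * (\<Sum>m\<le>n. C * t ^ m)" if x: "norm x < 1" for x
  proof -
    have "norm x ^ j \<le> 1" using x by (intro power_le_one) auto
    then have tp: "t * norm x ^ j \<le> t" using t by (simp add: mult_left_le)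
    have "jac j t x \<le> (C + (real j + 1) * t) * (\<Sum>m\<le>n. C * t ^ m)"
      unfolding jac_def
    proof (rule mult_mono)
      have "(real j + 1) * (t * norm x ^ j) \<le> (real j + 1) * t" using tp by (intro mult_left_mono) auto
      then show "u x + (real j + 1) * t * norm x ^ j \<le> C + (real j + 1) * t"
        using C(2)[of x] by (simp only: mult.assoc)
      show "(\<Sum>m\<le>n. E (n - m) x * (t * norm x ^ j) ^ m) \<le> (\<Sum>m\<le>n. C * t ^ m)"
        using C tp t by (intro sum_mono mult_mono power_mono) (auto intro: less_imp_le)
      show "0 \<le> C + (real j + 1) * t" using C(1) t by (simp add: add_nonneg_nonneg)
      show "0 \<le> (\<Sum>m\<le>n. E (n - m) x * (t * norm x ^ j) ^ m)"
        using t E_nonneg by (intro sum_nonneg mult_nonneg_nonneg zero_le_power) auto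
    qed
    then show ?thesis using jac_nonneg[OF t, of j x] by simp
  qed
  then show thesis by (rule that)
qed

text \<open>The left side does not mention \<open>j\<close>, so both parametrizations give the same
  volume.\<close>

lemma volume_inner_region:
  assumes t: "0 \<le> t"
  shows "emeasure lborel (inner_region t) = ennreal (ball_integral (jac j t))"
proof -
  let ?S = "ball (0 :: real^'d) 1 - {0}"
  have "\<exists>D. (Phi j t has_derivative D) (at x) \<and> det (matrix D) = jac j t x" if "x \<noteq> 0" for x
    by (rule Phi_has_derivative[OF that]) blast
  then obtain D where D: "\<And>x. x \<noteq> 0 \<Longrightarrow> (Phi j t has_derivative D x) (at x) \<and> det (matrix (D x)) = jac j t x" by metis
  have "emeasure lborel (inner_region t) = (\<integral>\<^sup>+x\<in>?S. ennreal (jac j t x) \<partial>lborel)"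
  proof (rule emeasure_injective_image_eq[where f = "Phi j t" and f' = D])
    show "inj_on (Phi j t) ?S" using inj_on_Phi[OF t] by (rule inj_on_subset) auto
    show "Phi j t ` ?S = inner_region t" by (rule Phi_image[OF t])
    show "(Phi j t has_derivative D x) (at x within ?S)" if "x \<in> ?S" for x
      using D[of x] that by (auto intro: has_derivative_at_withinI)
    show "jac j t x = \<bar>det (matrix (D x))\<bar>" if "x \<in> ?S" for x
      using D[of x] that jac_nonneg[OF t, of j x] by auto
  qed (auto simp: open_inner_region)
  also have "\<dots> = (\<integral>\<^sup>+x\<in>ball 0 1. ennreal (jac j t x) \<partial>lborel)"
    by (rule nn_integral_cong_AE, use AE_lborel_singleton[of "0 :: real^'d"] in eventually_elim) (auto simp: indicator_def)
  also have "\<dots> = ennreal (ball_integral (jac j t))"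
  proof (rule jac_bounded[OF t])
    fix C assume "\<And>x. norm x < 1 \<Longrightarrow> \<bar>jac j t x\<bar> \<le> C"
    then show ?thesis by (intro nn_integral_ball) (auto intro: jac_nonneg[OF t])
  qed
  finally show ?thesis .
qed

end

lemma ball_integral_add:
  assumes "f \<in> borel_measurable borel" "\<And>x. norm x < 1 \<Longrightarrow> \<bar>f x\<bar> \<le> C"
    and "g \<in> borel_measurable borel" "\<And>x. norm x < 1 \<Longrightarrow> \<bar>g x\<bar> \<le> D"
  shows "ball_integral (\<lambda>x. f x + g x) = ball_integral f + ball_integral g"
  unfolding ball_integral_def distrib_left
  by (rule Bochner_Integration.integral_add[OF ball_integrable[OF assms(1,2)] ball_integrable[OF assms(3,4)]])

lemma ball_integral_sum:
  assumes "\<And>i. i \<in> I \<Longrightarrow> f i \<in> borel_measurable borel" "\<And>i x. i \<in> I \<Longrightarrow> norm x < 1 \<Longrightarrow> \<bar>f i x\<bar> \<le> C i"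
  shows "ball_integral (\<lambda>x. \<Sum>i\<in>I. f i x) = (\<Sum>i\<in>I. ball_integral (f i))"
  unfolding ball_integral_def sum_distrib_left
  by (rule Bochner_Integration.integral_sum) (rule ball_integrable[OF assms])

lemma ball_integral_cmult: "ball_integral (\<lambda>x. c * f x) = c * ball_integral f"
  unfolding ball_integral_def by (simp add: mult.left_commute)

lemma ball_integral_mono:
  assumes "f \<in> borel_measurable borel" "\<And>x. norm x < 1 \<Longrightarrow> \<bar>f x\<bar> \<le> C"
    and "g \<in> borel_measurable borel" "\<And>x. norm x < 1 \<Longrightarrow> \<bar>g x\<bar> \<le> D"
    and "\<And>x. f x \<le> g x"
  shows "ball_integral f \<le> ball_integral g"
  unfolding ball_integral_def using assms(5)
  by (intro integral_mono ball_integrable[OF assms(1,2)] ball_integrable[OF assms(3,4)] mult_left_mono) auto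

section \<open>Integral formulas for the symmetric functions\<close>

context support_gradient
begin

lemma DIM_eq: "DIM(real^'d) = n + 1" using dim by simp

lemma uE_bounded:
  obtains C where "0 < C" "\<And>x k. k \<le> n \<Longrightarrow> \<bar>E k x\<bar> \<le> C" "\<And>x k. k \<le> n \<Longrightarrow> \<bar>u x * E k x\<bar> \<le> C * C"
    "\<And>x k. k \<le> n \<Longrightarrow> \<bar>ev_sum x * E k x\<bar> \<le> C * C"
proof (rule bounds)
  fix C assume C: "0 < C" "\<And>x. u x \<le> C" "\<And>x. ev_sum x \<le> C" "\<And>x k. k \<le> n \<Longrightarrow> E k x \<le> C"
  show thesis
  proof (rule that[OF C(1)])
    show "\<bar>E k x\<bar> \<le> C" if "k \<le> n" for x k using C(4)[OF that] E_nonneg by simp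
    show "\<bar>u x * E k x\<bar> \<le> C * C" if "k \<le> n" for x k
      using C(1,2) C(4)[OF that] E_nonneg u_nonneg by (simp add: abs_mult mult_mono)
    show "\<bar>ev_sum x * E k x\<bar> \<le> C * C" if "k \<le> n" for x k
      using C(1,3) C(4)[OF that] E_nonneg ev_sum_nonneg by (simp add: abs_mult mult_mono)
  qed
qed

lemma ball_integral_jac:
  "ball_integral (jac j t) =
    (\<Sum>m\<le>n. t ^ m * (DIM(real^'d) / (DIM(real^'d) + j * m) * ball_integral (\<lambda>x. u x * E (n - m) x))) +
    (\<Sum>m\<le>n. (real j + 1) * t ^ Suc m * (DIM(real^'d) / (DIM(real^'d) + j * Suc m) * ball_integral (E (n - m))))"
proof (rule uE_bounded)
  fix C assume C: "0 < C" "\<And>x k. k \<le> n \<Longrightarrow> \<bar>E k x\<bar> \<le> C" "\<And>x k. k \<le> n \<Longrightarrow> \<bar>u x * E k x\<bar> \<le> C * C"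
  have pw: "\<bar>c * (norm x ^ i * g x)\<bar> \<le> \<bar>c\<bar> * B" if "norm x < 1" "\<bar>g x\<bar> \<le> B" for c B i and g :: "real^'d \<Rightarrow> real" and x
  proof -
    have "norm x ^ i \<le> 1" using that by (intro power_le_one) auto
    then have "norm x ^ i * \<bar>g x\<bar> \<le> 1 * B" using that by (intro mult_mono) auto
    then show ?thesis by (simp add: abs_mult mult_left_mono)
  qed
  let ?a = "\<lambda>m x. t ^ m * (norm x ^ (j * m) * (u x * E (n - m) x))"
  let ?b = "\<lambda>m x. ((real j + 1) * t ^ Suc m) * (norm x ^ (j * Suc m) * E (n - m) x)"
  have aB: "\<bar>?a m x\<bar> \<le> \<bar>t ^ m\<bar> * (C * C)" if "norm x < 1" for m x
    using pw[where g = "\<lambda>x. u x * E (n - m) x", OF that C(3)] by simp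
  have bB: "\<bar>?b m x\<bar> \<le> \<bar>(real j + 1) * t ^ Suc m\<bar> * C" if "norm x < 1" for m x
    using pw[where g = "E (n - m)", OF that C(2)] by simp
  have am: "?a m \<in> borel_measurable borel" and bm: "?b m \<in> borel_measurable borel" for m
    by measurable
  have ia: "ball_integral (?a m) = t ^ m * (DIM(real^'d) / (DIM(real^'d) + j * m) * ball_integral (\<lambda>x. u x * E (n - m) x))" for m
    unfolding ball_integral_cmult
    by (subst ball_integral_power[where C = "C * C"]) (use C(3) u_nonneg E_nonneg in \<open>auto simp: u_scale E_scale\<close>)
  have ib: "ball_integral (?b m) = (real j + 1) * t ^ Suc m * (DIM(real^'d) / (DIM(real^'d) + j * Suc m) * ball_integral (E (n - m)))" for m
    unfolding ball_integral_cmult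
    by (subst ball_integral_power[where C = C]) (use C(2) E_nonneg in \<open>auto simp: E_scale\<close>)
  have "jac j t = (\<lambda>x. (\<Sum>m\<le>n. ?a m x) + (\<Sum>m\<le>n. ?b m x))"
  proof
    fix x :: "real^'d"
    have "(t * norm x ^ j) ^ m = t ^ m * norm x ^ (j * m)" for m
      by (simp add: power_mult_distrib power_mult)
    then have "jac j t x = (u x + (real j + 1) * t * norm x ^ j) * (\<Sum>m\<le>n. E (n - m) x * (t ^ m * norm x ^ (j * m)))"
      by (simp only: jac_def)
    also have "\<dots> = (\<Sum>m\<le>n. ?a m x) + (\<Sum>m\<le>n. ?b m x)"
    proof -
      let ?S = "\<Sum>m\<le>n. E (n - m) x * (t ^ m * norm x ^ (j * m))"
      have "u x * ?S = (\<Sum>m\<le>n. ?a m x)"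
        unfolding sum_distrib_left by (intro sum.cong refl) (simp only: mult_ac)
      moreover have "((real j + 1) * t * norm x ^ j) * ?S = (\<Sum>m\<le>n. ?b m x)"
        unfolding sum_distrib_left by (intro sum.cong refl) (simp only: power_add power_Suc mult_Suc_right mult_ac)
      ultimately show ?thesis by (simp only: distrib_right)
    qed
    finally show "jac j t x = (\<Sum>m\<le>n. ?a m x) + (\<Sum>m\<le>n. ?b m x)" .
  qed
  then have "ball_integral (jac j t) = ball_integral (\<lambda>x. (\<Sum>m\<le>n. ?a m x) + (\<Sum>m\<le>n. ?b m x))" by simp
  also have "\<dots> = ball_integral (\<lambda>x. \<Sum>m\<le>n. ?a m x) + ball_integral (\<lambda>x. \<Sum>m\<le>n. ?b m x)"
  proof (rule ball_integral_add)
    show "\<bar>\<Sum>m\<le>n. ?a m x\<bar> \<le> (\<Sum>m\<le>n. \<bar>t ^ m\<bar> * (C * C))" if "norm x < 1" for x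
      by (rule order_trans[OF sum_abs]) (intro sum_mono aB that)
    show "\<bar>\<Sum>m\<le>n. ?b m x\<bar> \<le> (\<Sum>m\<le>n. \<bar>(real j + 1) * t ^ Suc m\<bar> * C)" if "norm x < 1" for x
      by (rule order_trans[OF sum_abs]) (intro sum_mono bB that)
  qed (intro borel_measurable_sum am bm)+
  also have "ball_integral (\<lambda>x. \<Sum>m\<le>n. ?a m x) = (\<Sum>m\<le>n. ball_integral (?a m))"
    by (rule ball_integral_sum[OF am aB])
  also have "ball_integral (\<lambda>x. \<Sum>m\<le>n. ?b m x) = (\<Sum>m\<le>n. ball_integral (?b m))"
    by (rule ball_integral_sum[OF bm bB])
  finally show ?thesis by (simp only: ia ib)
qed

text \<open>The volume polynomials for \<open>j = 0\<close> and \<open>j = 1\<close> agree at all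
  positive \<open>t\<close>, hence in each coefficient. That of \<open>t^(n - k)\<close> links the
  integrals of \<open>u E_k\<close> and \<open>E_(k+1)\<close>, and the dimension
  \<open>n + 1\<close> turns its constants into \<open>n - k\<close> and
  \<open>k + 1\<close>.\<close>

lemma minkowski_formula:
  assumes k: "k < n"
  shows "real (n - k) * ball_integral (\<lambda>x. u x * E k x) = real (k + 1) * ball_integral (E (k + 1))"
proof -
  define a where "a i = ball_integral (\<lambda>x. u x * E i x)" for i
  define b where "b i = ball_integral (E i)" for i
  \<comment> \<open>The coefficient of \<open>t^m\<close> in the difference of the two polynomials.
    The terms with \<open>u\<close> have degrees \<open>0\<close> to \<open>n\<close>; those without
    are shifted up by one, and their factor \<open>2\<close> is \<open>j + 1\<close> for
    \<open>j = 1\<close>.\<close>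
  define c where "c m = (if m \<le> n then (1 - DIM(real^'d) / (DIM(real^'d) + m)) * a (n - m) else 0) +
    (if m = 0 then 0 else (1 - 2 * DIM(real^'d) / (DIM(real^'d) + m)) * b (Suc n - m))" for m
  have "c (n - k) = 0"
  proof (rule polynomial_zero_on_pos)
    fix t :: real assume t: "0 < t"
    have "ennreal (ball_integral (jac 0 t)) = ennreal (ball_integral (jac 1 t))"
      using volume_inner_region[of t 0] volume_inner_region[of t 1] t by simp
    moreover have "0 \<le> ball_integral (jac i t)" for i
      unfolding ball_integral_def using jac_nonneg t by (intro integral_nonneg_AE AE_I2 mult_nonneg_nonneg) auto
    ultimately have eq: "ball_integral (jac 0 t) = ball_integral (jac 1 t)" by simp
    have "(\<Sum>m\<le>Suc n. c m * t ^ m) =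
      (\<Sum>m\<le>Suc n. (if m \<le> n then (1 - DIM(real^'d) / (DIM(real^'d) + m)) * a (n - m) else 0) * t ^ m) +
      (\<Sum>m\<le>Suc n. (if m = 0 then 0 else (1 - 2 * DIM(real^'d) / (DIM(real^'d) + m)) * b (Suc n - m)) * t ^ m)"
      unfolding c_def distrib_right by (rule sum.distrib)
    also have "(\<Sum>m\<le>Suc n. (if m \<le> n then (1 - DIM(real^'d) / (DIM(real^'d) + m)) * a (n - m) else 0) * t ^ m) =
      (\<Sum>m\<le>n. (1 - DIM(real^'d) / (DIM(real^'d) + m)) * a (n - m) * t ^ m)"
      by simp
    also have "(\<Sum>m\<le>Suc n. (if m = 0 then 0 else (1 - 2 * DIM(real^'d) / (DIM(real^'d) + m)) * b (Suc n - m)) * t ^ m) =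
      (\<Sum>m\<le>n. (1 - 2 * DIM(real^'d) / (DIM(real^'d) + Suc m)) * b (n - m) * t ^ Suc m)"
      by (subst sum.atMost_Suc_shift) simp
    also have "(\<Sum>m\<le>n. (1 - DIM(real^'d) / (DIM(real^'d) + m)) * a (n - m) * t ^ m) + (\<Sum>m\<le>n. (1 - 2 * DIM(real^'d) / (DIM(real^'d) + Suc m)) * b (n - m) * t ^ Suc m)
      = ball_integral (jac 0 t) - ball_integral (jac 1 t)"
      unfolding ball_integral_jac a_def[symmetric] b_def[symmetric] sum.distrib[symmetric] sum_subtractf[symmetric]
      by (intro sum.cong refl) (simp add: algebra_simps)
    finally show "(\<Sum>m\<le>Suc n. c m * t ^ m) = 0" using eq by simp
  qed (use k in simp)
  moreover have "c (n - k) = (1 - DIM(real^'d) / (DIM(real^'d) + (n - k))) * a k + (1 - 2 * DIM(real^'d) / (DIM(real^'d) + (n - k))) * b (k + 1)"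
    using k by (simp add: c_def Suc_diff_le)
  moreover define d where "d = real DIM(real^'d) + real (n - k)"
  moreover have d: "0 < d" "real DIM(real^'d) = d - real (n - k)" by (auto simp: d_def add_pos_nonneg)
  ultimately have "(1 - DIM(real^'d) / d) * a k + (1 - 2 * DIM(real^'d) / d) * b (k + 1) = 0" by simp
  then have "d * ((1 - DIM(real^'d) / d) * a k + (1 - 2 * DIM(real^'d) / d) * b (k + 1)) = 0" by simp
  moreover have "d * (1 - x / d) = d - x" for x using d(1) by (simp add: right_diff_distrib)
  ultimately have "(d - DIM(real^'d)) * a k + (d - 2 * DIM(real^'d)) * b (k + 1) = 0"
    unfolding distrib_left mult.assoc[symmetric] by metis
  moreover have "d - DIM(real^'d) = real (n - k)" "d - 2 * DIM(real^'d) = - real (k + 1)"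
    using k DIM_eq by (auto simp: d_def)
  ultimately have "real (n - k) * a k + - real (k + 1) * b (k + 1) = 0" by metis
  then show ?thesis unfolding a_def b_def by linarith
qed

text \<open>The vectors \<open>s z\<close> for which all principal radii at the unit vector
  \<open>z\<close> are at least \<open>s\<close>: across the radial direction, \<open>A x\<close>
  has the radii divided by \<open>s\<close> as eigenvalues. Quadratic forms are used so that each
  \<open>v\<close> gives a relatively closed condition.\<close>

definition Omega :: "(real^'d) set" where
  "Omega = {x. x \<noteq> 0 \<and> (\<forall>v. v \<bullet> v - (x \<bullet> v)\<^sup>2 / (x \<bullet> x) \<le> A x v \<bullet> v)}"

lemma Omega_borel: "Omega \<in> sets borel"
proof -
  have "closedin (top_of_set (- {0})) (\<Inter>v. {x \<in> - {0}. A x v \<bullet> v - (v \<bullet> v - (x \<bullet> v)\<^sup>2 / (x \<bullet> x)) \<in> {0..}})"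
  proof (rule closedin_INT)
    fix v
    have "closedin (top_of_set (- {0})) (- {0} \<inter> (\<lambda>x. A x v \<bullet> v - (v \<bullet> v - (x \<bullet> v)\<^sup>2 / (x \<bullet> x))) -` {0..})"
      by (rule continuous_closedin_preimage) (auto intro!: continuous_intros A_cont)
    then show "closedin (top_of_set (- {0})) {x \<in> - {0}. A x v \<bullet> v - (v \<bullet> v - (x \<bullet> v)\<^sup>2 / (x \<bullet> x)) \<in> {0..}}"
      by (simp only: vimage_def Int_def mem_Collect_eq)
  qed auto
  moreover have "(\<Inter>v. {x \<in> - {0}. A x v \<bullet> v - (v \<bullet> v - (x \<bullet> v)\<^sup>2 / (x \<bullet> x)) \<in> {0..}}) = Omega"
    by (auto simp: Omega_def)
  ultimately obtain T where "closed T" "Omega = - {0} \<inter> T"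
    by (auto simp: closedin_closed)
  then show ?thesis by auto
qed

lemma Omega_ev:
  assumes "x \<in> Omega" "i < n"
  shows "norm x \<le> ev x ! i"
proof -
  have x: "x \<noteq> 0" using assms(1) by (simp add: Omega_def)
  show ?thesis
  proof (rule ev_eigenbasis[OF x])
    fix es assume es: "orthonormal_list (x /\<^sub>R norm x # es)" "length es = n"
      "ev x = map (\<lambda>e. norm x * (A x e \<bullet> e)) es"
    let ?e = "es ! i"
    have e: "?e \<in> set es" using assms(2) es(2) by simp
    then have ee: "?e \<bullet> ?e = 1" using es(1) by (simp add: orthonormal_list_def norm_eq_1)
    have "x /\<^sub>R norm x \<noteq> ?e" using e es(1) by (auto simp: orthonormal_list_def)
    then have "(x /\<^sub>R norm x) \<bullet> ?e = 0"
      using orthonormal_list_inner[OF es(1), of "x /\<^sub>R norm x" ?e] e by simp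
    then have "x \<bullet> ?e = 0" using x by simp
    moreover have "?e \<bullet> ?e - (x \<bullet> ?e)\<^sup>2 / (x \<bullet> x) \<le> A x ?e \<bullet> ?e" using assms(1) by (simp add: Omega_def)
    ultimately have "1 \<le> A x ?e \<bullet> ?e" using ee by simp
    then have "norm x * 1 \<le> norm x * (A x ?e \<bullet> ?e)" by (rule mult_left_mono) simp
    then show ?thesis using assms(2) es(2) by (simp add: es(3))
  qed
qed

text \<open>A point \<open>y\<close> at distance \<open>s\<close> from the boundary is \<open>X z - s z\<close> for a unit vector \<open>z\<close>, and the
  second order condition at the minimum of \<open>h - s norm - y\<close> bounds the principal radii at \<open>z\<close> below by \<open>s\<close>.\<close>

lemma inner_region_subset_normal_image: "inner_region 0 \<subseteq> (\<lambda>x. X x - x) ` Omega"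
proof
  fix y assume "y \<in> inner_region 0"
  then have y: "\<And>z. norm z = 1 \<Longrightarrow> y \<bullet> z < h z" by (simp add: inner_region_def)
  obtain z where z: "norm z = 1" "\<And>w. norm w = 1 \<Longrightarrow> h z + 0 - y \<bullet> z \<le> h w + 0 - y \<bullet> w"
    by (rule attains_min_gap[of 0 y]) (rule that)
  define s where "s = h z - y \<bullet> z"
  have s: "0 < s" using y[OF z(1)] by (simp add: s_def)
  have z0: "z \<noteq> 0" using z(1) by auto
  have zz: "z \<bullet> z = 1" using z(1) by (simp add: norm_eq_1)
  let ?F = "\<lambda>x. h x - s * norm x - y \<bullet> x"
  let ?g = "\<lambda>x. X x - s *\<^sub>R (x /\<^sub>R norm x) - y"
  have F0: "?F z = 0" using z(1) by (simp add: s_def)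
  have Fnn: "0 \<le> ?F x" if x: "x \<noteq> 0" for x
  proof -
    have hx: "h x = norm x * h (x /\<^sub>R norm x)"
      using h_scale[of "norm x" "x /\<^sub>R norm x"] x by simp
    have yx: "y \<bullet> x = norm x * (y \<bullet> (x /\<^sub>R norm x))" using x by simp
    have "s \<le> h (x /\<^sub>R norm x) - y \<bullet> (x /\<^sub>R norm x)" using z(2)[of "x /\<^sub>R norm x"] x by (simp add: s_def)
    then have "norm x * s \<le> norm x * (h (x /\<^sub>R norm x) - y \<bullet> (x /\<^sub>R norm x))" by (rule mult_left_mono) simp
    then show ?thesis unfolding hx yx by (simp add: algebra_simps)
  qed
  have Fd: "(?F has_derivative (\<lambda>v. ?g x \<bullet> v)) (at x)" if x: "x \<noteq> 0" for x
  proof -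
    have "(?F has_derivative (\<lambda>v. X x \<bullet> v - s * (v \<bullet> sgn x) - y \<bullet> v)) (at x)"
      by (intro has_derivative_diff has_derivative_mult_right h_deriv[OF x]
          has_derivative_norm[OF x] bounded_linear.has_derivative[OF bounded_linear_inner_right] has_derivative_ident)
    moreover have "(\<lambda>v. X x \<bullet> v - s * (v \<bullet> sgn x) - y \<bullet> v) = (\<lambda>v. ?g x \<bullet> v)"
      by (simp add: fun_eq_iff inner_diff_left inner_diff_right sgn_div_norm inner_commute)
    ultimately show ?thesis by simp
  qed
  have gd: "(?g has_derivative (\<lambda>v. A z v - s *\<^sub>R (v /\<^sub>R norm z - ((z \<bullet> v) / norm z ^ 3) *\<^sub>R z) - 0)) (at z)"
    by (intro has_derivative_diff has_derivative_scaleR_right X_deriv[OF z0] has_derivative_normalize[OF z0] has_derivative_const)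
  have "(\<lambda>v. ?g z \<bullet> v) = (\<lambda>v. 0)"
    by (rule differential_zero_maxmin[of z "- {0}", OF _ _ Fd[OF z0]]) (use z0 F0 Fnn in \<open>auto simp: open_Compl\<close>)
  then have "?g z \<bullet> ?g z = 0" by metis
  then have "?g z = 0" by simp
  then have yz: "y = X z - s *\<^sub>R z" using z(1) by (simp add: algebra_simps)
  have Azv: "s * (v \<bullet> v - (z \<bullet> v)\<^sup>2) \<le> A z v \<bullet> v" for v
  proof -
    have "0 \<le> (A z v - s *\<^sub>R (v /\<^sub>R norm z - ((z \<bullet> v) / norm z ^ 3) *\<^sub>R z) - 0) \<bullet> v"
    proof (rule minimum_second_derivative_nonneg[of "- {0}" z ?F ?g])
      show "?F z \<le> ?F x" if "x \<in> - {0}" for x using F0 Fnn[of x] that by simp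
      show "(?F has_derivative (\<lambda>v. ?g x \<bullet> v)) (at x)" if "x \<in> - {0}" for x using Fd[of x] that by simp
    qed (use z0 gd in \<open>auto simp: open_Compl\<close>)
    then show ?thesis using z(1) by (simp add: inner_diff_left power2_eq_square algebra_simps)
  qed
  have "s *\<^sub>R z \<in> Omega"
    unfolding Omega_def
  proof (intro CollectI conjI allI)
    show "s *\<^sub>R z \<noteq> 0" using s z0 by simp
    fix v
    have "v \<bullet> v - (z \<bullet> v)\<^sup>2 \<le> (A z v \<bullet> v) / s" using Azv[of v] s by (simp add: pos_le_divide_eq mult.commute)
    moreover have "((s *\<^sub>R z) \<bullet> v)\<^sup>2 / ((s *\<^sub>R z) \<bullet> (s *\<^sub>R z)) = (z \<bullet> v)\<^sup>2"
      using s by (simp add: zz power2_eq_square)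
    moreover have "A (s *\<^sub>R z) v \<bullet> v = (A z v \<bullet> v) / s"
      using s z0 by (simp add: A_scale divide_inverse mult.commute)
    ultimately show "v \<bullet> v - ((s *\<^sub>R z) \<bullet> v)\<^sup>2 / ((s *\<^sub>R z) \<bullet> (s *\<^sub>R z)) \<le> A (s *\<^sub>R z) v \<bullet> v"
      by simp
  qed
  moreover have "y = X (s *\<^sub>R z) - s *\<^sub>R z" using yz s by (simp add: X_scale)
  ultimately show "y \<in> (\<lambda>x. X x - x) ` Omega" by blast
qed

text \<open>The left side is the volume of the body, the case \<open>t = 0\<close> of the volume
  formula. The map \<open>X x - x\<close> covers the punctured interior from \<open>Omega\<close>.
  The area inequality and polar coordinates leave one integral per direction, which
  \<open>nn_integral_prod_diff_le\<close> bounds.\<close>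

lemma heintze_karcher: "ball_integral (\<lambda>x. u x * E n x) \<le> ball_integral (\<lambda>x. ev_sum x * E n x) / n"
proof (rule uE_bounded)
  fix C assume C: "0 < C" "\<And>x k. k \<le> n \<Longrightarrow> \<bar>E k x\<bar> \<le> C" "\<And>x k. k \<le> n \<Longrightarrow> \<bar>u x * E k x\<bar> \<le> C * C"
    "\<And>x k. k \<le> n \<Longrightarrow> \<bar>ev_sum x * E k x\<bar> \<le> C * C"
  define J where "J x = (if x = 0 then 0 else \<bar>det (matrix (\<lambda>v. A x v - v))\<bar>)" for x
  have Jm [measurable]: "J \<in> borel_measurable borel"
    unfolding J_def by (intro borel_measurable_punctured continuous_intros continuous_on_det_matrix A_cont)
  note [measurable] = Omega_borel
  have vol: "emeasure lborel (inner_region 0) = ennreal (ball_integral (\<lambda>x. u x * E n x))"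
  proof -
    have "jac 0 0 = (\<lambda>x. u x * E n x)"
    proof
      fix x
      have "(\<Sum>m\<le>n. E (n - m) x * 0 ^ m) = E (n - 0) x * 0 ^ 0"
        by (subst sum.remove[of _ 0]) auto
      then show "jac 0 0 x = u x * E n x" by (simp add: jac_def)
    qed
    then show ?thesis using volume_inner_region[of 0 0] by simp
  qed
  \<comment> \<open>The polar weight \<open>\<rho>^n\<close> clears the denominators of the
    Jacobian, and on \<open>Omega\<close> every factor is nonnegative, so the absolute value
    disappears.\<close>
  have Jval: "J x * norm x ^ n = (\<Prod>i<n. ev x ! i - norm x)" if x: "x \<in> Omega" for x
  proof -
    have x0: "x \<noteq> 0" using x by (simp add: Omega_def)
    let ?z = "x /\<^sub>R norm x"
    have zz: "?z \<bullet> ?z = 1" using x0 by (simp add: dot_square_norm power2_eq_square)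
    have "det (matrix (\<lambda>v. A x v - v)) = ((- ?z) \<bullet> ?z) * (\<Prod>i<n. 1 * (ev x ! i) / norm x + (-1))"
      by (rule det_radial[OF x0]) (simp add: algebra_simps)
    then have "J x = \<bar>\<Prod>i<n. ev x ! i / norm x - 1\<bar>"
      using x0 zz by (simp add: J_def)
    also have "\<dots> = (\<Prod>i<n. ev x ! i / norm x - 1)"
      using Omega_ev[OF x] x0 by (intro abs_of_nonneg prod_nonneg) (auto simp: field_simps)
    also have "\<dots> = (\<Prod>i<n. ev x ! i - norm x) / norm x ^ n"
    proof -
      have "(\<Prod>i<n. ev x ! i / norm x - 1) = (\<Prod>i<n. (ev x ! i - norm x) / norm x)"
        using x0 by (intro prod.cong) (auto simp: field_simps)
      then show ?thesis by (simp add: prod_dividef)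
    qed
    finally show ?thesis using x0 by simp
  qed
  have inner: "(\<integral>\<^sup>+\<rho>\<in>{0<..}. ennreal (J ((\<rho> / norm y) *\<^sub>R y)) * indicator Omega ((\<rho> / norm y) *\<^sub>R y) * ennreal (\<rho> ^ (DIM(real^'d) - 1)) \<partial>lborel)
      \<le> ennreal (E n y * (ev_sum y / n) / (n + 1))" if y: "y \<noteq> 0" for y
  proof -
    \<comment> \<open>The smallest principal radius bounds the part of a ray that lies in
      \<open>Omega\<close>.\<close>
    define \<mu> where "\<mu> = Min ((!) (ev y) ` {..<n})"
    have ne: "(!) (ev y) ` {..<n} \<noteq> {}" using n_pos by (auto simp: lessThan_empty_iff)
    have \<mu>: "\<mu> \<le> ev y ! i" if "i < n" for i unfolding \<mu>_def using that by (intro Min_le) auto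
    have \<mu>0: "0 \<le> \<mu>" unfolding \<mu>_def using ne ev_pos[OF y] by (subst Min_ge_iff) (auto intro: less_imp_le)
    have "(\<integral>\<^sup>+\<rho>\<in>{0<..}. ennreal (J ((\<rho> / norm y) *\<^sub>R y)) * indicator Omega ((\<rho> / norm y) *\<^sub>R y) * ennreal (\<rho> ^ (DIM(real^'d) - 1)) \<partial>lborel)
      \<le> (\<integral>\<^sup>+\<rho>\<in>{0<..\<mu>}. ennreal (\<Prod>i<n. ev y ! i - \<rho>) \<partial>lborel)"
    proof (rule nn_integral_mono)
      fix \<rho> :: real
      let ?x = "(\<rho> / norm y) *\<^sub>R y"
      show "ennreal (J ?x) * indicator Omega ?x * ennreal (\<rho> ^ (DIM(real^'d) - 1)) * indicator {0<..} \<rho>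
        \<le> ennreal (\<Prod>i<n. ev y ! i - \<rho>) * indicator {0<..\<mu>} \<rho>"
      proof (cases "?x \<in> Omega \<and> 0 < \<rho>")
        case True
        then have xO: "?x \<in> Omega" and \<rho>: "0 < \<rho>" by auto
        have ev: "ev ?x = ev y" by (rule ev_scale) (use \<rho> y in auto)
        have nx: "norm ?x = \<rho>" using \<rho> y by simp
        have "\<rho> \<le> ev y ! i" if "i < n" for i using Omega_ev[OF xO that] by (simp only: ev nx)
        then have "\<rho> \<le> \<mu>" unfolding \<mu>_def using ne by (subst Min_ge_iff) auto
        have Nn: "DIM(real^'d) - 1 = n" using DIM_eq by simp
        have "ennreal (J ?x) * ennreal (\<rho> ^ (DIM(real^'d) - 1)) = ennreal (J ?x * \<rho> ^ n)"
          unfolding Nn using \<rho> by (intro ennreal_mult[symmetric]) (auto simp: J_def)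
        also have "J ?x * \<rho> ^ n = (\<Prod>i<n. ev y ! i - \<rho>)" using Jval[OF xO] by (simp only: ev nx)
        finally show ?thesis using True \<open>\<rho> \<le> \<mu>\<close> by simp
      qed (auto simp: indicator_def)
    qed
    also have "\<dots> \<le> ennreal ((\<Prod>i<n. ev y ! i) * ((\<Sum>i<n. ev y ! i) / n) / (n + 1))"
      using n_pos by (intro nn_integral_prod_diff_le[OF _ ev_pos[OF y] \<mu>0 \<mu>]) auto
    also have "\<dots> = ennreal (E n y * (ev_sum y / n) / (n + 1))"
      using y by (simp add: E_def ev_sum_def esym_full)
    finally show ?thesis .
  qed
  have "ennreal (ball_integral (\<lambda>x. u x * E n x)) \<le> (\<integral>\<^sup>+x\<in>Omega. ennreal (J x) \<partial>lborel)"
    unfolding vol[symmetric]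
  proof (rule emeasure_subset_image_le[where f = "\<lambda>x. X x - x" and f' = "\<lambda>x v. A x v - v"])
    show "((\<lambda>x. X x - x) has_derivative (\<lambda>v. A x v - v)) (at x within Omega)" if "x \<in> Omega" for x
      using that by (intro has_derivative_diff has_derivative_at_withinI[OF X_deriv] has_derivative_ident) (simp add: Omega_def)
    show "J x = \<bar>det (matrix (\<lambda>v. A x v - v))\<bar>" if "x \<in> Omega" for x
      using that by (simp add: J_def Omega_def)
  qed (use Omega_borel Jm open_inner_region inner_region_subset_normal_image in auto)
  also have "\<dots> = of_nat DIM(real^'d) * (\<integral>\<^sup>+y\<in>ball 0 1. (\<integral>\<^sup>+\<rho>\<in>{0<..}. ennreal (J ((\<rho> / norm y) *\<^sub>R y)) *
      indicator Omega ((\<rho> / norm y) *\<^sub>R y) * ennreal (\<rho> ^ (DIM(real^'d) - 1)) \<partial>lborel) \<partial>lborel)"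
    by (rule nn_integral_polar) measurable
  also have "\<dots> \<le> of_nat DIM(real^'d) * (\<integral>\<^sup>+y\<in>ball 0 1. ennreal (E n y * (ev_sum y / n) / (n + 1)) \<partial>lborel)"
  proof (intro mult_left_mono nn_integral_mono_AE)
    show "AE y in lborel. (\<integral>\<^sup>+\<rho>\<in>{0<..}. ennreal (J ((\<rho> / norm y) *\<^sub>R y)) *
      indicator Omega ((\<rho> / norm y) *\<^sub>R y) * ennreal (\<rho> ^ (DIM(real^'d) - 1)) \<partial>lborel) * indicator (ball 0 1) y
      \<le> ennreal (E n y * (ev_sum y / n) / (n + 1)) * indicator (ball 0 1) y"
      using AE_lborel_singleton[of "0 :: real^'d"] by eventually_elim (intro mult_right_mono inner, auto)
  qed simp
  also have "(\<integral>\<^sup>+y\<in>ball 0 1. ennreal (E n y * (ev_sum y / n) / (n + 1)) \<partial>lborel) =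
      ennreal (ball_integral (\<lambda>y. (1 / (n * (n + 1))) * (ev_sum y * E n y)))"
  proof -
    have "(\<integral>\<^sup>+y\<in>ball 0 1. ennreal (E n y * (ev_sum y / n) / (n + 1)) \<partial>lborel) =
        (\<integral>\<^sup>+y\<in>ball 0 1. ennreal ((1 / (n * (n + 1))) * (ev_sum y * E n y)) \<partial>lborel)"
      by (intro nn_integral_cong) (simp add: field_simps)
    also have "\<dots> = ennreal (ball_integral (\<lambda>y. (1 / (n * (n + 1))) * (ev_sum y * E n y)))"
    proof (rule nn_integral_ball)
      show "\<bar>(1 / (n * (n + 1))) * (ev_sum y * E n y)\<bar> \<le> (1 / (n * (n + 1))) * (C * C)" for y
        using C(4)[of n y] unfolding abs_mult[of "1 / (n * (n + 1))"] by (intro mult_mono) auto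
      show "0 \<le> (1 / (n * (n + 1))) * (ev_sum y * E n y)" for y
        using ev_sum_nonneg E_nonneg by (intro mult_nonneg_nonneg) auto
    qed measurable
    finally show ?thesis .
  qed
  \<comment> \<open>The dimension \<open>n + 1\<close> from polar coordinates cancels the
    \<open>n + 1\<close> from integrating an \<open>n\<close>-th power along the normal.\<close>
  also have "of_nat DIM(real^'d) * ennreal (ball_integral (\<lambda>y. (1 / (n * (n + 1))) * (ev_sum y * E n y))) =
      ennreal (ball_integral (\<lambda>x. ev_sum x * E n x) / n)"
  proof -
    have "x * ((1 / (n * x)) * B) = B / n" if "0 < x" for x B :: real
      using that by simp
    then have "real DIM(real^'d) * ((1 / (n * real (n + 1))) * B) = B / n" for B :: real
      unfolding DIM_eq by (metis add_gr_0 of_nat_0_less_iff zero_less_one)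
    moreover have "of_nat DIM(real^'d) * ennreal B = ennreal (real DIM(real^'d) * B)" for B
      by (simp add: ennreal_mult' ennreal_of_nat_eq_real_of_nat)
    ultimately show ?thesis by (simp only: ball_integral_cmult of_nat_mult)
  qed
  finally show ?thesis
  proof (subst (asm) ennreal_le_iff)
    show "0 \<le> ball_integral (\<lambda>x. ev_sum x * E n x) / n"
      unfolding ball_integral_def using ev_sum_nonneg E_nonneg
      by (intro divide_nonneg_nonneg integral_nonneg_AE AE_I2 mult_nonneg_nonneg) auto
  qed
qed

lemma minkowski_heintze_karcher:
  assumes k: "1 \<le> k" "k \<le> n"
  shows "real n * ball_integral (\<lambda>x. u x * E k x) \<le> ball_integral (\<lambda>x. ev_sum x * E k x)"
proof (cases "k = n")
  case True
  have "real n * ball_integral (\<lambda>x. u x * E n x) \<le> real n * (ball_integral (\<lambda>x. ev_sum x * E n x) / n)"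
    using heintze_karcher by (rule mult_left_mono) simp
  then show ?thesis using True n_pos by simp
next
  case False
  then have kn: "k < n" using k by simp
  show ?thesis
  proof (rule uE_bounded)
    fix C assume C: "0 < C" "\<And>x k. k \<le> n \<Longrightarrow> \<bar>E k x\<bar> \<le> C" "\<And>x k. k \<le> n \<Longrightarrow> \<bar>u x * E k x\<bar> \<le> C * C"
      "\<And>x k. k \<le> n \<Longrightarrow> \<bar>ev_sum x * E k x\<bar> \<le> C * C"
    \<comment> \<open>The factor of \<open>E (k + 1)\<close> in the Minkowski formula; the ratio of
      binomial coefficients in the Maclaurin inequality produces the same one.\<close>
    define c where "c = real n * (k + 1) / (n - k)"
    have nk: "0 < real (n - k)" "real (n - k) = real n - real k" using kn by auto
    have mac: "c * E (k + 1) x \<le> ev_sum x * E k x" for x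
    proof (cases "x = 0")
      case False
      have "E (k + 1) x / real (n choose (k + 1)) \<le> (ev_sum x / real n) * (E k x / real (n choose k))"
        using False esym_maclaurin[of n "(!) (ev x)" k] ev_pos[OF False] k kn by (simp add: E_def ev_sum_def less_imp_le)
      moreover have "real (k + 1) * real (n choose (k + 1)) = real (n - k) * real (n choose k)"
      proof -
        have "(k + 1) * (n choose (k + 1)) = (n - k) * (n choose k)"
          using binomial_absorb_comp[of n k] binomial_absorption[of k n] by simp
        then show ?thesis by (metis of_nat_mult)
      qed
      moreover have "0 < real (n choose (k + 1))" "0 < real (n choose k)" "0 < real n" using kn by auto
      moreover have "M * K / d * e1 \<le> s * e" if "e1 / b1 \<le> (s / M) * (e / b)" "K * b1 = d * b" "0 < b1" "0 < b" "0 < M" "0 < d" "0 < K"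
        for M K d e1 s e b1 b :: real
      proof -
        have "e1 \<le> (s / M) * (e / b) * b1" using that by (simp add: pos_divide_le_eq)
        then have "M * K / d * e1 \<le> M * K / d * ((s / M) * (e / b) * b1)" using that by (intro mult_left_mono) auto
        also have "\<dots> = s * e * ((K * b1) / (d * b))" using that by (simp add: field_simps)
        also have "\<dots> = s * e" using that by simp
        finally show ?thesis .
      qed
      ultimately show ?thesis using nk unfolding c_def by (simp del: of_nat_add of_nat_diff)
    qed (simp add: E_def)
    have "real n * ball_integral (\<lambda>x. u x * E k x) = c * ball_integral (E (k + 1))"
      using minkowski_formula[OF kn] nk by (simp add: c_def field_simps)
    also have "\<dots> = ball_integral (\<lambda>x. c * E (k + 1) x)" by (rule ball_integral_cmult[symmetric])
    also have "\<dots> \<le> ball_integral (\<lambda>x. ev_sum x * E k x)"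
    proof (rule ball_integral_mono[OF _ _ _ _ mac])
      show "\<bar>c * E (k + 1) x\<bar> \<le> \<bar>c\<bar> * C" for x
        using C(2)[of "k + 1" x] kn by (simp add: abs_mult mult_left_mono)
      show "\<bar>ev_sum x * E k x\<bar> \<le> C * C" for x using C(4)[of k x] kn by simp
      show "(\<lambda>x. c * E (k + 1) x) \<in> borel_measurable borel" "(\<lambda>x. ev_sum x * E k x) \<in> borel_measurable borel"
        using kn by (auto intro!: borel_measurable_times)
    qed
    finally show ?thesis .
  qed
qed

end

section \<open>The divergence identity\<close>

lemma positive_part_square_has_derivative:
  "((\<lambda>y::real. (max 0 y)\<^sup>2) has_real_derivative 2 * max 0 y) (at y)"
proof (cases y "0 :: real" rule: linorder_cases)
  case less
  have "((\<lambda>y. 0 :: real) has_real_derivative 0) (at y)" by simp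
  then have "((\<lambda>y. (max 0 y)\<^sup>2) has_real_derivative 0) (at y)"
    by (rule has_field_derivative_transform_within_open[where S = "{..<0}"]) (use less in auto)
  then show ?thesis using less by simp
next
  case equal
  have "((\<lambda>h. max 0 h :: real) \<longlongrightarrow> max 0 0) (at 0)" by (intro tendsto_max tendsto_const tendsto_ident_at)
  moreover have "(\<lambda>h. ((max 0 (0 + h))\<^sup>2 - (max 0 0)\<^sup>2) / h) = (\<lambda>h. max 0 h :: real)"
    by (auto simp: fun_eq_iff max_def power2_eq_square)
  ultimately show ?thesis using equal by (simp only: DERIV_def) simp
next
  case greater
  have "((\<lambda>y. y\<^sup>2 :: real) has_real_derivative 2 * y) (at y)" by (auto intro!: derivative_eq_intros)
  then have "((\<lambda>y. (max 0 y)\<^sup>2) has_real_derivative 2 * y) (at y)"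
    by (rule has_field_derivative_transform_within_open[where S = "{0<..}"]) (use greater in auto)
  then show ?thesis using greater by simp
qed

text \<open>Evaluated at \<open>s = |x|^2\<close>, this is a C^1 cutoff for the annulus
  \<open>1 < |x| < 2\<close>. It keeps away from the origin, where the fields are singular, and from
  infinity; the square makes the positive part differentiable.\<close>

definition bump :: "real \<Rightarrow> real" where
  "bump s = (max 0 ((s - 1) * (4 - s)))\<^sup>2"

lemma bump_has_derivative:
  "(bump has_real_derivative 2 * max 0 ((s - 1) * (4 - s)) * (5 - 2 * s)) (at s)"
proof -
  have "((\<lambda>s. (s - 1) * (4 - s)) has_real_derivative 5 - 2 * s) (at s)"
    by (auto intro!: derivative_eq_intros simp: algebra_simps)
  then show ?thesis
    unfolding bump_def[abs_def] by (rule DERIV_chain2[OF positive_part_square_has_derivative])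
qed

lemma bump_pos:
  assumes "1 < s" "s < 4"
  shows "0 < bump s"
proof -
  have "0 < (s - 1) * (4 - s)" using assms by simp
  then show ?thesis unfolding bump_def by (intro zero_less_power) simp
qed

lemma bump_eq_0:
  assumes "s \<le> 1 \<or> 4 \<le> s"
  shows "bump s = 0"
proof -
  have "(s - 1) * (4 - s) \<le> 0" using assms by (auto simp: mult_le_0_iff)
  then show ?thesis by (simp add: bump_def max_def)
qed

lemma bump_nonneg: "0 \<le> bump s" by (simp add: bump_def)

lemma continuous_bump: "continuous_on S (\<lambda>s. bump (f s))" if "continuous_on S f"
  using that unfolding bump_def by (intro continuous_intros)

lemma bump_le: "bump (\<rho>\<^sup>2) / \<rho> \<le> 9 * indicator {1..2} \<rho>" if "0 < \<rho>"
proof (cases "1 \<le> \<rho> \<and> \<rho> \<le> 2")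
  case True
  \<comment> \<open>Completing the square gives the maximum \<open>9 / 4\<close>, which is below
    \<open>3\<close>; the bound \<open>9\<close> is the square of \<open>3\<close>.\<close>
  have "(\<rho>\<^sup>2 - 1) * (4 - \<rho>\<^sup>2) = 9 / 4 - (\<rho>\<^sup>2 - 5 / 2)\<^sup>2" by (simp add: power2_eq_square algebra_simps)
  then have "(\<rho>\<^sup>2 - 1) * (4 - \<rho>\<^sup>2) \<le> 9 / 4 - 0" by (metis diff_left_mono zero_le_power2)
  then have "(max 0 ((\<rho>\<^sup>2 - 1) * (4 - \<rho>\<^sup>2)))\<^sup>2 \<le> 3\<^sup>2" by (intro power_mono) auto
  then have "bump (\<rho>\<^sup>2) \<le> 9" by (simp add: bump_def)
  moreover have "bump (\<rho>\<^sup>2) / \<rho> \<le> bump (\<rho>\<^sup>2) / 1" using True bump_nonneg by (intro divide_left_mono) auto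
  ultimately show ?thesis using True by simp
next
  case False
  then have "bump (\<rho>\<^sup>2) = 0"
    using that power_le_one[of \<rho> 2] power_mono[of 2 \<rho> 2] by (intro bump_eq_0) (auto simp: not_le)
  then show ?thesis using False by simp
qed

text \<open>For functions of degree zero the weighted integral is the ball integral times a constant
  \<open>DIM('a) * W\<close>. The constant is positive and finite, so it can be cancelled.\<close>

lemma bump_weight_balance:
  fixes a b :: "'a::euclidean_space \<Rightarrow> real"
  assumes a: "a \<in> borel_measurable borel" "\<And>x. \<bar>a x\<bar> \<le> C" "\<And>x. 0 \<le> a x"
      "\<And>c x. 0 < c \<Longrightarrow> x \<noteq> 0 \<Longrightarrow> a (c *\<^sub>R x) = a x"
    and b: "b \<in> borel_measurable borel" "\<And>x. \<bar>b x\<bar> \<le> D" "\<And>x. 0 \<le> b x"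
      "\<And>c x. 0 < c \<Longrightarrow> x \<noteq> 0 \<Longrightarrow> b (c *\<^sub>R x) = b x"
    and eq: "(\<integral>x. bump ((norm x)\<^sup>2) / norm x * (a x - b x) \<partial>lborel) = 0"
  shows "ball_integral a = ball_integral b"
proof -
  let ?w = "\<lambda>\<rho>. bump (\<rho>\<^sup>2) / \<rho> :: real"
  define W where "W = (\<integral>\<^sup>+\<rho>\<in>{0<..}. ennreal (?w \<rho>) * ennreal (\<rho> ^ (DIM('a) - 1)) \<partial>lborel)"
  have bm [measurable]: "bump \<in> borel_measurable borel"
    using continuous_bump[of UNIV "\<lambda>x. x"] by (intro borel_measurable_continuous_onI) simp
  have W_fin: "W < \<infinity>"
  proof -
    have "W \<le> (\<integral>\<^sup>+\<rho>. ennreal (9 * 2 ^ (DIM('a) - 1)) * indicator {1..2::real} \<rho> \<partial>lborel)"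
      unfolding W_def
    proof (rule nn_integral_mono)
      fix \<rho> :: real
      have "ennreal (?w \<rho>) * ennreal (\<rho> ^ (DIM('a) - 1)) \<le> ennreal (9 * 2 ^ (DIM('a) - 1)) * indicator {1..2} \<rho>" if \<rho>: "0 < \<rho>"
      proof (cases "\<rho> \<in> {1..2}")
        case True
        have "?w \<rho> \<le> 9" using bump_le[OF \<rho>] True by simp
        moreover have "\<rho> ^ (DIM('a) - 1) \<le> 2 ^ (DIM('a) - 1)" using True by (intro power_mono) auto
        ultimately have "?w \<rho> * \<rho> ^ (DIM('a) - 1) \<le> 9 * 2 ^ (DIM('a) - 1)"
          using \<rho> bump_nonneg by (intro mult_mono) auto
        then show ?thesis using True \<rho> bump_nonneg by (simp add: ennreal_mult[symmetric] ennreal_leI)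
      next
        case False
        then have "?w \<rho> \<le> 0" using bump_le[OF \<rho>] by simp
        then show ?thesis by (simp add: ennreal_neg)
      qed
      then show "ennreal (?w \<rho>) * ennreal (\<rho> ^ (DIM('a) - 1)) * indicator {0<..} \<rho>
        \<le> ennreal (9 * 2 ^ (DIM('a) - 1)) * indicator {1..2} \<rho>" by (cases "0 < \<rho>") simp_all
    qed
    also have "\<dots> < \<infinity>" by (subst nn_integral_cmult_indicator) (auto simp: ennreal_mult_less_top)
    finally show ?thesis .
  qed
  have W_pos: "W \<noteq> 0"
  proof
    assume "W = 0"
    then have "AE \<rho> in lborel. ennreal (?w \<rho>) * ennreal (\<rho> ^ (DIM('a) - 1)) * indicator {0<..} \<rho> = 0"
      unfolding W_def by (subst (asm) nn_integral_0_iff_AE) auto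
    then have "AE \<rho> in lborel. \<rho> \<notin> {1<..<2::real}"
    proof eventually_elim
      fix \<rho> :: real
      assume 0: "ennreal (?w \<rho>) * ennreal (\<rho> ^ (DIM('a) - 1)) * indicator {0<..} \<rho> = 0"
      show "\<rho> \<notin> {1<..<2}"
      proof
        assume \<rho>: "\<rho> \<in> {1<..<2}"
        then have "1 < \<rho>\<^sup>2" "\<rho>\<^sup>2 < 4"
          using power_strict_mono[of \<rho> 2 2] by (simp_all add: one_less_power)
        then have "0 < ?w \<rho>" using \<rho> bump_pos[of "\<rho>\<^sup>2"] by simp
        moreover have "0 < \<rho> ^ (DIM('a) - 1)" using \<rho> by simp
        ultimately show False using 0 \<rho> by (auto simp: ennreal_eq_0_iff)
      qed
    qed
    then have "emeasure lborel {\<rho> \<in> space lborel. \<not> \<rho> \<notin> {1<..<2::real}} = 0"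
      by (subst (asm) AE_iff_measurable[OF _ refl]) auto
    moreover have "{\<rho> \<in> space lborel. \<not> \<rho> \<notin> {1<..<2::real}} = {1<..<2}" by auto
    ultimately show False by (simp only: emeasure_lborel_Ioo) simp
  qed
  have polar: "(\<integral>\<^sup>+x. ennreal (?w (norm x) * f x) \<partial>lborel) = of_nat DIM('a) * W * ennreal (ball_integral f)"
    and int: "integrable lborel (\<lambda>x. ?w (norm x) * f x)"
    if f [measurable]: "f \<in> borel_measurable borel" "\<And>x. \<bar>f x\<bar> \<le> C" "\<And>x. 0 \<le> f x"
      "\<And>c x. 0 < c \<Longrightarrow> x \<noteq> 0 \<Longrightarrow> f (c *\<^sub>R x) = f x" for f :: "'a \<Rightarrow> real" and C
  proof -
    have "(\<integral>\<^sup>+x. ennreal (?w (norm x) * f x) \<partial>lborel) = (\<integral>\<^sup>+x. ennreal (f x) * ennreal (?w (norm x)) \<partial>lborel)"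
      using f(3) bump_nonneg by (intro nn_integral_cong) (simp add: ennreal_mult[symmetric] mult.commute)
    also have "\<dots> = of_nat DIM('a) * W * (\<integral>\<^sup>+y\<in>ball 0 1. ennreal (f y) \<partial>lborel)"
      unfolding W_def by (rule nn_integral_polar_product) (use f(4) in \<open>measurable, simp\<close>)
    also have "(\<integral>\<^sup>+y\<in>ball 0 1. ennreal (f y) \<partial>lborel) = ennreal (ball_integral f)"
      by (rule nn_integral_ball) (use f in auto)
    finally show eq: "(\<integral>\<^sup>+x. ennreal (?w (norm x) * f x) \<partial>lborel) = of_nat DIM('a) * W * ennreal (ball_integral f)" .
    show "integrable lborel (\<lambda>x. ?w (norm x) * f x)"
    proof (rule integrableI_nonneg)
      show "(\<integral>\<^sup>+x. ennreal (?w (norm x) * f x) \<partial>lborel) < \<infinity>"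
        unfolding eq using W_fin by (simp add: ennreal_mult_less_top of_nat_less_top)
    qed (use f(3) bump_nonneg in auto)
  qed
  have int_eq: "ennreal (\<integral>x. ?w (norm x) * f x \<partial>lborel) = of_nat DIM('a) * W * ennreal (ball_integral f)"
    if f: "f \<in> borel_measurable borel" "\<And>x. \<bar>f x\<bar> \<le> C" "\<And>x. 0 \<le> f x"
      "\<And>c x. 0 < c \<Longrightarrow> x \<noteq> 0 \<Longrightarrow> f (c *\<^sub>R x) = f x" for f :: "'a \<Rightarrow> real" and C
  proof -
    have "(\<integral>\<^sup>+x. ennreal (?w (norm x) * f x) \<partial>lborel) = ennreal (\<integral>x. ?w (norm x) * f x \<partial>lborel)"
      by (rule nn_integral_eq_integral[OF int[OF f]]) (use f(3) bump_nonneg in auto)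
    then show ?thesis using polar[OF f] by (rule trans[OF sym])
  qed
  have "(\<integral>x. ?w (norm x) * (a x - b x) \<partial>lborel) = (\<integral>x. ?w (norm x) * a x \<partial>lborel) - (\<integral>x. ?w (norm x) * b x \<partial>lborel)"
    unfolding right_diff_distrib by (rule Bochner_Integration.integral_diff[OF int[OF a] int[OF b]])
  then have "ennreal (\<integral>x. ?w (norm x) * a x \<partial>lborel) = ennreal (\<integral>x. ?w (norm x) * b x \<partial>lborel)"
    using eq by simp
  moreover have "of_nat DIM('a) * W * ennreal (ball_integral a) = ennreal (\<integral>x. ?w (norm x) * a x \<partial>lborel)"
    using a by (intro int_eq[symmetric])
  moreover have "of_nat DIM('a) * W * ennreal (ball_integral b) = ennreal (\<integral>x. ?w (norm x) * b x \<partial>lborel)"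
    using b by (intro int_eq[symmetric])
  ultimately have "of_nat DIM('a) * W * ennreal (ball_integral a) = of_nat DIM('a) * W * ennreal (ball_integral b)"
    by (simp only:)
  moreover have "of_nat DIM('a) * W \<noteq> 0" "of_nat DIM('a) * W \<noteq> (\<infinity> :: ennreal)"
    using W_pos W_fin by (auto simp: ennreal_mult_eq_top_iff)
  ultimately have "ennreal (ball_integral a) = ennreal (ball_integral b)"
    by (simp only: ennreal_mult_cancel_left) simp
  moreover have "0 \<le> ball_integral a" "0 \<le> ball_integral b"
    unfolding ball_integral_def using a(3) b(3) by (auto intro!: integral_nonneg_AE)
  ultimately show ?thesis by simp
qed

section \<open>The divergence of the tangential field\<close>

context support_gradient
begin

text \<open>On the unit sphere this is the gradient of the support function, tangent to the sphere.\<close>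

definition T :: "real^'d \<Rightarrow> real^'d" where
  "T x = X x - (h x / (x \<bullet> x)) *\<^sub>R x"

definition T' :: "real^'d \<Rightarrow> real^'d \<Rightarrow> real^'d" where
  "T' x v = A x v - ((h x / (x \<bullet> x)) *\<^sub>R v + (((X x \<bullet> v) * (x \<bullet> x) - h x * (2 * (x \<bullet> v))) / ((x \<bullet> x) * (x \<bullet> x))) *\<^sub>R x)"

lemma T_has_derivative:
  assumes x: "x \<noteq> 0"
  shows "(T has_derivative T' x) (at x)"
proof -
  have q: "((\<lambda>x. x \<bullet> x) has_derivative (\<lambda>v. 2 * (x \<bullet> v))) (at x)"
    by (auto intro!: derivative_eq_intros simp: inner_commute)
  have "((\<lambda>x. h x / (x \<bullet> x)) has_derivative (\<lambda>v. ((X x \<bullet> v) * (x \<bullet> x) - h x * (2 * (x \<bullet> v))) / ((x \<bullet> x) * (x \<bullet> x)))) (at x)"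
    by (rule has_derivative_divide'[OF h_deriv[OF x] q]) (use x in simp)
  from has_derivative_diff[OF X_deriv[OF x] has_derivative_scaleR[OF this has_derivative_ident]]
  show ?thesis unfolding T_def[abs_def] T'_def[abs_def] .
qed

lemma inner_T: "x \<noteq> 0 \<Longrightarrow> x \<bullet> T x = 0"
  by (simp add: T_def inner_diff_right h_eq inner_commute)

lemma T_scale: "0 < c \<Longrightarrow> x \<noteq> 0 \<Longrightarrow> T (c *\<^sub>R x) = T x"
  by (simp add: T_def X_scale h_scale)

lemma T_cont: "continuous_on (- {0}) T"
  by (intro continuous_at_imp_continuous_on ballI has_derivative_continuous[OF T_has_derivative]) auto

lemma T'_cont: "continuous_on (- {0}) (\<lambda>x. T' x v)"
  unfolding T'_def by (intro continuous_intros A_cont X_cont h_cont) auto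

text \<open>The counterpart of the Laplacian of \<open>u\<close> on the sphere. Removing the radial
  part of \<open>X\<close> costs \<open>n + 1\<close> through the identity and \<open>1\<close>
  through the gradient of \<open>h\<close>, and returns \<open>2\<close> through the denominator
  \<open>x \<bullet> x\<close>; hence the factor \<open>n\<close>.\<close>

lemma trace_T':
  assumes x: "x \<noteq> 0"
  shows "(\<Sum>e\<in>Basis. T' x e \<bullet> e) = (ev_sum x - n * u x) / norm x"
proof -
  let ?s = "x \<bullet> x" and ?h = "h x"
  have s: "?s \<noteq> 0" using x by simp
  have ip: "(\<Sum>e\<in>Basis. (y \<bullet> e) * (x \<bullet> e)) = y \<bullet> x" for y
    by (rule euclidean_inner[symmetric])
  have "T' x e \<bullet> e = A x e \<bullet> e - ?h / ?s * (e \<bullet> e) - (X x \<bullet> e) * (x \<bullet> e) / ?s + 2 * ?h / (?s * ?s) * ((x \<bullet> e) * (x \<bullet> e))" for e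
    using s by (simp add: T'_def inner_diff_left inner_add_left diff_divide_distrib left_diff_distrib)
  then have "(\<Sum>e\<in>Basis. T' x e \<bullet> e) =
      (\<Sum>e\<in>Basis. A x e \<bullet> e) - ?h / ?s * (\<Sum>e\<in>(Basis :: (real^'d) set). e \<bullet> e) - (\<Sum>e\<in>Basis. (X x \<bullet> e) * (x \<bullet> e)) / ?s + 2 * ?h / (?s * ?s) * (\<Sum>e\<in>Basis. (x \<bullet> e) * (x \<bullet> e))"
    by (simp only: sum.distrib sum_subtractf sum_distrib_left sum_divide_distrib)
  also have "(\<Sum>e\<in>(Basis :: (real^'d) set). e \<bullet> e) = n + 1" using DIM_eq by (simp add: inner_Basis)
  also have "(\<Sum>e\<in>Basis. (X x \<bullet> e) * (x \<bullet> e)) = ?h" using ip x by (simp add: h_eq)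
  also have "(\<Sum>e\<in>Basis. (x \<bullet> e) * (x \<bullet> e)) = ?s" by (rule ip)
  also have "(\<Sum>e\<in>Basis. A x e \<bullet> e) = ev_sum x / norm x" using x by (simp add: ev_sum_trace)
  also have "ev_sum x / norm x - ?h / ?s * (n + 1) - ?h / ?s + 2 * ?h / (?s * ?s) * ?s = ev_sum x / norm x - n * (?h / ?s)"
    using s by (simp add: field_simps)
  also have "?h / ?s = u x / norm x"
    using x by (simp add: u_def dot_square_norm power2_eq_square)
  finally show ?thesis by (simp add: diff_divide_distrib)
qed

text \<open>The integral of the divergence of the field \<open>F T\<close> times the cutoff
  vanishes. The gradient of the cutoff is radial and \<open>T\<close> is tangential, so what remains
  is a radial weight times a function of degree zero, and the weight can be traded for the unit
  ball.\<close>

lemma divergence_identity: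
  assumes F_deriv: "\<And>x. x \<noteq> 0 \<Longrightarrow> (F has_derivative F' x) (at x)"
    and F'_cont: "\<And>v. continuous_on (- {0}) (\<lambda>x. F' x v)"
    and F_scale: "\<And>c x. 0 < c \<Longrightarrow> x \<noteq> 0 \<Longrightarrow> F (c *\<^sub>R x) = F x"
    and F_nonneg: "\<And>x. 0 \<le> F x" and F_measurable: "F \<in> borel_measurable borel"
    and g: "\<And>x. g x = (if x = 0 then 0 else norm x * F' x (T x))" "\<And>x. 0 \<le> g x"
  shows "ball_integral (\<lambda>x. g x + F x * ev_sum x) = ball_integral (\<lambda>x. n * (F x * u x))"
    and "continuous_on (- {0}) (\<lambda>x. norm x * F' x (T x))" and "\<And>c x. 0 < c \<Longrightarrow> x \<noteq> 0 \<Longrightarrow> g (c *\<^sub>R x) = g x"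
    and "g \<in> borel_measurable borel"
proof -
  note [measurable] = F_measurable
  have F_cont: "continuous_on (- {0}) F"
    by (intro continuous_at_imp_continuous_on ballI has_derivative_continuous[OF F_deriv]) auto
  have F'T: "F' x (T x) = (\<Sum>e\<in>Basis. (T x \<bullet> e) * F' x e)" if "x \<noteq> 0" for x
  proof -
    have "linear (F' x)" by (rule has_derivative_linear[OF F_deriv[OF that]])
    then have "F' x (\<Sum>e\<in>Basis. (T x \<bullet> e) *\<^sub>R e) = (\<Sum>e\<in>Basis. (T x \<bullet> e) *\<^sub>R F' x e)"
      by (simp add: linear_sum linear_cmul)
    then show ?thesis by (simp add: euclidean_representation)
  qed
  show gc: "continuous_on (- {0}) (\<lambda>x. norm x * F' x (T x))"
  proof -
    have "continuous_on (- {0}) (\<lambda>x. norm x * (\<Sum>e\<in>Basis. (T x \<bullet> e) * F' x e))"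
      by (intro continuous_intros T_cont F'_cont)
    then show ?thesis by (rule continuous_on_cong[THEN iffD1, rotated 2]) (auto simp: F'T)
  qed
  show gs: "g (c *\<^sub>R x) = g x" if c: "0 < c" and x: "x \<noteq> 0" for c x
  proof -
    have cx: "c *\<^sub>R x \<noteq> 0" using c x by simp
    have "((\<lambda>y. c *\<^sub>R y) has_derivative (\<lambda>v. c *\<^sub>R v)) (at x)" by (auto intro!: derivative_eq_intros)
    then have "((\<lambda>y. F (c *\<^sub>R y)) has_derivative (\<lambda>v. F' (c *\<^sub>R x) (c *\<^sub>R v))) (at x)"
      by (rule has_derivative_compose) (rule F_deriv[OF cx])
    then have "(F has_derivative (\<lambda>v. F' (c *\<^sub>R x) (c *\<^sub>R v))) (at x)"
      by (rule has_derivative_transform_within_open[of _ _ _ _ "- {0}"]) (use c x F_scale in \<open>auto simp: open_Compl\<close>)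
    then have "(\<lambda>v. F' (c *\<^sub>R x) (c *\<^sub>R v)) = F' x" by (rule has_derivative_unique) (rule F_deriv[OF x])
    then have "F' (c *\<^sub>R x) (c *\<^sub>R T x) = F' x (T x)" by metis
    then have "c * F' (c *\<^sub>R x) (T x) = F' x (T x)"
      using linear_cmul[OF has_derivative_linear[OF F_deriv[OF cx]]] by simp
    then show ?thesis using c x by (simp add: g(1) T_scale)
  qed
  show gm [measurable]: "g \<in> borel_measurable borel"
    unfolding g(1)[abs_def] by (rule borel_measurable_punctured[OF gc])
  obtain G where G: "\<And>x. x \<noteq> 0 \<Longrightarrow> \<bar>norm x * F' x (T x)\<bar> \<le> G"
  proof -
    have "norm (c *\<^sub>R x) * F' (c *\<^sub>R x) (T (c *\<^sub>R x)) = norm x * F' x (T x)" if "0 < c" "x \<noteq> 0" for c x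
      using gs[OF that] that by (simp add: g(1))
    then show thesis using homogeneous_bounded[OF gc] that by blast
  qed
  obtain B where B: "\<And>x. x \<noteq> 0 \<Longrightarrow> \<bar>F x\<bar> \<le> B"
    using homogeneous_bounded[OF F_cont F_scale] by blast
  obtain C where C: "0 < C" "\<And>x. u x \<le> C" "\<And>x. ev_sum x \<le> C"
    by (rule bounds) (rule that)
  \<comment> \<open>The derivative in direction \<open>v\<close> of the component along
    \<open>e\<close>. Both terms carry a factor that vanishes on the unit ball, so the formula is
    continuous across the origin.\<close>
  define \<phi>' where "\<phi>' e x v = (2 * max 0 ((x \<bullet> x - 1) * (4 - x \<bullet> x)) * (5 - 2 * (x \<bullet> x))) * (2 * (x \<bullet> v)) * (F x * (T x \<bullet> e)) +
     bump (x \<bullet> x) * (F x * (T' x v \<bullet> e) + F' x v * (T x \<bullet> e))" for e x v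
  have inner1: "x \<bullet> x < 1" if "norm x < 1" for x :: "real^'d"
    using that by (metis dot_square_norm norm_ge_zero power_less_one_iff zero_less_numeral)
  have \<phi>'0: "\<phi>' e x v = 0" if "norm x < 1" for e x v
  proof -
    have "(x \<bullet> x - 1) * (4 - x \<bullet> x) \<le> 0" using inner1[OF that] by (intro mult_nonpos_nonneg) auto
    then show ?thesis using inner1[OF that] by (simp add: \<phi>'_def bump_eq_0 max_def)
  qed
  have zero: "integrable lborel (\<lambda>x. \<phi>' e x e)" "(\<integral>x. \<phi>' e x e \<partial>lborel) = 0" for e
  proof -
    have d: "((\<lambda>x. bump (x \<bullet> x) * (F x * (T x \<bullet> e))) has_derivative \<phi>' e x) (at x)" for x
    proof (cases "norm x < 1")
      case True
      have "\<phi>' e x = (\<lambda>v. 0)" using \<phi>'0[OF True] by (simp add: fun_eq_iff)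
      moreover have "((\<lambda>x. bump (x \<bullet> x) * (F x * (T x \<bullet> e))) has_derivative (\<lambda>v. 0)) (at x)"
      proof (rule has_derivative_transform_within_open[of "\<lambda>_. 0" _ _ _ "ball 0 1"])
        show "0 = bump (y \<bullet> y) * (F y * (T y \<bullet> e))" if "y \<in> ball 0 1" for y
          using inner1[of y] that by (simp add: bump_eq_0)
      qed (use True in auto)
      ultimately show ?thesis by simp
    next
      case False
      then have x: "x \<noteq> 0" by auto
      have q: "((\<lambda>x. x \<bullet> x) has_derivative (\<lambda>v. 2 * (x \<bullet> v))) (at x)"
        by (auto intro!: derivative_eq_intros simp: inner_commute)
      have b: "((\<lambda>x. bump (x \<bullet> x)) has_derivative
          (\<lambda>v. (2 * max 0 ((x \<bullet> x - 1) * (4 - x \<bullet> x)) * (5 - 2 * (x \<bullet> x))) * (2 * (x \<bullet> v)))) (at x)"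
        by (rule has_derivative_compose[OF q bump_has_derivative[unfolded has_field_derivative_def]])
      have Te: "((\<lambda>x. T x \<bullet> e) has_derivative (\<lambda>v. T' x v \<bullet> e)) (at x)"
        by (rule has_derivative_inner_left[OF T_has_derivative[OF x]])
      have "((\<lambda>x. bump (x \<bullet> x) * (F x * (T x \<bullet> e))) has_derivative
        (\<lambda>v. bump (x \<bullet> x) * (F x * (T' x v \<bullet> e) + F' x v * (T x \<bullet> e)) +
          (2 * max 0 ((x \<bullet> x - 1) * (4 - x \<bullet> x)) * (5 - 2 * (x \<bullet> x))) * (2 * (x \<bullet> v)) * (F x * (T x \<bullet> e)))) (at x)"
        by (rule has_derivative_mult[OF b has_derivative_mult[OF F_deriv[OF x] Te]])
      then show ?thesis unfolding \<phi>'_def[abs_def] by (simp only: add.commute)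
    qed
    have "continuous_on (ball 0 1 \<union> - {0}) (\<lambda>x. \<phi>' e x e)"
    proof (rule continuous_on_open_Un)
      show "continuous_on (ball 0 1) (\<lambda>x. \<phi>' e x e)"
        by (rule continuous_on_eq[OF continuous_on_const[of _ 0]]) (simp add: \<phi>'0)
      show "continuous_on (- {0}) (\<lambda>x. \<phi>' e x e)"
        unfolding \<phi>'_def by (intro continuous_intros continuous_bump F_cont F'_cont T_cont T'_cont)
    qed (auto simp: open_Compl)
    moreover have "ball 0 1 \<union> - {0} = (UNIV :: (real^'d) set)" by auto
    ultimately have c: "continuous_on UNIV (\<lambda>x. \<phi>' e x e)" by simp
    have s: "bump (x \<bullet> x) * (F x * (T x \<bullet> e)) = 0" if "2 \<le> norm x" for x
    proof -
      have "2\<^sup>2 \<le> (norm x)\<^sup>2" using that by (rule power_mono) simp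
      then show ?thesis by (simp add: dot_square_norm bump_eq_0)
    qed
    show "integrable lborel (\<lambda>x. \<phi>' e x e)" "(\<integral>x. \<phi>' e x e \<partial>lborel) = 0"
      using integral_derivative_compact_support[OF d c s] by simp_all
  qed
  have sum: "(\<Sum>e\<in>Basis. \<phi>' e x e) = bump ((norm x)\<^sup>2) / norm x * ((g x + F x * ev_sum x) - n * (F x * u x))" for x
  proof (cases "norm x < 1")
    case True
    then show ?thesis using \<phi>'0[OF True] inner1[OF True] by (simp add: bump_eq_0 dot_square_norm)
  next
    case False
    then have x: "x \<noteq> 0" by auto
    let ?c = "(2 * max 0 ((x \<bullet> x - 1) * (4 - x \<bullet> x)) * (5 - 2 * (x \<bullet> x)))"
    have "(\<Sum>e\<in>Basis. \<phi>' e x e) = (\<Sum>e\<in>Basis. (2 * ?c * F x) * ((x \<bullet> e) * (T x \<bullet> e)) + (bump (x \<bullet> x) * F x) * (T' x e \<bullet> e) + bump (x \<bullet> x) * ((T x \<bullet> e) * F' x e))"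
      unfolding \<phi>'_def by (intro sum.cong refl) (simp add: distrib_left mult_ac)
    also have "\<dots> = (2 * ?c * F x) * (\<Sum>e\<in>Basis. (x \<bullet> e) * (T x \<bullet> e)) + (bump (x \<bullet> x) * F x) * (\<Sum>e\<in>Basis. T' x e \<bullet> e) + bump (x \<bullet> x) * (\<Sum>e\<in>Basis. (T x \<bullet> e) * F' x e)"
      by (simp only: sum.distrib sum_distrib_left)
    also have "(\<Sum>e\<in>Basis. (x \<bullet> e) * (T x \<bullet> e)) = 0"
      using inner_T[OF x] by (simp only: euclidean_inner[symmetric])
    also have "(\<Sum>e\<in>Basis. T' x e \<bullet> e) = (ev_sum x - n * u x) / norm x" by (rule trace_T'[OF x])
    also have "(\<Sum>e\<in>Basis. (T x \<bullet> e) * F' x e) = g x / norm x" using x by (simp add: F'T[OF x, symmetric] g(1))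
    finally show ?thesis by (simp add: dot_square_norm algebra_simps add_divide_distrib diff_divide_distrib)
  qed
  show "ball_integral (\<lambda>x. g x + F x * ev_sum x) = ball_integral (\<lambda>x. n * (F x * u x))"
  proof (rule bump_weight_balance)
    show "(\<integral>x. bump ((norm x)\<^sup>2) / norm x * ((g x + F x * ev_sum x) - n * (F x * u x)) \<partial>lborel) = 0"
      unfolding sum[symmetric] by (subst Bochner_Integration.integral_sum) (simp_all add: zero)
    show "\<bar>g x + F x * ev_sum x\<bar> \<le> \<bar>G\<bar> + \<bar>B\<bar> * C" for x
    proof (cases "x = 0")
      case False
      have "g x \<le> \<bar>G\<bar>" using G[OF False] False by (simp add: g(1))
      moreover have "F x * ev_sum x \<le> \<bar>B\<bar> * C"
        using B[OF False] C F_nonneg ev_sum_nonneg by (intro mult_mono) auto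
      ultimately show ?thesis using g(2) F_nonneg ev_sum_nonneg by simp
    qed (use C in \<open>simp add: g(1) ev_sum_def\<close>)
    show "\<bar>n * (F x * u x)\<bar> \<le> n * (\<bar>B\<bar> * C)" for x
    proof (cases "x = 0")
      case False
      have "F x * u x \<le> \<bar>B\<bar> * C" using B[OF False] C F_nonneg u_nonneg by (intro mult_mono) auto
      then show ?thesis using F_nonneg u_nonneg by (simp add: mult_left_mono)
    qed (use C in \<open>simp add: u_def\<close>)
  qed (use g(2) F_nonneg ev_sum_nonneg u_nonneg in \<open>auto simp: gs F_scale ev_sum_scale u_scale\<close>)
qed

text \<open>Logarithmic differentiation of \<open>u^a r^b\<close>. Together with the equation it
  supplies the gradient of the curvature function from \<open>h\<close>, \<open>X\<close> and
  \<open>A\<close> alone.\<close>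

lemma powr_has_derivative_at:
  fixes a b :: real
  assumes x: "x \<noteq> 0"
  defines "F \<equiv> \<lambda>x. (h x / norm x) powr a * norm (X x) powr b"
  shows "(F has_derivative (\<lambda>v. F x * (a * (T x \<bullet> v) / h x + b * (X x \<bullet> A x v) / (X x \<bullet> X x)))) (at x)"
proof -
  have X0: "X y \<noteq> 0" if "y \<noteq> 0" for y using h_pos[OF that] h_eq[OF that] by auto
  have hp: "0 < h x" and xx: "0 < x \<bullet> x" and XX: "0 < X x \<bullet> X x" using x X0[OF x] h_pos by simp_all
  have Fexp: "F y = exp (a * (ln (h y) - ln (y \<bullet> y) / 2) + b * (ln (X y \<bullet> X y) / 2))" if y: "y \<noteq> 0" for y
  proof -
    have n: "ln (norm y) = ln (y \<bullet> y) / 2" if "y \<noteq> 0" for y :: "real^'d"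
      using that by (simp add: dot_square_norm ln_realpow)
    show ?thesis
      unfolding F_def powr_def using y X0[OF y] h_pos[OF y] by (simp add: ln_div n exp_add[symmetric])
  qed
  have "((\<lambda>y. a * (ln (h y) - ln (y \<bullet> y) / 2) + b * (ln (X y \<bullet> X y) / 2)) has_derivative
     (\<lambda>v. a * (T x \<bullet> v) / h x + b * (X x \<bullet> A x v) / (X x \<bullet> X x))) (at x)"
  proof -
    have 1: "((\<lambda>y. ln (h y)) has_derivative (\<lambda>v. (X x \<bullet> v) / h x)) (at x)"
      using has_derivative_ln[OF hp h_deriv[OF x]] by (simp add: divide_inverse)
    have 2: "((\<lambda>y. ln (y \<bullet> y)) has_derivative (\<lambda>v. 2 * (x \<bullet> v) / (x \<bullet> x))) (at x)"
      by (rule has_derivative_eq_rhs[OF has_derivative_ln[OF xx has_derivative_inner[OF has_derivative_ident has_derivative_ident]]])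
        (simp add: fun_eq_iff divide_inverse inner_commute)
    have 3: "((\<lambda>y. ln (X y \<bullet> X y)) has_derivative (\<lambda>v. 2 * (X x \<bullet> A x v) / (X x \<bullet> X x))) (at x)"
      by (rule has_derivative_eq_rhs[OF has_derivative_ln[OF XX has_derivative_inner[OF X_deriv[OF x] X_deriv[OF x]]]])
        (simp add: fun_eq_iff divide_inverse inner_commute)
    have "((\<lambda>y. a * (ln (h y) - ln (y \<bullet> y) / 2) + b * (ln (X y \<bullet> X y) / 2)) has_derivative
      (\<lambda>v. a * ((X x \<bullet> v) / h x - (2 * (x \<bullet> v) / (x \<bullet> x)) / 2) + b * ((2 * (X x \<bullet> A x v) / (X x \<bullet> X x)) / 2))) (at x)"
      by (intro has_derivative_add has_derivative_mult_right has_derivative_diff bounded_linear.has_derivative[OF bounded_linear_divide] 1 2 3)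
    moreover have "(X x \<bullet> v) / h x - (2 * (x \<bullet> v) / (x \<bullet> x)) / 2 = (T x \<bullet> v) / h x" for v
      using hp xx by (simp add: T_def inner_diff_left diff_divide_distrib)
    ultimately show ?thesis by simp
  qed
  then have "((\<lambda>y. exp (a * (ln (h y) - ln (y \<bullet> y) / 2) + b * (ln (X y \<bullet> X y) / 2))) has_derivative
     (\<lambda>v. F x * (a * (T x \<bullet> v) / h x + b * (X x \<bullet> A x v) / (X x \<bullet> X x)))) (at x)"
    using Fexp[OF x] by (auto dest!: has_derivative_exp simp: mult.commute)
  then show ?thesis
    by (rule has_derivative_transform_within_open[of _ _ _ _ "- {0}"]) (use x Fexp in \<open>auto simp: open_Compl\<close>)
qed

text \<open>\<open>X\<close> and \<open>T\<close> differ by a radial vector, which is orthogonal to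
  the range of \<open>A x\<close>. The contribution of \<open>r\<close> thereby becomes a
  nonnegative quadratic form.\<close>

lemma inner_X_A_T:
  assumes x: "x \<noteq> 0"
  shows "X x \<bullet> A x (T x) = A x (T x) \<bullet> T x"
proof -
  have "X x = T x + (h x / (x \<bullet> x)) *\<^sub>R x" by (simp add: T_def)
  then have "A x (T x) \<bullet> X x = A x (T x) \<bullet> T x + (h x / (x \<bullet> x)) * (A x (T x) \<bullet> x)"
    by (metis inner_add_right inner_scaleR_right)
  also have "A x (T x) \<bullet> x = 0" using A_sym[OF x, of "T x" x] A_self[OF x] by simp
  finally show ?thesis by (simp add: inner_commute)
qed

text \<open>The logarithmic derivative of \<open>h / norm\<close> is
  \<open>T \<bullet> v / h\<close>. The quotient is therefore constant on the punctured space, which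
  is connected in dimension at least two.\<close>

lemma T_eq_0_imp_sphere:
  assumes T: "\<And>x. x \<noteq> 0 \<Longrightarrow> T x = 0"
  shows "\<exists>R>0. \<forall>z. norm z = 1 \<longrightarrow> X z = R *\<^sub>R z"
proof -
  have d: "((\<lambda>x. h x / norm x) has_derivative (\<lambda>v. 0)) (at x)" if x: "x \<noteq> 0" for x
  proof -
    have "X y \<noteq> 0" if "y \<noteq> 0" for y using h_pos[OF that] h_eq[OF that] by auto
    then have "(h y / norm y) powr 1 * norm (X y) powr 0 = h y / norm y" if "y \<noteq> 0" for y
      using h_pos[OF that] that by simp
    moreover have "((\<lambda>x. (h x / norm x) powr 1 * norm (X x) powr 0) has_derivative (\<lambda>v. 0)) (at x)"
      using powr_has_derivative_at[OF x, of 1 0] T[OF x] by (simp only: inner_zero_left mult_zero_left mult_zero_right div_0 add_0)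
    ultimately show ?thesis
      using x by (elim has_derivative_transform_within_open[where s = "- {0}"]) (simp_all add: open_Compl)
  qed
  have "connected (- {0 :: real^'d})"
    by (rule connected_punctured_universe) (use DIM_eq n_pos in simp)
  then have "(\<lambda>x. h x / norm x) constant_on (- {0})"
    by (rule has_derivative_zero_connected_constant_on[where K = "{}"])
      (use d u_cont in \<open>auto simp: open_Compl intro: has_derivative_at_withinI\<close>)
  then obtain R where R: "\<And>x. x \<noteq> 0 \<Longrightarrow> h x / norm x = R" by (auto simp: constant_on_def)
  obtain e :: "real^'d" where e: "norm e = 1" using vector_choose_size[of 1] by auto
  then have "e \<noteq> 0" by auto
  then have "0 < R" using R[of e] h_pos[of e] e by simp
  moreover have "X z = R *\<^sub>R z" if z: "norm z = 1" for z
  proof -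
    have "z \<noteq> 0" using z by auto
    moreover have "z \<bullet> z = 1" using z by (simp add: norm_eq_1)
    ultimately show ?thesis using T[of z] R[of z] z by (simp add: T_def)
  qed
  ultimately show ?thesis by blast
qed

text \<open>\<open>g\<close> is the derivative of the curvature function along \<open>T\<close>,
  scaled to degree zero. The divergence identity and the opposite integral inequality force the
  nonnegative \<open>g\<close> to have integral zero. Since \<open>a\<close> or \<open>b\<close> is
  positive, \<open>g\<close> can vanish only where \<open>T\<close> does. The constant
  \<open>c\<close> accounts for a binomial coefficient.\<close>

lemma sphere_if_curvature_equation:
  assumes k: "1 \<le> k" "k \<le> n" and ab: "0 \<le> a" "0 \<le> b" "0 < a \<or> 0 < b" and c: "0 < c"
    and eq: "\<And>z. norm z = 1 \<Longrightarrow> E k z = c * (h z powr a * norm (X z) powr b)"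
  shows "\<exists>R>0. \<forall>z. norm z = 1 \<longrightarrow> X z = R *\<^sub>R z"
proof (rule T_eq_0_imp_sphere)
  have X0: "X y \<noteq> 0" if "y \<noteq> 0" for y using h_pos[OF that] h_eq[OF that] by auto
  define f where "f x v = a * (T x \<bullet> v) / h x + b * (X x \<bullet> A x v) / (X x \<bullet> X x)" for x v
  define g where "g x = (if x = 0 then 0 else norm x * (E k x * f x (T x)))" for x
  have Eeq: "E k x = c * ((h x / norm x) powr a * norm (X x) powr b)" if x: "x \<noteq> 0" for x
  proof -
    have 1: "norm (x /\<^sub>R norm x) = 1" using x by simp
    have "x /\<^sub>R norm x \<noteq> 0" using x by simp
    then have "E k x = E k (x /\<^sub>R norm x)" using E_scale[of "inverse (norm x)" x] x by simp
    also have "\<dots> = c * (h (x /\<^sub>R norm x) powr a * norm (X (x /\<^sub>R norm x)) powr b)" by (rule eq[OF 1])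
    also have "h (x /\<^sub>R norm x) = h x / norm x" using x h_scale[of "inverse (norm x)" x] by (simp add: field_simps)
    also have "X (x /\<^sub>R norm x) = X x" using x X_scale[of "inverse (norm x)" x] by simp
    finally show ?thesis .
  qed
  have E_pos: "0 < E k x" if "x \<noteq> 0" for x
    unfolding Eeq[OF that] using c h_pos[OF that] X0[OF that] that by simp
  \<comment> \<open>\<open>E k\<close> is built from second derivatives of \<open>h\<close>; the
    equation makes it differentiable by expressing it through \<open>h\<close> and
    \<open>X\<close>.\<close>
  have deriv: "(E k has_derivative (\<lambda>v. E k x * f x v)) (at x)" if x: "x \<noteq> 0" for x
  proof -
    have "((\<lambda>x. c * ((h x / norm x) powr a * norm (X x) powr b)) has_derivative
      (\<lambda>v. c * ((h x / norm x) powr a * norm (X x) powr b * f x v))) (at x)"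
      unfolding f_def by (rule has_derivative_mult_right[OF powr_has_derivative_at[OF x]])
    then have "(E k has_derivative (\<lambda>v. c * ((h x / norm x) powr a * norm (X x) powr b * f x v))) (at x)"
      by (rule has_derivative_transform_within_open[of _ _ _ _ "- {0}"]) (use x Eeq in \<open>auto simp: open_Compl\<close>)
    then show ?thesis by (simp add: Eeq[OF x] mult.assoc)
  qed
  have f_T: "f x (T x) = a * (T x \<bullet> T x) / h x + b * (A x (T x) \<bullet> T x) / (X x \<bullet> X x)" if "x \<noteq> 0" for x
    by (simp add: f_def inner_X_A_T[OF that])
  have A_T: "0 < A x (T x) \<bullet> T x" if "x \<noteq> 0" "T x \<noteq> 0" for x
    using A_pos[OF that inner_T[OF that(1)]] .
  have f_nonneg: "0 \<le> f x (T x)" if x: "x \<noteq> 0" for x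
  proof (cases "T x = 0")
    case False
    then show ?thesis
      unfolding f_T[OF x] using ab h_pos[OF x] A_T[OF x False]
      by (intro add_nonneg_nonneg divide_nonneg_nonneg mult_nonneg_nonneg) auto
  qed (use linear_0[OF A_linear[OF x]] in \<open>simp add: f_def\<close>)
  have f_pos: "0 < f x (T x)" if x: "x \<noteq> 0" and T: "T x \<noteq> 0" for x
  proof -
    have "0 \<le> a * (T x \<bullet> T x) / h x" "0 \<le> b * (A x (T x) \<bullet> T x) / (X x \<bullet> X x)"
      using ab h_pos[OF x] A_T[OF x T] by (auto intro!: divide_nonneg_nonneg mult_nonneg_nonneg)
    moreover have "0 < a * (T x \<bullet> T x) / h x" if "0 < a" using that h_pos[OF x] T by simp
    moreover have "0 < b * (A x (T x) \<bullet> T x) / (X x \<bullet> X x)" if "0 < b" using that A_T[OF x T] X0[OF x] by simp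
    ultimately show ?thesis unfolding f_T[OF x] using ab(3) by linarith
  qed
  have g_nonneg: "0 \<le> g x" for x using f_nonneg E_nonneg by (simp add: g_def)
  have E_cont: "continuous_on (- {0}) (E k)"
    by (intro continuous_at_imp_continuous_on ballI has_derivative_continuous[OF deriv]) auto
  have h0: "h x \<noteq> 0" if "x \<noteq> 0" for x using h_pos[OF that] by simp
  have f_cont: "continuous_on (- {0}) (\<lambda>x. E k x * f x v)" for v
    unfolding f_def by (intro continuous_intros E_cont T_cont h_cont X_cont A_cont) (use h0 X0 in auto)
  note identity = divergence_identity[where F = "E k" and F' = "\<lambda>x v. E k x * f x v" and g = g,
      OF deriv f_cont E_scale E_nonneg E_measurable[OF k(2)] g_def g_nonneg]
  have div: "ball_integral (\<lambda>x. g x + E k x * ev_sum x) = ball_integral (\<lambda>x. n * (E k x * u x))"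
    "continuous_on (- {0}) (\<lambda>x. norm x * (E k x * f x (T x)))"
    "\<And>c x. 0 < c \<Longrightarrow> x \<noteq> 0 \<Longrightarrow> g (c *\<^sub>R x) = g x" "g \<in> borel_measurable borel"
    by (rule identity; simp)+
  obtain G where G: "\<And>x. \<bar>g x\<bar> \<le> G"
  proof -
    obtain G where "\<And>x. x \<noteq> 0 \<Longrightarrow> \<bar>norm x * (E k x * f x (T x))\<bar> \<le> G"
      using homogeneous_bounded[OF div(2)] div(3) by (auto simp: g_def)
    then have "\<bar>g x\<bar> \<le> \<bar>G\<bar>" for x by (cases "x = 0") (fastforce simp: g_def)+
    then show thesis by (rule that)
  qed
  have "ball_integral g \<le> 0"
  proof (rule uE_bounded)
    fix C assume C: "\<And>x k. k \<le> n \<Longrightarrow> \<bar>ev_sum x * E k x\<bar> \<le> C * C"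
    have "ball_integral (\<lambda>x. g x + E k x * ev_sum x) = ball_integral g + ball_integral (\<lambda>x. ev_sum x * E k x)"
    proof -
      have "(\<lambda>x. ev_sum x * E k x) \<in> borel_measurable borel" using k(2) by (auto intro!: borel_measurable_times)
      from ball_integral_add[OF div(4) G this C[OF k(2)]] show ?thesis by (simp only: mult.commute)
    qed
    moreover have "ball_integral (\<lambda>x. n * (E k x * u x)) = n * ball_integral (\<lambda>x. u x * E k x)"
      unfolding ball_integral_cmult by (simp only: mult.commute)
    ultimately show ?thesis using div(1) minkowski_heintze_karcher[OF k] by linarith
  qed
  moreover have int: "integrable lborel (\<lambda>x. indicator (ball 0 1) x * g x)"
    by (rule ball_integrable[OF div(4) G])
  moreover have nn: "AE x in lborel. 0 \<le> indicator (ball 0 1) x * g x" using g_nonneg by simp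
  ultimately have "(\<integral>x. indicator (ball 0 1) x * g x \<partial>lborel) = 0"
    unfolding ball_integral_def using integral_nonneg_AE[OF nn] by linarith
  then have "AE x in lborel. indicator (ball 0 1) x * g x = 0"
    using integral_nonneg_eq_0_iff_AE[OF int nn] by simp
  then have AE: "AE x in lebesgue. indicator (ball 0 1) x * g x = 0" by (rule AE_completion)
  \<comment> \<open>The zero set is relatively closed, so vanishing almost everywhere in the ball
    becomes vanishing everywhere in it. An arbitrary \<open>x\<close> is scaled to norm one half to
    enter the ball, and degree zero carries the conclusion back.\<close>
  have "closedin (top_of_set (- {0})) {x \<in> - {0}. norm x * (E k x * f x (T x)) = 0}"
    by (rule continuous_closedin_preimage_constant[OF div(2)])
  then obtain S where S: "closed S" "{x \<in> - {0}. norm x * (E k x * f x (T x)) = 0} = - {0} \<inter> S"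
    by (auto simp: closedin_closed)
  have S_iff: "f x (T x) = 0 \<longleftrightarrow> x \<in> S" if x: "x \<noteq> 0" for x
  proof -
    have "x \<in> {x \<in> - {0}. norm x * (E k x * f x (T x)) = 0} \<longleftrightarrow> x \<in> - {0} \<inter> S" by (simp only: S(2))
    then show ?thesis using x E_pos[OF x] by simp
  qed
  fix x :: "real^'d" assume x: "x \<noteq> 0"
  let ?y = "x /\<^sub>R (2 * norm x)"
  have y: "?y \<noteq> 0" "norm ?y < 1" using x by auto
  have "?y \<in> S"
  proof (rule mem_closed_if_AE_lebesgue_open[OF _ S(1)])
    show "open (ball 0 1 - {0 :: real^'d})" by (intro open_Diff) auto
    show "AE y\<in>ball 0 1 - {0} in lebesgue. y \<in> S"
      using AE
    proof eventually_elim
      fix y :: "real^'d"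
      assume "indicator (ball 0 1) y * g y = 0"
      then have "f y (T y) = 0" if "y \<in> ball 0 1 - {0}" using that E_pos[of y] by (simp add: g_def)
      then show "y \<in> ball 0 1 - {0} \<longrightarrow> y \<in> S" using S_iff[of y] by simp
    qed
  qed (use y in auto)
  then have "f ?y (T ?y) = 0" using S_iff[OF y(1)] by simp
  then have "T ?y = 0" using f_pos[OF y(1)] by (metis less_irrefl)
  then show "T x = 0" using T_scale[of "inverse (2 * norm x)" x] x by simp
qed

end

section \<open>The support function of a smooth convex body\<close>

text \<open>A derivative within the sphere is determined on tangent vectors only; there any known
  derivative may replace the chosen one.\<close>

lemma frechet_derivative_unit_sphere:
  fixes z :: "'a::euclidean_space"
  assumes z: "norm z = 1" and f: "(f has_derivative f') (at z within sphere 0 1)" and v: "v \<bullet> z = 0"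
  shows "frechet_derivative f (at z within sphere 0 1) v = f' v"
proof -
  have "(f has_derivative frechet_derivative f (at z within sphere 0 1)) (at z within sphere 0 1)"
    using f frechet_derivative_works by (auto simp: differentiable_def)
  then show ?thesis by (rule tangential_derivative_unique[OF _ f tangential_unit_sphere[OF z v]])
qed

text \<open>The tangential projection of the ambient gradient has the defining property, and two
  tangent vectors with equal products against all tangent vectors coincide.\<close>

lemma sphere_grad_eqI:
  assumes z: "norm z = 1" and f: "(f has_derivative (\<lambda>v. g \<bullet> v)) (at z)"
  shows "sphere_grad f z = g - (g \<bullet> z) *\<^sub>R z"
  unfolding sphere_grad_def
proof (rule the_equality)
  have zz: "z \<bullet> z = 1" using z by (simp add: norm_eq_1)
  have fr: "frechet_derivative f (at z within unit_sphere) v = g \<bullet> v" if "v \<in> sphere_tangent z" for v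
    using frechet_derivative_unit_sphere[OF z has_derivative_at_withinI[OF f]] that by (simp add: sphere_tangent_def)
  show proj: "g - (g \<bullet> z) *\<^sub>R z \<in> sphere_tangent z \<and>
      (\<forall>v\<in>sphere_tangent z. (g - (g \<bullet> z) *\<^sub>R z) \<bullet> v = frechet_derivative f (at z within unit_sphere) v)"
    using fr zz by (simp add: sphere_tangent_def inner_diff_left inner_diff_right inner_commute)
  fix g' assume g': "g' \<in> sphere_tangent z \<and> (\<forall>v\<in>sphere_tangent z. g' \<bullet> v = frechet_derivative f (at z within unit_sphere) v)"
  define d where "d = g' - (g - (g \<bullet> z) *\<^sub>R z)"
  have d: "d \<in> sphere_tangent z" using g' proj by (simp add: d_def sphere_tangent_def inner_diff_left)
  have "g' \<bullet> d = (g - (g \<bullet> z) *\<^sub>R z) \<bullet> d" using g' proj d by metis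
  then have "d \<bullet> d = 0" by (simp only: d_def inner_diff_left)
  then show "g' = g - (g \<bullet> z) *\<^sub>R z" by (simp add: d_def)
qed

lemma form_eigenvalues_cong:
  assumes "\<And>v w. v \<in> T \<Longrightarrow> w \<in> T \<Longrightarrow> B v w = B' v w"
  shows "form_eigenvalues T B = form_eigenvalues T B'"
proof -
  have "form_eigenspace T B l = form_eigenspace T B' l" for l
    using assms by (auto simp: form_eigenspace_def)
  then show ?thesis by (simp add: form_eigenvalues_def)
qed

context smooth_convex_body
begin

lemma sphere_grad_support_function:
  assumes z: "norm z = 1"
  shows "sphere_grad (support_function K) z = contact z - support_function K z *\<^sub>R z"
proof -
  have z0: "z \<noteq> 0" using z by auto
  show ?thesis
    using sphere_grad_eqI[OF z support_function_has_derivative[OF z0]] z0 by (simp add: support_function_eq)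
qed

lemma inverse_gauss_map_support_function:
  "norm z = 1 \<Longrightarrow> inverse_gauss_map (support_function K) z = contact z"
  by (simp add: inverse_gauss_map_def sphere_grad_support_function)

text \<open>The field \<open>contact x - h(x) x\<close>, with \<open>h\<close> the support function,
  agrees with the gradient field on the sphere, which suffices for derivatives within it.
  Differentiating the product gives a radial term, which the connection projects away, and
  \<open>- h(z) v\<close>, which cancels the zeroth order term of \<open>W\<close>.\<close>

lemma W_form_support_function:
  assumes z: "norm z = 1" and v: "v \<in> sphere_tangent z" and w: "w \<in> sphere_tangent z"
  shows "W_form (support_function K) z v w = contact_deriv z v \<bullet> w"
proof -
  let ?h = "support_function K"
  let ?Y' = "\<lambda>v. contact_deriv z v - (?h z *\<^sub>R v + (contact z \<bullet> v) *\<^sub>R z)"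
  have z0: "z \<noteq> 0" using z by auto
  have "((\<lambda>x. contact x - ?h x *\<^sub>R x) has_derivative ?Y') (at z)"
    by (rule has_derivative_diff[OF contact_has_derivative[OF z0]
        has_derivative_scaleR[OF support_function_has_derivative[OF z0] has_derivative_ident]])
  then have "((\<lambda>x. contact x - ?h x *\<^sub>R x) has_derivative ?Y') (at z within unit_sphere)"
    by (rule has_derivative_at_withinI)
  then have "(sphere_grad ?h has_derivative ?Y') (at z within unit_sphere)"
    by (rule has_derivative_transform[rotated 2]) (use z sphere_grad_support_function in auto)
  from frechet_derivative_unit_sphere[OF z this]
  have "frechet_derivative (sphere_grad ?h) (at z within unit_sphere) v = ?Y' v"
    using v by (simp add: sphere_tangent_def)
  then have "sphere_hessian ?h z v w = (?Y' v - (?Y' v \<bullet> z) *\<^sub>R z) \<bullet> w"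
    by (simp only: sphere_hessian_def sphere_connection_def Let_def)
  also have "\<dots> = contact_deriv z v \<bullet> w - ?h z * (v \<bullet> w)"
    using w by (simp add: sphere_tangent_def inner_diff_left inner_add_left inner_commute[of w])
  finally show ?thesis by (simp add: W_form_def)
qed

end

theorem corollary1p5:
  fixes M K :: "(real ^ 'd) set" and n k :: nat and p q :: real
    and u r :: "real ^ 'd \<Rightarrow> real"
  assumes "CARD('d) = n + 1" and "n \<ge> 2" and "1 \<le> k" and "k \<le> n"
    and "p \<ge> 1" and "q \<le> real k + 1" and "p > 1 \<or> q < real k + 1"
    and "smooth_strictly_convex_around_0 M K"
    and "u = support_function K" and "r = radial_function u"
    and "\<forall>z\<in>unit_sphere. u z powr (1 - p) * r z powr (q - real k - 1) * P_W n k u z = 1"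
  shows "\<exists>R>0. M = sphere 0 R"
proof -
  note dim = assms(1) and n = assms(2) and k = assms(3,4) and pq = assms(5-7) and hyp = assms(8)
    and u = assms(9) and r = assms(10) and eq = assms(11)
  interpret smooth_convex_body M K by unfold_locales (rule hyp)
  interpret S: support_gradient "support_function K" contact contact_deriv n
  proof
    fix x v w y :: "real^'d" and c :: real
    show "(support_function K has_derivative (\<lambda>v. contact x \<bullet> v)) (at x)" if "x \<noteq> 0"
      using that by (rule support_function_has_derivative)
    show "(contact has_derivative contact_deriv x) (at x)" if "x \<noteq> 0" using that by (rule contact_has_derivative)
    show "continuous_on (- {0}) (\<lambda>x. contact_deriv x v)" by (rule continuous_contact_deriv)
    show "contact_deriv x v \<bullet> w = v \<bullet> contact_deriv x w" if "x \<noteq> 0" using that by (rule contact_deriv_symmetric)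
    show "contact_deriv x x = 0" if "x \<noteq> 0" using that by (rule contact_deriv_self)
    show "0 < contact_deriv x v \<bullet> v" if "x \<noteq> 0" "v \<noteq> 0" "x \<bullet> v = 0" using that by (rule contact_deriv_pos)
    show "contact (c *\<^sub>R x) = contact x" if "0 < c" using that by (rule contact_scale)
    show "support_function K x = contact x \<bullet> x" if "x \<noteq> 0" using that by (rule support_function_eq)
    show "0 < support_function K x" if "x \<noteq> 0" using support_function_pos[OF that] that by (simp add: support_function_eq)
    show "contact y \<bullet> x \<le> support_function K x" if "x \<noteq> 0" "y \<noteq> 0"
      using inner_le_contact[of x "contact y"] contact(1)[OF that(2)] M_subset that by (auto simp: support_function_eq)
    show "inj_on contact (sphere 0 1)" by (rule inj_on_contact)
  qed (use dim n in auto)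
  have P: "P_W n k u z = S.E k z / (n choose k)" if z: "norm z = 1" for z
  proof -
    have z0: "z \<noteq> 0" using z by auto
    have "{v. v \<bullet> (z /\<^sub>R norm z) = 0} = sphere_tangent z" using z by (simp add: sphere_tangent_def)
    then have "S.ev z = form_eigenvalues (sphere_tangent z) (\<lambda>v w. contact_deriv z v \<bullet> w)"
      using z by (simp add: S.ev_def)
    also have "\<dots> = form_eigenvalues (sphere_tangent z) (W_form u z)"
      unfolding u by (rule form_eigenvalues_cong) (rule W_form_support_function[OF z, symmetric])
    finally have "S.ev z = form_eigenvalues (sphere_tangent z) (W_form u z)" .
    then show ?thesis using z0 by (simp add: P_W_def normalized_esym_def S.E_def esym_def)
  qed
  have rz: "r z = norm (contact z)" if "norm z = 1" for z
    using inverse_gauss_map_support_function[OF that] by (simp add: r u radial_function_def)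
  have "\<exists>R>0. \<forall>z. norm z = 1 \<longrightarrow> contact z = R *\<^sub>R z"
  \<comment> \<open>The equation solved for the curvature function: the exponents change sign, and
    \<open>n choose k\<close> converts the normalized symmetric function into the plain one.\<close>
  proof (rule S.sphere_if_curvature_equation[OF k, of "p - 1" "k + 1 - q" "n choose k"])
    fix z :: "real^'d" assume z: "norm z = 1"
    have z0: "z \<noteq> 0" using z by auto
    have uz: "0 < u z" using z0 S.h_pos u by simp
    have "contact z \<noteq> 0" using S.h_pos[OF z0] S.h_eq[OF z0] by auto
    then have "0 < r z" using rz[OF z] by simp
    let ?P = "u z powr (p - 1) * r z powr (k + 1 - q)"
    have "?P = ?P * (u z powr (1 - p) * r z powr (q - real k - 1) * P_W n k u z)" using eq z by simp
    also have "\<dots> = (u z powr (p - 1) * u z powr (1 - p)) * (r z powr (k + 1 - q) * r z powr (q - real k - 1)) * P_W n k u z"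
      by (simp only: mult_ac)
    also have "\<dots> = P_W n k u z" using uz \<open>0 < r z\<close> by (simp add: powr_add[symmetric])
    finally have "P_W n k u z = ?P" by simp
    moreover have "0 < real (n choose k)" using k by simp
    ultimately show "S.E k z = real (n choose k) * (support_function K z powr (p - 1) * norm (contact z) powr (k + 1 - q))"
      using P[OF z] by (simp add: u[symmetric] rz[OF z, symmetric] field_simps)
  qed (use pq k in auto)
  then obtain R where R: "0 < R" "\<forall>z. norm z = 1 \<longrightarrow> contact z = R *\<^sub>R z" by (elim exE conjE)
  have "contact ` sphere 0 1 = (\<lambda>z. R *\<^sub>R z) ` sphere 0 1"
    by (rule image_cong) (use R(2) in auto)
  also have "\<dots> = sphere 0 R" using R(1) sphere_scale[of R 0 1] by simp
  finally have "M = sphere 0 R" by (simp only: contact_image)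
  then show ?thesis using R(1) by blast
qed

end
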